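(* Let $u, v \in F_2$ with $\|u\| \ge \|v\|$, and let $\Omega$ be the set of all chains of type (C1) or (C2) of length less than or equal to $2\|u\|+5$. Let $\Omega_1$ be the subset of $\Omega$ consisting of all chains of type (C1), and let $\Omega_2$ be the subset of $\Omega$ consisting of all chains of type (C2). Put $k=\|u\|+1$. Suppose that $u$ and $v$ have the property that \[ \|\sigma^{k+1}\psi_1(u)\|=\|\sigma^k\psi_1(u)\| \text{ if and only if } \|\sigma^{k+1}\psi_1(v)\|=\|\sigma^k\psi_1(v)\|, \] \[ \|\tau^{k+1}\psi_1(u)\|=\|\tau^k\psi_1(u)\| \text{ if and only if } \|\tau^{k+1}\psi_1(v)\|=\|\tau^k\psi_1(v)\| \] for every $\psi_1\in\Omega_1$, and that \[ \|\sigma^{-k-1}\psi_2(u)\|=\|\sigma^{-k}\psi_2(u)\| \text{ if and only if } \|\sigma^{-k-1}\psi_2(v)\|=\|\sigma^{-k}\psi_2(v)\|, \] \[ \|\tau^{-k-1}\psi_2(u)\|=\|\tau^{-k}\psi_2(u)\| \text{ if and only if } \|\tau^{-k-1}\psi_2(v)\|=\|\tau^{-k}\psi_2(v)\| \] for every $\psi_2\in\Omega_2$. Then $u$ and $v$ are boundedly translation equivalent in $F_2$. More specifically, \[ \min\Delta \le \frac{\|\phi(u)\|}{\|\phi(v)\|}\le \max\Delta \] for every automorphism $\phi$ of $F_2$, where \[ \Delta:=\left\{\frac{\|\psi(u)\|}{\|\psi(v)\|},\ \frac{\|\alpha:\psi_1:u\|}{\|\alpha:\psi_1:v\|},\ \frac{\|\alpha^{-1}:\psi_2:u\|}{\|\alpha^{-1}:\psi_2:v\|}\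 \middle|\ \psi\in\Omega,\ \psi_i\in\Omega_i,\ \alpha=\sigma\text{ or }\tau\right\}. \] (Obviously, $\Delta$ is a finite set consisting of positive real numbers.)
   Context: $F_2$ is the free group with basis $\{a,b\}$. For $w\in F_2$, $\|w\|$ denotes the cyclic length of $w$, i.e. the length of a cyclically reduced word conjugate to $w$. Compositions act on the left: $\phi\psi(u)=\phi(\psi(u))$. Let $\sigma,\tau$ be the automorphisms of $F_2$ with $\sigma(a)=ab,\ \sigma(b)=b$ and $\tau(a)=a,\ \tau(b)=ba$. A chain of type (C1) is a composition $\tau^{m_r}\sigma^{l_r}\cdots\tau^{m_1}\sigma^{l_1}$, and a chain of type (C2) is a composition $\tau^{-m_r}\sigma^{-l_r}\cdots\tau^{-m_1}\sigma^{-l_1}$, with $r\in\mathbb{N}$ and all $l_i,m_i\ge 0$; the length of such a chain is $\sum_{i=1}^r(m_i+l_i)$. For $\beta\in\{\sigma^{\pm1},\tau^{\pm1}\}$, a chain $\psi$ and $w\in F_2$, define $\|\beta:\psi:w\|:=\max\{1,\ \|\beta\psi(w)\|-\|\psi(w)\|\}$. Two elements $u,v\in F_2$ are said to be boundedly translation equivalent in $F_2$ if there is $C>0$ such that $\frac1C\le\frac{\|\phi(u)\|}{\|\phi(v)\|}\le C$ for every automorphism $\phi$ of $F_2$. *)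

theory Defs
  imports Complex_Main "HOL-Algebra.Bij"
begin

datatype gen = Gen_a | Gen_b

text \<open>
  A letter \<open>(x, True)\<close> stands for the generator \<open>x\<close>, and \<open>(x, False)\<close> for its inverse.
\<close>

type_synonym letter = "gen \<times> bool"
type_synonym word = "letter list"

definition inv_letter :: "letter \<Rightarrow> letter"
  where "inv_letter l = (fst l, \<not> snd l)"

definition reduced :: "word \<Rightarrow> bool"
  where "reduced w \<longleftrightarrow> successively (\<lambda>x y. y \<noteq> inv_letter x) w"

fun push :: "letter \<Rightarrow> word \<Rightarrow> word"
  where
    "push x [] = [x]"
  | "push x (y # ys) = (if y = inv_letter x then ys else x # y # ys)"

text \<open>
  The elements are the reduced words; the product of two reduced words is obtained by
  multiplying the second one from the left by the letters of the first one, cancelling at each step.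
\<close>

definition F2 :: "word monoid"
  where "F2 = \<lparr>carrier = {w. reduced w}, mult = \<lambda>u v. foldr push u v, one = []\<rparr>"

definition elt_a :: word where "elt_a = [(Gen_a, True)]"
definition elt_b :: word where "elt_b = [(Gen_b, True)]"

lemma inv_letter_simps [simp]:
  "inv_letter (inv_letter x) = x" "inv_letter x \<noteq> x" "x \<noteq> inv_letter x"
  "inv_letter (g, s) = (g, \<not> s)"
  by (cases x; auto simp: inv_letter_def)+

lemma reduced_Nil [simp]: "reduced []"
  and reduced_single [simp]: "reduced [x]"
  and reduced_Cons: "reduced (x # w) \<longleftrightarrow> w = [] \<or> hd w \<noteq> inv_letter x \<and> reduced w"
  by (auto simp: reduced_def successively_Cons)

lemma reduced_append:
  "reduced (u @ v) \<longleftrightarrow>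
     reduced u \<and> reduced v \<and> (u = [] \<or> v = [] \<or> hd v \<noteq> inv_letter (last u))"
  by (auto simp: reduced_def successively_append_iff)

lemma reduced_ConsD: "reduced (x # w) \<Longrightarrow> reduced w"
  by (auto simp: reduced_Cons)

lemma reduced_push: "reduced w \<Longrightarrow> reduced (push x w)"
  by (cases w) (auto simp: reduced_Cons)

lemma push_eq_Cons: "reduced (x # w) \<Longrightarrow> push x w = x # w"
  by (cases w) (auto simp: reduced_Cons)

lemma push_push_inv: "reduced w \<Longrightarrow> push x (push (inv_letter x) w) = w"
  by (cases w) (auto simp: push_eq_Cons)

lemma reduced_foldr_push: "reduced v \<Longrightarrow> reduced (foldr push u v)"
  by (induction u) (auto intro: reduced_push)

lemma foldr_push_push:
  assumes "reduced w"
  shows "foldr push (push x v) w = push x (foldr push v w)"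
  using push_push_inv[OF reduced_foldr_push[OF assms]] by (cases v) auto

lemma foldr_push_assoc:
  assumes "reduced w"
  shows "foldr push (foldr push u v) w = foldr push u (foldr push v w)"
  using assms by (induction u) (auto simp: foldr_push_push)

lemma foldr_push_append: "reduced (u @ v) \<Longrightarrow> foldr push u v = u @ v"
proof (induction u)
  case (Cons x u)
  then have "reduced (u @ v)" "reduced (x # (u @ v))" by (auto dest: reduced_ConsD)
  then show ?case using Cons.IH push_eq_Cons by simp
qed simp

lemma foldr_push_inverse:
  assumes "reduced w"
  shows "foldr push (rev (map inv_letter w)) w = []"
  using assms
proof (induction w)
  case (Cons x w)
  have "push (inv_letter x) (x # w) = w" by simp
  then show ?case using Cons by (auto dest: reduced_ConsD)
qed simp

lemma reduced_inverse: "reduced w \<Longrightarrow> reduced (rev (map inv_letter w))"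
proof (induction w)
  case (Cons x w)
  then show ?case
    by (cases w) (auto simp: reduced_append reduced_Cons dest: arg_cong[of _ _ inv_letter])
qed simp

lemma F2_simps [simp]:
  "carrier F2 = {w. reduced w}" "u \<otimes>\<^bsub>F2\<^esub> v = foldr push u v" "\<one>\<^bsub>F2\<^esub> = []"
  by (simp_all add: F2_def)

interpretation F2: group F2
proof (rule groupI, goal_cases)
  case (3 x y z)
  then show ?case by (simp add: foldr_push_assoc)
next
  case (5 x)
  then show ?case
    by (intro bexI[of _ "rev (map inv_letter x)"]) (auto simp: foldr_push_inverse reduced_inverse)
qed (auto simp: reduced_foldr_push)

lemma F2_inv: "reduced w \<Longrightarrow> inv\<^bsub>F2\<^esub> w = rev (map inv_letter w)"
  by (rule F2.inv_equality) (auto simp: foldr_push_inverse reduced_inverse)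

lemma elt_in_carrier [simp]: "reduced elt_a" "reduced elt_b"
  by (simp_all add: elt_a_def elt_b_def)

definition eval_letter :: "('g, 'm) monoid_scheme \<Rightarrow> (gen \<Rightarrow> 'g) \<Rightarrow> letter \<Rightarrow> 'g"
  where "eval_letter G f l = (if snd l then f (fst l) else inv\<^bsub>G\<^esub> (f (fst l)))"

definition lift :: "('g, 'm) monoid_scheme \<Rightarrow> (gen \<Rightarrow> 'g) \<Rightarrow> word \<Rightarrow> 'g"
  where "lift G f w = foldr (\<lambda>l g. eval_letter G f l \<otimes>\<^bsub>G\<^esub> g) w \<one>\<^bsub>G\<^esub>"

context group
begin

context
  fixes f :: "gen \<Rightarrow> 'a"
  assumes f: "\<And>x. f x \<in> carrier G"
begin

lemma eval_letter_closed: "eval_letter G f l \<in> carrier G"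
  by (simp add: eval_letter_def f)

lemma eval_letter_inv: "eval_letter G f (inv_letter l) = inv (eval_letter G f l)"
  by (simp add: eval_letter_def inv_letter_def f)

lemma lift_closed: "lift G f w \<in> carrier G"
  by (induction w) (auto simp: lift_def eval_letter_closed)

lemma lift_Cons: "lift G f (x # w) = eval_letter G f x \<otimes> lift G f w"
  by (simp add: lift_def)

lemma lift_push: "lift G f (push x w) = eval_letter G f x \<otimes> lift G f w"
  by (cases w)
    (simp_all add: lift_Cons eval_letter_inv eval_letter_closed lift_closed m_assoc[symmetric])

lemma lift_hom: "lift G f \<in> hom F2 G"
proof -
  have "lift G f (foldr push u v) = lift G f u \<otimes> lift G f v" for u v
  proof (induction u)
    case Nil
    then show ?case by (simp add: lift_closed) (simp add: lift_def lift_closed)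
  next
    case (Cons x u)
    then show ?case by (simp add: lift_push lift_Cons eval_letter_closed lift_closed m_assoc)
  qed
  then show ?thesis by (auto simp: hom_def lift_closed)
qed

lemma lift_gen: "lift G f elt_a = f Gen_a" "lift G f elt_b = f Gen_b"
  by (simp_all add: lift_def elt_a_def elt_b_def eval_letter_def f)

end

lemma F2_hom_unique:
  assumes h: "h \<in> hom F2 G" and h': "h' \<in> hom F2 G"
    and "h elt_a = h' elt_a" "h elt_b = h' elt_b" and "reduced w"
  shows "h w = h' w"
proof -
  interpret h: group_hom F2 G h by unfold_locales (rule h)
  interpret h': group_hom F2 G h' by unfold_locales (rule h')
  have gen: "h [(x, True)] = h' [(x, True)]" for x
    using assms(3,4) by (cases x) (simp_all add: elt_a_def elt_b_def)
  have "h [l] = h' [l]" for l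
  proof (cases l)
    case (Pair x s)
    have "[(x, False)] = inv\<^bsub>F2\<^esub> [(x, True)]" by (simp add: F2_inv)
    then have "h [(x, False)] = h' [(x, False)]"
      using gen[of x] by (metis F2_simps(1) h.hom_inv h'.hom_inv mem_Collect_eq reduced_single)
    then show ?thesis using gen[of x] Pair by (cases s) auto
  qed
  note letter = this
  show ?thesis using \<open>reduced w\<close>
  proof (induction w)
    case Nil
    then show ?case using h.hom_one h'.hom_one by simp
  next
    case (Cons x w)
    then have w: "reduced w" by (auto dest: reduced_ConsD)
    have xw: "x # w = [x] \<otimes>\<^bsub>F2\<^esub> w" using Cons.prems by (simp add: push_eq_Cons)
    have "h (x # w) = h [x] \<otimes> h w"
      unfolding xw by (rule h.hom_mult) (use w in auto)
    moreover have "h' (x # w) = h' [x] \<otimes> h' w"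
      unfolding xw by (rule h'.hom_mult) (use w in auto)
    ultimately show ?case using letter Cons.IH w by simp
  qed
qed

end

definition cyc_reduced :: "word \<Rightarrow> bool"
  where "cyc_reduced w \<longleftrightarrow> reduced w \<and> (w \<noteq> [] \<longrightarrow> hd w \<noteq> inv_letter (last w))"

definition conj_F2 :: "word \<Rightarrow> word \<Rightarrow> bool"
  where "conj_F2 v w \<longleftrightarrow> (\<exists>g \<in> carrier F2. v = g \<otimes>\<^bsub>F2\<^esub> w \<otimes>\<^bsub>F2\<^esub> inv\<^bsub>F2\<^esub> g)"

definition cyc_len :: "word \<Rightarrow> nat"
  where "cyc_len w = (THE n. \<exists>c. cyc_reduced c \<and> conj_F2 c w \<and> n = length c)"

lemma conj_F2_refl: "reduced w \<Longrightarrow> conj_F2 w w"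
  unfolding conj_F2_def by (rule bexI[of _ "\<one>\<^bsub>F2\<^esub>"]) (use F2.inv_one foldr_push_append[of w "[]"] in auto)

lemma conj_F2_sym:
  assumes "conj_F2 v w" "reduced w"
  shows "conj_F2 w v"
proof -
  obtain g where g: "g \<in> carrier F2" "v = g \<otimes>\<^bsub>F2\<^esub> w \<otimes>\<^bsub>F2\<^esub> inv\<^bsub>F2\<^esub> g"
    using assms unfolding conj_F2_def by blast
  have w: "w \<in> carrier F2" using assms by simp
  have "w = inv\<^bsub>F2\<^esub> g \<otimes>\<^bsub>F2\<^esub> v \<otimes>\<^bsub>F2\<^esub> inv\<^bsub>F2\<^esub> (inv\<^bsub>F2\<^esub> g)"
    unfolding g(2) using g(1) w
    by (metis F2.inv_closed F2.inv_inv F2.inv_solve_left F2.inv_solve_right' F2.m_assoc F2.m_closed)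
  then show ?thesis unfolding conj_F2_def using F2.inv_closed[OF g(1)] by blast
qed

lemma conj_F2_trans:
  assumes "conj_F2 u v" "conj_F2 v w" "reduced w"
  shows "conj_F2 u w"
proof -
  obtain g where g: "g \<in> carrier F2" "u = g \<otimes>\<^bsub>F2\<^esub> v \<otimes>\<^bsub>F2\<^esub> inv\<^bsub>F2\<^esub> g"
    using assms unfolding conj_F2_def by blast
  obtain h where h: "h \<in> carrier F2" "v = h \<otimes>\<^bsub>F2\<^esub> w \<otimes>\<^bsub>F2\<^esub> inv\<^bsub>F2\<^esub> h"
    using assms unfolding conj_F2_def by blast
  have w: "w \<in> carrier F2" using assms by simp
  have "u = (g \<otimes>\<^bsub>F2\<^esub> h) \<otimes>\<^bsub>F2\<^esub> w \<otimes>\<^bsub>F2\<^esub> inv\<^bsub>F2\<^esub> (g \<otimes>\<^bsub>F2\<^esub> h)"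
    unfolding g(2) h(2) using g(1) h(1) w
    by (simp add: F2.inv_mult_group F2.m_assoc del: F2_simps)
  then show ?thesis unfolding conj_F2_def using F2.m_closed[OF g(1) h(1)] by blast
qed

lemma conj_F2_reduced: "conj_F2 v w \<Longrightarrow> reduced w \<Longrightarrow> reduced v"
proof -
  assume "conj_F2 v w" "reduced w"
  then obtain g where g: "g \<in> carrier F2" "v = g \<otimes>\<^bsub>F2\<^esub> w \<otimes>\<^bsub>F2\<^esub> inv\<^bsub>F2\<^esub> g"
    unfolding conj_F2_def by blast
  have "v \<in> carrier F2"
    unfolding g(2) using g(1) \<open>reduced w\<close> by (intro F2.m_closed F2.inv_closed) auto
  then show ?thesis by simp
qed

lemma ex_cyc_reduced_conj:
  assumes "reduced w"
  shows "\<exists>c. cyc_reduced c \<and> conj_F2 c w"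
  using assms
proof (induction w rule: length_induct)
  case (1 w)
  show ?case
  proof (cases "cyc_reduced w")
    case True
    then show ?thesis using conj_F2_refl 1 by blast
  next
    case False
    then have ne: "w \<noteq> []" and hd: "hd w = inv_letter (last w)"
      using 1 by (auto simp: cyc_reduced_def)
    obtain x w' where w: "w = x # w'" using ne by (cases w) auto
    have "w' \<noteq> []" using hd w by auto
    then obtain m y where w': "w' = m @ [y]" by (metis append_butlast_last_id)
    have x: "y = inv_letter x" using hd w w' by simp
    have w_eq: "w = x # m @ [inv_letter x]" using w w' x by simp
    have m: "reduced (m @ [inv_letter x])" "reduced m"
      using 1 w_eq by (auto simp: reduced_append dest: reduced_ConsD)
    have "w = [x] \<otimes>\<^bsub>F2\<^esub> m \<otimes>\<^bsub>F2\<^esub> inv\<^bsub>F2\<^esub> [x]"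
    proof -
      have "[x] \<otimes>\<^bsub>F2\<^esub> m \<otimes>\<^bsub>F2\<^esub> inv\<^bsub>F2\<^esub> [x] = [x] \<otimes>\<^bsub>F2\<^esub> (m \<otimes>\<^bsub>F2\<^esub> inv\<^bsub>F2\<^esub> [x])"
        by (rule F2.m_assoc) (use m in \<open>auto simp: F2_inv\<close>)
      also have "\<dots> = push x (m @ [inv_letter x])"
        using m by (simp add: F2_inv foldr_push_append)
      also have "\<dots> = w" using 1 w_eq by (simp add: push_eq_Cons)
      finally show ?thesis by simp
    qed
    then have "conj_F2 w m" unfolding conj_F2_def by (intro bexI[of _ "[x]"]) auto
    then have "conj_F2 m w" using conj_F2_sym m by blast
    moreover obtain c where "cyc_reduced c" "conj_F2 c m"
      using 1 w_eq m by (metis length_Cons length_append_singleton less_Suc_eq less_SucI)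
    ultimately show ?thesis using conj_F2_trans 1 by blast
  qed
qed

lemma length_push: "length (push x w) \<le> Suc (length w)"
  by (cases w) auto

lemma length_mult: "length (u \<otimes>\<^bsub>F2\<^esub> v) \<le> length u + length v"
proof (simp, induction u)
  case (Cons x u)
  then show ?case using length_push[of x "foldr push u v"] by simp
qed simp

lemma cyc_reduced_pow:
  assumes "cyc_reduced c"
  shows "c [^]\<^bsub>F2\<^esub> n = concat (replicate n c)" "reduced (concat (replicate n c))"
proof -
  have red: "reduced (concat (replicate n c))" for n
  proof (induction n)
    case (Suc n)
    then show ?case using assms by (cases n) (auto simp: cyc_reduced_def reduced_append)
  qed simp
  then show "reduced (concat (replicate n c))" .
  have comm: "concat (replicate n c) @ c = concat (replicate (Suc n) c)" for n
    by (induction n) auto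
  show "c [^]\<^bsub>F2\<^esub> n = concat (replicate n c)"
  proof (induction n)
    case (Suc n)
    then show ?case using red[of "Suc n"] comm[of n] foldr_push_append by (simp del: replicate_Suc)
  qed simp
qed

lemma cyc_reduced_conj_le:
  assumes c: "cyc_reduced c" and d: "cyc_reduced d" and "conj_F2 d c"
  shows "length d \<le> length c"
proof (rule ccontr)
  assume "\<not> length d \<le> length c"
  then have lt: "Suc (length c) \<le> length d" by simp
  obtain g where g: "g \<in> carrier F2" "d = g \<otimes>\<^bsub>F2\<^esub> c \<otimes>\<^bsub>F2\<^esub> inv\<^bsub>F2\<^esub> g"
    using assms unfolding conj_F2_def by blast
  have cc: "c \<in> carrier F2" using c by (simp add: cyc_reduced_def)
  have pow: "d [^]\<^bsub>F2\<^esub> n = g \<otimes>\<^bsub>F2\<^esub> c [^]\<^bsub>F2\<^esub> n \<otimes>\<^bsub>F2\<^esub> inv\<^bsub>F2\<^esub> g" for n :: nat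
  proof (induction n)
    case 0
    then show ?case using g(1) by (simp del: F2_simps)
  next
    case (Suc n)
    have "d [^]\<^bsub>F2\<^esub> Suc n = d [^]\<^bsub>F2\<^esub> n \<otimes>\<^bsub>F2\<^esub> d" by (rule F2.nat_pow_Suc)
    also have "\<dots> = (g \<otimes>\<^bsub>F2\<^esub> c [^]\<^bsub>F2\<^esub> n \<otimes>\<^bsub>F2\<^esub> inv\<^bsub>F2\<^esub> g) \<otimes>\<^bsub>F2\<^esub> (g \<otimes>\<^bsub>F2\<^esub> c \<otimes>\<^bsub>F2\<^esub> inv\<^bsub>F2\<^esub> g)"
      by (simp only: Suc.IH flip: g(2))
    also have "\<dots> = (g \<otimes>\<^bsub>F2\<^esub> c [^]\<^bsub>F2\<^esub> n) \<otimes>\<^bsub>F2\<^esub> (inv\<^bsub>F2\<^esub> g \<otimes>\<^bsub>F2\<^esub> (g \<otimes>\<^bsub>F2\<^esub> (c \<otimes>\<^bsub>F2\<^esub> inv\<^bsub>F2\<^esub> g)))"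
      using g(1) cc by (simp add: F2.m_assoc del: F2_simps)
    also have "inv\<^bsub>F2\<^esub> g \<otimes>\<^bsub>F2\<^esub> (g \<otimes>\<^bsub>F2\<^esub> (c \<otimes>\<^bsub>F2\<^esub> inv\<^bsub>F2\<^esub> g)) = c \<otimes>\<^bsub>F2\<^esub> inv\<^bsub>F2\<^esub> g"
      using g(1) cc by (simp add: F2.m_assoc[symmetric] del: F2_simps)
    also have "(g \<otimes>\<^bsub>F2\<^esub> c [^]\<^bsub>F2\<^esub> n) \<otimes>\<^bsub>F2\<^esub> (c \<otimes>\<^bsub>F2\<^esub> inv\<^bsub>F2\<^esub> g) =
        g \<otimes>\<^bsub>F2\<^esub> c [^]\<^bsub>F2\<^esub> Suc n \<otimes>\<^bsub>F2\<^esub> inv\<^bsub>F2\<^esub> g"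
      using g(1) cc by (simp add: F2.m_assoc del: F2_simps)
    finally show ?case .
  qed
  have len: "n * length d \<le> n * length c + 2 * length g" for n
  proof -
    have "n * length d = length (d [^]\<^bsub>F2\<^esub> n)"
      using cyc_reduced_pow(1)[OF d] by (simp add: length_concat sum_list_replicate)
    also have "\<dots> \<le> length g + length (c [^]\<^bsub>F2\<^esub> n) + length (inv\<^bsub>F2\<^esub> g)"
      unfolding pow using length_mult[of "g \<otimes>\<^bsub>F2\<^esub> c [^]\<^bsub>F2\<^esub> n" "inv\<^bsub>F2\<^esub> g"]
        length_mult[of g "c [^]\<^bsub>F2\<^esub> n"] by linarith
    also have "\<dots> = n * length c + 2 * length g"
      using cyc_reduced_pow(1)[OF c] g(1) by (simp add: length_concat sum_list_replicate F2_inv)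
    finally show ?thesis .
  qed
  let ?n = "Suc (2 * length g)"
  have "?n * Suc (length c) \<le> ?n * length d" using lt by (rule mult_le_mono2)
  then show False using len[of ?n] by simp
qed

lemma cyc_len_eq:
  assumes "reduced w" "cyc_reduced c" "conj_F2 c w"
  shows "cyc_len w = length c"
  unfolding cyc_len_def
proof (rule the_equality)
  show "\<exists>c'. cyc_reduced c' \<and> conj_F2 c' w \<and> length c = length c'" using assms by blast
next
  fix n assume "\<exists>c. cyc_reduced c \<and> conj_F2 c w \<and> n = length c"
  then obtain d where d: "cyc_reduced d" "conj_F2 d w" "n = length d" by blast
  have "conj_F2 d c" "conj_F2 c d"
    using assms d by (meson conj_F2_sym conj_F2_trans cyc_reduced_def)+
  then show "n = length c" using cyc_reduced_conj_le assms(2) d by (simp add: le_antisym)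
qed

abbreviation Aut_F2 :: "(word \<Rightarrow> word) monoid"
  where "Aut_F2 \<equiv> AutoGroup F2"

interpretation Aut_F2: group Aut_F2
  by (rule F2.AutoGroup)

text \<open>
  Elements of the automorphism group are extensional, hence the restriction to the carrier.
\<close>

definition sigma :: "word \<Rightarrow> word"
  where "sigma = restrict (lift F2 (case_gen (elt_a \<otimes>\<^bsub>F2\<^esub> elt_b) elt_b)) (carrier F2)"

definition tau :: "word \<Rightarrow> word"
  where "tau = restrict (lift F2 (case_gen elt_a (elt_b \<otimes>\<^bsub>F2\<^esub> elt_a))) (carrier F2)"

lemma restrict_hom_F2: "h \<in> hom F2 F2 \<Longrightarrow> restrict h (carrier F2) \<in> hom F2 F2"
  by (auto simp: hom_def Pi_iff reduced_foldr_push)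

lemma auto_F2I:
  assumes f: "\<And>x. reduced (f x)" and g: "\<And>x. reduced (g x)"
    and "lift F2 g (f Gen_a) = elt_a" "lift F2 g (f Gen_b) = elt_b"
    and "lift F2 f (g Gen_a) = elt_a" "lift F2 f (g Gen_b) = elt_b"
  shows "restrict (lift F2 f) (carrier F2) \<in> auto F2"
proof -
  have fh: "lift F2 f \<in> hom F2 F2" and gh: "lift F2 g \<in> hom F2 F2"
    using f g by (simp_all add: F2.lift_hom)
  have id: "(\<lambda>x. x) \<in> hom F2 F2" by (auto simp: hom_def)
  have "(lift F2 g \<circ> lift F2 f) w = (\<lambda>x. x) w" if "reduced w" for w
    by (rule F2.F2_hom_unique[OF hom_compose[OF fh gh] id _ _ that])
      (use assms in \<open>simp_all add: F2.lift_gen\<close>)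
  moreover have "(lift F2 f \<circ> lift F2 g) w = (\<lambda>x. x) w" if "reduced w" for w
    by (rule F2.F2_hom_unique[OF hom_compose[OF gh fh] id _ _ that])
      (use assms in \<open>simp_all add: F2.lift_gen\<close>)
  ultimately have "bij_betw (lift F2 f) (carrier F2) (carrier F2)"
    using fh gh by (intro bij_betw_byWitness[where f' = "lift F2 g"]) (auto simp: hom_def Pi_iff)
  then have "bij_betw (restrict (lift F2 f) (carrier F2)) (carrier F2) (carrier F2)"
    using bij_betw_cong[of "carrier F2" "restrict (lift F2 f) (carrier F2)" "lift F2 f"]
    by (metis restrict_apply')
  then show ?thesis using restrict_hom_F2[OF fh] by (simp add: auto_def Bij_def)
qed

lemma sigma_auto: "sigma \<in> auto F2"
  unfolding sigma_def
  by (rule auto_F2I[where g = "case_gen (elt_a \<otimes>\<^bsub>F2\<^esub> inv\<^bsub>F2\<^esub> elt_b) elt_b"])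
    (auto split: gen.split simp: F2_inv elt_a_def elt_b_def lift_def eval_letter_def reduced_Cons)

lemma tau_auto: "tau \<in> auto F2"
  unfolding tau_def
  by (rule auto_F2I[where g = "case_gen elt_a (elt_b \<otimes>\<^bsub>F2\<^esub> inv\<^bsub>F2\<^esub> elt_a)"])
    (auto split: gen.split simp: F2_inv elt_a_def elt_b_def lift_def eval_letter_def reduced_Cons)

lemma sigma_gen: "sigma elt_a = elt_a \<otimes>\<^bsub>F2\<^esub> elt_b" "sigma elt_b = elt_b"
  and tau_gen: "tau elt_a = elt_a" "tau elt_b = elt_b \<otimes>\<^bsub>F2\<^esub> elt_a"
  by (auto simp: sigma_def tau_def elt_a_def elt_b_def lift_def eval_letter_def)

text \<open>
  The list \<open>[(l\<^sub>1, m\<^sub>1), \<dots>, (l\<^sub>r, m\<^sub>r)]\<close> encodes the chain whose first applied factor is \<open>\<sigma>\<close> to the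
  power \<open>l\<^sub>1\<close> or \<open>- l\<^sub>1\<close>, and whose last applied factor is \<open>\<tau>\<close> to the power \<open>m\<^sub>r\<close> or \<open>- m\<^sub>r\<close>.
\<close>

fun chain1 :: "(nat \<times> nat) list \<Rightarrow> word \<Rightarrow> word"
  where
    "chain1 [] = \<one>\<^bsub>Aut_F2\<^esub>"
  | "chain1 ((l, m) # ps) =
      chain1 ps \<otimes>\<^bsub>Aut_F2\<^esub> (tau [^]\<^bsub>Aut_F2\<^esub> int m \<otimes>\<^bsub>Aut_F2\<^esub> sigma [^]\<^bsub>Aut_F2\<^esub> int l)"

fun chain2 :: "(nat \<times> nat) list \<Rightarrow> word \<Rightarrow> word"
  where
    "chain2 [] = \<one>\<^bsub>Aut_F2\<^esub>"
  | "chain2 ((l, m) # ps) =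
      chain2 ps \<otimes>\<^bsub>Aut_F2\<^esub> (tau [^]\<^bsub>Aut_F2\<^esub> (- int m) \<otimes>\<^bsub>Aut_F2\<^esub> sigma [^]\<^bsub>Aut_F2\<^esub> (- int l))"

definition chain_length :: "(nat \<times> nat) list \<Rightarrow> nat"
  where "chain_length ps = (\<Sum>(l, m)\<leftarrow>ps. m + l)"

definition Omega1 :: "nat \<Rightarrow> (word \<Rightarrow> word) set"
  where "Omega1 N = {chain1 ps | ps. chain_length ps \<le> N}"

definition Omega2 :: "nat \<Rightarrow> (word \<Rightarrow> word) set"
  where "Omega2 N = {chain2 ps | ps. chain_length ps \<le> N}"

definition Omega :: "nat \<Rightarrow> (word \<Rightarrow> word) set"
  where "Omega N = Omega1 N \<union> Omega2 N"

definition incr :: "(word \<Rightarrow> word) \<Rightarrow> (word \<Rightarrow> word) \<Rightarrow> word \<Rightarrow> real"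
  where "incr \<beta> \<psi> w = max 1 (real (cyc_len (\<beta> (\<psi> w))) - real (cyc_len (\<psi> w)))"

definition len_ratio :: "(word \<Rightarrow> word) \<Rightarrow> word \<Rightarrow> word \<Rightarrow> real"
  where "len_ratio \<phi> u v = real (cyc_len (\<phi> u)) / real (cyc_len (\<phi> v))"

text \<open>
  The quotient is meaningful only for nontrivial \<open>v\<close>; for trivial \<open>v\<close> the convention
  \<open>x / 0 = 0\<close> makes the predicate false.
\<close>

definition bdd_trans_equiv :: "word \<Rightarrow> word \<Rightarrow> bool"
  where "bdd_trans_equiv u v \<longleftrightarrow>
    (\<exists>C::real. C > 0 \<and> (\<forall>\<phi> \<in> carrier Aut_F2. 1 / C \<le> len_ratio \<phi> u v \<and> len_ratio \<phi> u v \<le> C))"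

definition Delta :: "nat \<Rightarrow> word \<Rightarrow> word \<Rightarrow> real set"
  where "Delta N u v =
    {len_ratio \<psi> u v | \<psi>. \<psi> \<in> Omega N}
    \<union> {incr \<alpha> \<psi>\<^sub>1 u / incr \<alpha> \<psi>\<^sub>1 v | \<alpha> \<psi>\<^sub>1. \<psi>\<^sub>1 \<in> Omega1 N \<and> \<alpha> \<in> {sigma, tau}}
    \<union> {incr (inv\<^bsub>Aut_F2\<^esub> \<alpha>) \<psi>\<^sub>2 u / incr (inv\<^bsub>Aut_F2\<^esub> \<alpha>) \<psi>\<^sub>2 v | \<alpha> \<psi>\<^sub>2.
         \<psi>\<^sub>2 \<in> Omega2 N \<and> \<alpha> \<in> {sigma, tau}}"

end

theory Submission
  imports Defs
begin

text \<open>
  For a cyclic word \<open>w\<close> put \<open>A = \<parallel>\<sigma> w\<parallel> - \<parallel>w\<parallel>\<close> and \<open>B = \<parallel>\<tau> w\<parallel> - \<parallel>w\<parallel>\<close>, and let \<open>X\<close> be the number of cyclic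
  factors \<open>a b\<^sup>-\<^sup>1\<close>, \<open>b a\<^sup>-\<^sup>1\<close>. Counting letters gives \<open>A = n\<^sub>a - 2 X\<close> and \<open>B = n\<^sub>b - 2 X\<close>, and \<open>\<sigma>\<close> lowers \<open>X\<close> by
  the number \<open>p\<close> of factors \<open>a b\<^sup>-\<^sup>1 a\<close> (up to inversion), so \<open>A\<close> becomes \<open>A + 2 p\<close> and \<open>B\<close> becomes
  \<open>B + A + 2 p\<close>; symmetrically for \<open>\<tau>\<close>. Thus, while \<open>X\<close> is stable, length and increments evolve linearly
  along a chain of type (C1).

  A factor \<open>a b\<^sup>-\<^sup>1 a\<close> in \<open>\<psi> w\<close> pulls back through \<open>\<psi>\<close> to a factor of \<open>w\<close> that gains a letter at every step
  below the last block \<open>\<tau>\<^sup>t\<close> of \<open>\<psi>\<close>; hence it can only survive if all but at most \<open>\<parallel>w\<parallel>\<close> steps of \<open>\<psi>\<close>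
  are final steps \<open>\<tau>\<close>, and in that block \<open>p\<close> is constant. So beyond length \<open>2 \<parallel>u\<parallel> + 5\<close> each new length or
  increment is a sum of two earlier ones, taken at the same chains for \<open>u\<close> and for \<open>v\<close>. The hypotheses say
  that the eventual increments vanish simultaneously for \<open>u\<close> and \<open>v\<close>, so the mediant inequality keeps all
  quotients between \<open>min \<Delta>\<close> and \<open>max \<Delta>\<close>.

  Inverting \<open>b\<close> turns chains of type (C2) into chains of type (C1). Finally, Nielsen reduction of the basis
  \<open>\<phi> a\<close>, \<open>\<phi> b\<close> shows that every automorphism is, up to an inner automorphism and a signed permutation of
  the generators applied last, a chain of one of the two types.
\<close>

section \<open>Reduced words, conjugation and rotation\<close>

text \<open>The increments in \<open>Delta\<close> are cut off below at 1, while the mediant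
  inequality needs the true ones. The induction therefore has to know that the increments of
  \<open>u\<close> and \<open>v\<close> are both positive or both zero. Late in a chain a zero
  increment means that the shear fixes the cyclic word, so its letter can be deleted from the chain.
  Positivity has to be forced by length. Put M = \<open>cyc_len u\<close>, which also bounds
  \<open>cyc_len v\<close>. The number X never grows along a chain and 2 X is at most the initial
  length, so A and B never fall below -M. After M letters a factor \<open>a b^-1 a\<close> survives
  only in a tail of \<tau>-steps. If B is positive on that tail, A gains a positive constant at
  every step, so about M more letters make it positive. The recursion looks back a few letters, and
  this gives 2 M + 5. The exponent k = M + 1 has a similar origin: beyond M letters all increments
  along consecutive powers of one shear agree, from the second power on, so comparing the powers k
  and k + 1 amounts to comparing the powers 1 and 2.\<close>

abbreviation mul :: "word \<Rightarrow> word \<Rightarrow> word" (infixr "\<cdot>" 70)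
  where "u \<cdot> v \<equiv> foldr push u v"

abbreviation inverse_word :: "word \<Rightarrow> word"
  where "inverse_word w \<equiv> rev (map inv_letter w)"

lemma mul_Nil2: "reduced w \<Longrightarrow> w \<cdot> [] = w"
  using foldr_push_append[of w "[]"] by simp

lemma inverse_word_inverse_word [simp]: "rev (map inv_letter (inverse_word w)) = w"
  by (simp add: rev_map comp_def)

lemma inverse_mul_cancel: "reduced g \<Longrightarrow> reduced w \<Longrightarrow> inverse_word g \<cdot> (g \<cdot> w) = w"
  using foldr_push_assoc[of w "inverse_word g" g] by (simp add: foldr_push_inverse)

lemma mul_inverse_cancel: "reduced g \<Longrightarrow> reduced w \<Longrightarrow> g \<cdot> (inverse_word g \<cdot> w) = w"
  using inverse_mul_cancel[of "inverse_word g" w] by (simp add: reduced_inverse)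

lemma mul_inverse: "reduced g \<Longrightarrow> g \<cdot> inverse_word g = []"
  using foldr_push_inverse[of "inverse_word g"] by (simp add: reduced_inverse)

lemma inverse_word_mul:
  "reduced u \<Longrightarrow> reduced v \<Longrightarrow> inverse_word (u \<cdot> v) = inverse_word v \<cdot> inverse_word u"
  using F2.inv_mult_group[of u v] by (simp add: F2_inv reduced_foldr_push)

lemma conj_F2_iff:
  assumes "reduced w"
  shows "conj_F2 v w \<longleftrightarrow> (\<exists>g. reduced g \<and> v = g \<cdot> (w \<cdot> inverse_word g))"
  using assms by (auto simp: conj_F2_def F2_inv foldr_push_assoc reduced_inverse)

lemma conj_F2I: "reduced g \<Longrightarrow> reduced w \<Longrightarrow> conj_F2 (g \<cdot> (w \<cdot> inverse_word g)) w"
  using conj_F2_iff by blast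

definition nform :: "word \<Rightarrow> word" where "nform w = w \<cdot> []"

lemma reduced_nform [simp]: "reduced (nform w)"
  by (simp add: nform_def reduced_foldr_push)

lemma nform_reduced: "reduced w \<Longrightarrow> nform w = w"
  by (simp add: nform_def mul_Nil2)

lemma mul_nform: "reduced v \<Longrightarrow> nform u \<cdot> v = u \<cdot> v"
  by (simp add: nform_def foldr_push_assoc)

lemma conj_F2_rotate:
  assumes "reduced (u @ v)" "reduced (v @ u)"
  shows "conj_F2 (v @ u) (u @ v)"
proof -
  have r: "reduced u" "reduced v" using assms by (auto simp: reduced_append)
  have "inverse_word u \<cdot> ((u @ v) \<cdot> inverse_word (inverse_word u)) = inverse_word u \<cdot> (u \<cdot> (v \<cdot> u))"
    by (simp add: rev_map comp_def)
  also have "\<dots> = v @ u"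
    using r assms(2) by (simp add: inverse_mul_cancel reduced_foldr_push foldr_push_append del: map_append)
  finally have "v @ u = inverse_word u \<cdot> ((u @ v) \<cdot> inverse_word (inverse_word u))" by simp
  then show ?thesis
    using conj_F2I[OF reduced_inverse[OF r(1)] assms(1)] by metis
qed

lemma cyc_reduced_append_iff:
  assumes "u \<noteq> []" "v \<noteq> []"
  shows "cyc_reduced (u @ v) \<longleftrightarrow> reduced u \<and> reduced v \<and>
    hd v \<noteq> inv_letter (last u) \<and> hd u \<noteq> inv_letter (last v)"
  using assms by (auto simp: cyc_reduced_def reduced_append)

lemma cyc_reduced_swap: "cyc_reduced (u @ v) \<longleftrightarrow> cyc_reduced (v @ u)"
  by (cases "u = [] \<or> v = []") (auto simp: cyc_reduced_append_iff)

lemma conj_F2_swap: "cyc_reduced (u @ v) \<Longrightarrow> conj_F2 (v @ u) (u @ v)"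
  using conj_F2_rotate[of u v] cyc_reduced_swap[of u v] by (simp add: cyc_reduced_def)

lemma cyc_reduced_inverse: "cyc_reduced c \<Longrightarrow> cyc_reduced (inverse_word c)"
proof (cases "c = []")
  case False
  assume c: "cyc_reduced c"
  have "hd (inverse_word c) = inv_letter (last c)" "last (inverse_word c) = inv_letter (hd c)"
    using False by (simp_all add: hd_rev last_rev last_map hd_map)
  then show ?thesis using c False by (auto simp: cyc_reduced_def reduced_inverse)
qed simp

text \<open>Length is already known to be a conjugacy invariant; counting factors needs uniqueness
  of the cyclically reduced representative up to rotation. The conjugator is shortened from its
  inner end: its last letter cancels against one end of \<open>c\<close>, which rotates
  \<open>c\<close>, or it cancels nowhere.\<close>

lemma conj_cyc_reduced_rotate:
  assumes "cyc_reduced c" "cyc_reduced d" "conj_F2 d c"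
  shows "\<exists>k. d = rotate k c"
proof -
  have "\<exists>k. d = rotate k c"
    if "reduced g" "cyc_reduced c" "d = g \<cdot> (c \<cdot> inverse_word g)" for g c
    using that
  proof (induction g arbitrary: c rule: rev_induct)
    case Nil
    then have "d = rotate 0 c" by (simp add: mul_Nil2 cyc_reduced_def)
    then show ?case by blast
  next
    case (snoc l g)
    have rg: "reduced g" and rc: "reduced c"
      using snoc.prems by (auto simp: reduced_append cyc_reduced_def)
    have eq: "d = g \<cdot> ([l] \<cdot> (c \<cdot> ([inv_letter l] \<cdot> inverse_word g)))"
      using snoc.prems(3) reduced_inverse[OF snoc.prems(1)] by (simp add: push_eq_Cons)
    have eq: "d = g \<cdot> (([l] \<cdot> (c \<cdot> [inv_letter l])) \<cdot> inverse_word g)"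
      using eq reduced_inverse[OF rg] by (simp add: foldr_push_assoc reduced_foldr_push foldr_push_push)
    show ?case
    proof (cases "c = []")
      case True
      then have "d = g \<cdot> (c \<cdot> inverse_word g)" using eq by simp
      then show ?thesis using snoc.IH[OF rg snoc.prems(2)] by simp
    next
      case ne: False
      consider "hd c = inv_letter l" | "last c = l" | "hd c \<noteq> inv_letter l" "last c \<noteq> l" by blast
      then show ?thesis
      proof cases
        case 1
        obtain c' where c: "c = inv_letter l # c'" using 1 ne by (cases c) auto
        have r: "cyc_reduced (c' @ [inv_letter l])"
          using snoc.prems(2) cyc_reduced_swap[of "[inv_letter l]" c'] c by simp
        then have r': "reduced (c' @ [inv_letter l])" by (simp add: cyc_reduced_def)
        have "[l] \<cdot> (c \<cdot> [inv_letter l]) = [l] \<cdot> ([inv_letter l] \<cdot> (c' \<cdot> [inv_letter l]))"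
          by (simp add: c)
        also have "\<dots> = c' @ [inv_letter l]"
          using r' by (simp add: foldr_push_append push_push_inv)
        finally have "d = g \<cdot> ((c' @ [inv_letter l]) \<cdot> inverse_word g)" using eq by simp
        then obtain k where "d = rotate k (c' @ [inv_letter l])" using snoc.IH[OF rg r] by blast
        then have "d = rotate (k + 1) c" by (simp add: c rotate_add [symmetric] rotate1_rotate_swap flip: rotate_rotate)
        then show ?thesis by blast
      next
        case 2
        obtain c' where c: "c = c' @ [l]" using 2 ne by (metis append_butlast_last_id)
        have r: "cyc_reduced (l # c')"
          using snoc.prems(2) cyc_reduced_swap[of "[l]" c'] c by simp
        then have r': "reduced (l # c')" "reduced c'" by (auto simp: cyc_reduced_def dest: reduced_ConsD)
        have "[l] \<cdot> (c \<cdot> [inv_letter l]) = [l] \<cdot> (c' \<cdot> [])"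
          by (simp add: c)
        also have "\<dots> = l # c'"
          using r' by (simp add: mul_Nil2 push_eq_Cons)
        finally have "d = g \<cdot> ((l # c') \<cdot> inverse_word g)" using eq by simp
        then obtain k where k: "d = rotate k (l # c')" using snoc.IH[OF rg r] by blast
        have "l # c' = rotate (length c') c" by (simp add: c rotate_append)
        then have "d = rotate (k + length c') c" using k by (simp add: rotate_rotate)
        then show ?thesis by blast
      next
        case 3
        have rl: "reduced (c @ inverse_word (g @ [l]))"
          using rc ne 3 reduced_inverse[OF snoc.prems(1)]
          by (auto simp: reduced_append hd_append) (metis inv_letter_simps(1))
        have "reduced ((g @ [l]) @ (c @ inverse_word (g @ [l])))"
          using rl snoc.prems(1) ne 3 by (subst reduced_append) (auto simp: hd_append)
        then have "d = (g @ [l]) @ (c @ inverse_word (g @ [l]))"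
          using snoc.prems(3) rl by (metis foldr_push_append)
        \<comment> \<open>Nothing cancels, so \<open>d\<close> begins and ends with mutually inverse
          letters, which cyclic reducedness forbids.\<close>
        then have "hd d = hd (g @ [l])" "last d = inv_letter (hd (g @ [l]))" "d \<noteq> []"
          by (auto simp: hd_append last_append last_rev hd_map)
        then have False using assms(2) by (auto simp: cyc_reduced_def)
        then show ?thesis ..
      qed
    qed
  qed
  then show ?thesis using assms conj_F2_iff[of c d] by (auto simp: cyc_reduced_def)
qed

section \<open>Cyclic statistics\<close>

text \<open>Three letters are the shortest window that sees \<open>a b^-1 a\<close>. Counts of
  letters and turns use the same window and ignore its later letters, so one rotation argument
  serves them all.\<close>

fun cnt3 :: "(letter \<Rightarrow> letter \<Rightarrow> letter \<Rightarrow> int) \<Rightarrow> word \<Rightarrow> int"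
  where
    "cnt3 g (x # y # z # r) = g x y z + cnt3 g (y # z # r)"
  | "cnt3 g _ = 0"

text \<open>For words of length 1 or 2 the cyclic windows wrap around more than once.\<close>

definition cyc3 :: "(letter \<Rightarrow> letter \<Rightarrow> letter \<Rightarrow> int) \<Rightarrow> word \<Rightarrow> int"
  where "cyc3 g c = cnt3 g (c @ take 2 (c @ c))"

lemma cnt3_snoc: "cnt3 g (xs @ [u, v, w]) = cnt3 g (xs @ [u, v]) + g u v w"
proof (induction xs)
  case (Cons x xs)
  show ?case
  proof (cases xs)
    case (Cons y ys)
    then show ?thesis using \<open>cnt3 g (xs @ [u, v, w]) = cnt3 g (xs @ [u, v]) + g u v w\<close> by (cases ys) simp_all
  qed simp
qed simp

text \<open>Rotation removes the first window of the extended word and appends the same window at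
  its end.\<close>

lemma cyc3_rotate1: "cyc3 g (rotate1 c) = cyc3 g c"
proof (cases c)
  case (Cons x c1)
  show ?thesis
  proof (cases c1)
    case Nil
    then show ?thesis by (simp add: Cons)
  next
    case c1: (Cons y c2)
    define z where "z = hd (c2 @ [x])"
    obtain r where r: "c2 @ [x] = z # r" unfolding z_def by (cases c2) auto
    have "cyc3 g c = cnt3 g (x # y # (c2 @ [x]) @ [y])"
      by (simp add: cyc3_def Cons c1)
    also have "\<dots> = g x y z + cnt3 g (y # (c2 @ [x]) @ [y])" by (simp add: r)
    finally have 1: "cyc3 g c = g x y z + cnt3 g ((y # c2) @ [x, y])" by simp
    have "cyc3 g (rotate1 c) = cnt3 g ((y # c2 @ [x]) @ take 2 (y # (c2 @ [x]) @ y # c2 @ [x]))"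
      by (simp add: cyc3_def Cons c1)
    also have "take 2 (y # (c2 @ [x]) @ y # c2 @ [x]) = [y, z]" by (simp add: r)
    also have "(y # c2 @ [x]) @ [y, z] = (y # c2) @ [x, y, z]" by simp
    finally show ?thesis using 1 by (simp only: cnt3_snoc)
  qed
qed simp

lemma cyc3_rotate: "cyc3 g (rotate k c) = cyc3 g c"
  by (induction k) (simp_all add: cyc3_rotate1)

lemma cnt3_map: "cnt3 g (map f c) = cnt3 (\<lambda>x y z. g (f x) (f y) (f z)) c"
  by (induction g c rule: cnt3.induct) simp_all

lemma cyc3_map: "cyc3 g (map f c) = cyc3 (\<lambda>x y z. g (f x) (f y) (f z)) c"
  unfolding cyc3_def by (simp flip: cnt3_map add: take_map)

text \<open>By \<open>stat_eq\<close> the choice of the representative is immaterial for reduced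
  \<open>w\<close>, so this is a conjugacy invariant.\<close>

definition stat :: "(letter \<Rightarrow> letter \<Rightarrow> letter \<Rightarrow> int) \<Rightarrow> word \<Rightarrow> int"
  where "stat g w = cyc3 g (SOME c. cyc_reduced c \<and> conj_F2 c w)"

lemma stat_eq:
  assumes "reduced w" "cyc_reduced c" "conj_F2 c w"
  shows "stat g w = cyc3 g c"
proof -
  let ?d = "SOME c. cyc_reduced c \<and> conj_F2 c w"
  have d: "cyc_reduced ?d \<and> conj_F2 ?d w"
    using assms by (intro someI[of "\<lambda>c. cyc_reduced c \<and> conj_F2 c w" c]) simp
  then have "conj_F2 ?d c"
    using assms by (meson conj_F2_sym conj_F2_trans cyc_reduced_def)
  then obtain k where "?d = rotate k c" using conj_cyc_reduced_rotate d assms by blast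
  then show ?thesis by (simp add: stat_def cyc3_rotate)
qed

lemma cyc_len_conj: "conj_F2 v w \<Longrightarrow> reduced w \<Longrightarrow> cyc_len v = cyc_len w"
  by (metis conj_F2_reduced conj_F2_trans ex_cyc_reduced_conj cyc_len_eq)

section \<open>Cyclic words as sequences of blocks\<close>

definition bpow :: "int \<Rightarrow> word"
  where "bpow j = replicate (nat \<bar>j\<bar>) (Gen_b, 0 < j)"

definition blk :: "bool \<Rightarrow> int \<Rightarrow> word"
  where "blk e j = (Gen_a, e) # bpow j"

definition wrd :: "(nat \<Rightarrow> bool) \<Rightarrow> (nat \<Rightarrow> int) \<Rightarrow> nat \<Rightarrow> nat \<Rightarrow> word"
  where "wrd E J k n = concat (map (\<lambda>i. blk (E i) (J i)) [k..<n])"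

lemma wrd_Cons: "k < n \<Longrightarrow> wrd E J k n = blk (E k) (J k) @ wrd E J (Suc k) n"
  by (simp add: wrd_def upt_conv_Cons)

lemma wrd_empty [simp]: "wrd E J n n = []"
  by (simp add: wrd_def)

lemma wrd_append: "k \<le> m \<Longrightarrow> m \<le> n \<Longrightarrow> wrd E J k n = wrd E J k m @ wrd E J m n"
  using upt_add_eq_append[of k m "n - m"] by (simp add: wrd_def)

text \<open>The letter after the \<open>a\<close>-letter of block \<open>i\<close>; a window that
  starts in block \<open>i - 1\<close> reaches no further.\<close>

definition nxt :: "(nat \<Rightarrow> bool) \<Rightarrow> (nat \<Rightarrow> int) \<Rightarrow> nat \<Rightarrow> letter"
  where "nxt E J i = (if J i = 0 then (Gen_a, E (Suc i)) else (Gen_b, 0 < J i))"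

lemma wrd_starts:
  assumes "k \<le> n"
  shows "\<exists>r. wrd E J k n @ [(Gen_a, E n), nxt E J n] = (Gen_a, E k) # nxt E J k # r"
proof (cases "k = n")
  case False
  then have kn: "k < n" using assms by simp
  show ?thesis
  proof (cases "J k = 0")
    case True
    show ?thesis
    proof (cases "Suc k = n")
      case True
      then show ?thesis using kn \<open>J k = 0\<close> by (simp add: wrd_Cons blk_def bpow_def nxt_def)
    next
      case False
      then have "Suc k < n" using kn by simp
      then show ?thesis using kn \<open>J k = 0\<close> by (simp add: wrd_Cons blk_def bpow_def nxt_def)
    qed
  next
    case False
    then obtain m where "nat \<bar>J k\<bar> = Suc m" by (cases "nat \<bar>J k\<bar>") auto
    then show ?thesis using kn False by (simp add: wrd_Cons blk_def bpow_def nxt_def)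
  qed
qed simp

lemma cnt3_replicate:
  "cnt3 g (replicate (Suc (Suc m)) x @ y # z # r) =
    int m * g x x x + g x x y + g x y z + cnt3 g (y # z # r)"
  by (induction m) (simp_all add: algebra_simps)

text \<open>The contribution of all windows that start in \<open>blk e j\<close>, when the next
  block has sign \<open>e'\<close> and \<open>t\<close> is the letter after its
  \<open>a\<close>-letter. Short blocks are separate cases because their windows reach over the next
  \<open>a\<close>-letter sooner.\<close>

definition blkval :: "(letter \<Rightarrow> letter \<Rightarrow> letter \<Rightarrow> int) \<Rightarrow> bool \<Rightarrow> int \<Rightarrow> bool \<Rightarrow> letter \<Rightarrow> int"
  where "blkval g e j e' t =
    (let a = (Gen_a, e); a' = (Gen_a, e'); b = (Gen_b, 0 < j) in
      if j = 0 then g a a' t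
      else if \<bar>j\<bar> = 1 then g a b a' + g b a' t
      else g a b b + (\<bar>j\<bar> - 2) * g b b b + g b b a' + g b a' t)"

lemma cnt3_blk:
  "cnt3 g (blk e j @ (Gen_a, e') # t # r) = blkval g e j e' t + cnt3 g ((Gen_a, e') # t # r)"
proof -
  consider "j = 0" | "\<bar>j\<bar> = 1" | m where "nat \<bar>j\<bar> = Suc (Suc m)" "\<bar>j\<bar> = int m + 2"
  proof (cases "j = 0 \<or> \<bar>j\<bar> = 1")
    case False
    then have "nat \<bar>j\<bar> = Suc (Suc (nat (\<bar>j\<bar> - 2)))" "\<bar>j\<bar> = int (nat (\<bar>j\<bar> - 2)) + 2" by linarith+
    then show ?thesis using that(3) by blast
  qed (use that in auto)
  then show ?thesis
  proof cases
    case 3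
    then have "j \<noteq> 0" "\<bar>j\<bar> \<noteq> 1" by linarith+
    then show ?thesis
      using 3 cnt3_replicate[of g m "(Gen_b, 0 < j)" "(Gen_a, e')" t r]
      by (simp add: blk_def bpow_def blkval_def Let_def)
  qed (auto simp: blk_def bpow_def blkval_def Let_def)
qed

lemma cnt3_wrd:
  assumes "k \<le> n"
  shows "cnt3 g (wrd E J k n @ [(Gen_a, E n), nxt E J n]) =
    (\<Sum>i=k..<n. blkval g (E i) (J i) (E (Suc i)) (nxt E J (Suc i)))"
  using assms
proof (induction k rule: inc_induct)
  case (step k)
  obtain r where r: "wrd E J (Suc k) n @ [(Gen_a, E n), nxt E J n] = (Gen_a, E (Suc k)) # nxt E J (Suc k) # r"
    using wrd_starts[of "Suc k" n E J] step by auto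
  have "wrd E J k n @ [(Gen_a, E n), nxt E J n] = blk (E k) (J k) @ (Gen_a, E (Suc k)) # nxt E J (Suc k) # r"
    using step by (simp add: wrd_Cons r)
  then show ?case using step r by (simp add: cnt3_blk sum.atLeast_Suc_lessThan)
qed simp

text \<open>Cyclic words \<open>a\<^sup>\<plusminus> b\<^bsup>J 0\<^esup> a\<^sup>\<plusminus> b\<^bsup>J 1\<^esup> \<dots>\<close>, with the signs of \<open>a\<close> in \<open>E\<close> and the exponents of \<open>b\<close> in \<open>J\<close>.
  In this form \<open>\<sigma>\<close> causes no cancellation: it keeps \<open>E\<close> and shifts each \<open>J i\<close> by -1, 0 or 1.\<close>

definition periodic_form :: "(nat \<Rightarrow> bool) \<Rightarrow> (nat \<Rightarrow> int) \<Rightarrow> nat \<Rightarrow> bool"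
  where "periodic_form E J n \<longleftrightarrow> 0 < n \<and> (\<forall>i. E (i + n) = E i) \<and> (\<forall>i. J (i + n) = J i)
    \<and> (\<forall>i. J i = 0 \<longrightarrow> E (Suc i) = E i)"

lemma cyc3_wrd_periodic:
  assumes "0 < n" "\<And>i. E (i + n) = E i" "\<And>i. J (i + n) = J i"
  shows "cyc3 g (wrd E J 0 n) = (\<Sum>i<n. blkval g (E i) (J i) (E (Suc i)) (nxt E J (Suc i)))"
proof -
  have E: "E n = E 0" "J n = J 0" "E (Suc n) = E (Suc 0)"
    using assms(2)[of 0] assms(2)[of 1] assms(3)[of 0] by simp_all
  have n: "nxt E J n = nxt E J 0" by (simp add: nxt_def E)
  obtain r where r: "wrd E J 0 n @ [(Gen_a, E n), nxt E J n] = (Gen_a, E 0) # nxt E J 0 # r"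
    using wrd_starts[of 0 n E J] by auto
  have "take 2 (wrd E J 0 n @ wrd E J 0 n) = [(Gen_a, E 0), nxt E J 0]"
  proof (cases "length (wrd E J 0 n) \<ge> 2")
    case True
    have "take 2 (wrd E J 0 n) = take 2 (wrd E J 0 n @ [(Gen_a, E n), nxt E J n])" using True by simp
    then show ?thesis using True r by simp
  next
    case False
    moreover have "wrd E J 0 n = (Gen_a, E 0) # bpow (J 0) @ wrd E J (Suc 0) n"
      using assms(1) by (simp add: wrd_Cons blk_def)
    ultimately have "wrd E J 0 n = [(Gen_a, E 0)]" by (cases "bpow (J 0) @ wrd E J (Suc 0) n") auto
    then show ?thesis using r E by simp
  qed
  then show ?thesis using cnt3_wrd[of 0 n g E J] E n by (simp add: cyc3_def lessThan_atLeast0)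
qed

text \<open>Treating cancellation as a window statistic lets the block formula decide cyclic
  reducedness as well.\<close>

definition backtrack :: "letter \<Rightarrow> letter \<Rightarrow> letter \<Rightarrow> int"
  where "backtrack x y z = of_bool (y = inv_letter x)"

lemma cnt3_backtrack:
  "c \<noteq> [] \<Longrightarrow> cnt3 backtrack (c @ [t, t']) = 0 \<longleftrightarrow> reduced (c @ [t])"
proof (induction c)
  case (Cons x c)
  have nn: "0 \<le> cnt3 backtrack l" for l
    by (induction backtrack l rule: cnt3.induct) (simp_all add: backtrack_def)
  show ?case
  proof (cases c)
    case Nil
    then show ?thesis by (auto simp: reduced_Cons backtrack_def)
  next
    case (Cons y c')
    obtain z r where zr: "c' @ [t, t'] = z # r" by (cases c') auto
    have "cnt3 backtrack ((x # c) @ [t, t']) = backtrack x y z + cnt3 backtrack (c @ [t, t'])"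
      by (simp add: Cons zr)
    moreover have "backtrack x y z = of_bool (y = inv_letter x)" by (simp add: backtrack_def)
    ultimately have "cnt3 backtrack ((x # c) @ [t, t']) = 0 \<longleftrightarrow>
        y \<noteq> inv_letter x \<and> cnt3 backtrack (c @ [t, t']) = 0"
      using nn[of "c @ [t, t']"] by (cases "y = inv_letter x") auto
    then show ?thesis using Cons.IH Cons by (auto simp: reduced_Cons)
  qed
qed simp

lemma cyc_reduced_cyc3:
  assumes "c \<noteq> []"
  shows "cyc_reduced c \<longleftrightarrow> cyc3 backtrack c = 0"
proof -
  obtain x c' where c: "c = x # c'" using assms by (cases c) auto
  obtain y r where "c' @ x # c' = y # r" by (cases c') auto
  then have "take 2 (c @ c) = [x, y]" by (simp add: c)
  then have "cyc3 backtrack c = 0 \<longleftrightarrow> reduced (c @ [x])"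
    using cnt3_backtrack[OF assms, of x y] by (simp add: cyc3_def)
  also have "\<dots> \<longleftrightarrow> cyc_reduced c"
    using assms by (simp add: cyc_reduced_def reduced_append) (simp add: c)
  finally show ?thesis by simp
qed

lemma cyc_reduced_wrd:
  assumes "0 < n" "\<And>i. E (i + n) = E i" "\<And>i. J (i + n) = J i"
  shows "cyc_reduced (wrd E J 0 n) \<longleftrightarrow> periodic_form E J n"
proof -
  have ne: "wrd E J 0 n \<noteq> []" using assms(1) by (simp add: wrd_Cons blk_def)
  have "blkval backtrack (E i) (J i) (E (Suc i)) (nxt E J (Suc i))
      = of_bool (J i = 0 \<and> E (Suc i) \<noteq> E i)" for i
    by (auto simp: blkval_def Let_def backtrack_def)
  then have "cyc_reduced (wrd E J 0 n) \<longleftrightarrow> (\<forall>i<n. J i = 0 \<longrightarrow> E (Suc i) = E i)"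
    using cyc_reduced_cyc3[OF ne] cyc3_wrd_periodic[of n E J backtrack] assms
    by (auto simp: sum_nonneg_eq_0_iff)
  also have "\<dots> \<longleftrightarrow> (\<forall>i. J i = 0 \<longrightarrow> E (Suc i) = E i)"
  proof -
    have per: "E (i + k * n) = E i" "J (i + k * n) = J i" for i k
      by (induction k) (simp_all add: assms(2,3) add.assoc[symmetric] add.commute[of n])
    have "E (Suc i) = E (Suc (i mod n))" "E i = E (i mod n)" "J i = J (i mod n)" for i
      using per(1)[of "Suc (i mod n)" "i div n"] per[of "i mod n" "i div n"] by simp_all
    then show ?thesis using assms(1) by (metis mod_less_divisor)
  qed
  finally show ?thesis using assms by (auto simp: periodic_form_def)
qed

section \<open>The action of the shears on cyclic words\<close>

definition sg :: "word \<Rightarrow> word"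
  where "sg = lift F2 (case_gen [(Gen_a, True), (Gen_b, True)] [(Gen_b, True)])"

definition sgi :: "word \<Rightarrow> word"
  where "sgi = lift F2 (case_gen [(Gen_a, True), (Gen_b, False)] [(Gen_b, True)])"

definition ta :: "word \<Rightarrow> word"
  where "ta = lift F2 (case_gen [(Gen_a, True)] [(Gen_b, True), (Gen_a, True)])"

definition tai :: "word \<Rightarrow> word"
  where "tai = lift F2 (case_gen [(Gen_a, True)] [(Gen_b, True), (Gen_a, False)])"

lemmas shear_defs = sg_def sgi_def ta_def tai_def

lemma lift_Nil [simp]: "lift F2 f [] = []"
  by (simp add: lift_def)

lemma hom_shear: "sg \<in> hom F2 F2" "sgi \<in> hom F2 F2" "ta \<in> hom F2 F2" "tai \<in> hom F2 F2"
  unfolding shear_defs by (rule F2.lift_hom; auto split: gen.split simp: reduced_Cons)+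

lemma reduced_lift:
  assumes "\<And>x. reduced (f x)"
  shows "reduced (lift F2 f w)"
  using F2.lift_closed[of f w] assms by simp

lemma reduced_shear [simp]: "reduced (sg w)" "reduced (sgi w)" "reduced (ta w)" "reduced (tai w)"
  unfolding shear_defs by (rule reduced_lift; auto split: gen.split simp: reduced_Cons)+

lemma shear_Nil [simp]: "sg [] = []" "sgi [] = []" "ta [] = []" "tai [] = []"
  by (simp_all add: shear_defs)

lemma sg_Cons: "sg ((Gen_a, True) # w) = push (Gen_a, True) (push (Gen_b, True) (sg w))"
  "sg ((Gen_a, False) # w) = push (Gen_b, False) (push (Gen_a, False) (sg w))"
  "sg ((Gen_b, s) # w) = push (Gen_b, s) (sg w)"
  by (cases s; simp add: sg_def lift_def eval_letter_def F2_inv reduced_Cons)+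

lemma sgi_Cons: "sgi ((Gen_a, True) # w) = push (Gen_a, True) (push (Gen_b, False) (sgi w))"
  "sgi ((Gen_a, False) # w) = push (Gen_b, True) (push (Gen_a, False) (sgi w))"
  "sgi ((Gen_b, s) # w) = push (Gen_b, s) (sgi w)"
  by (cases s; simp add: sgi_def lift_def eval_letter_def F2_inv reduced_Cons)+

lemma hom_mul: "h \<in> hom F2 F2 \<Longrightarrow> reduced u \<Longrightarrow> reduced v \<Longrightarrow> h (u \<cdot> v) = h u \<cdot> h v"
  using hom_mult[of h F2 F2 u v] by simp

lemma hom_reduced: "h \<in> hom F2 F2 \<Longrightarrow> reduced u \<Longrightarrow> reduced (h u)"
  using hom_in_carrier[of h F2 F2 u] by simp

lemma hom_inverse:
  assumes "h \<in> hom F2 F2" "reduced u"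
  shows "h (inverse_word u) = inverse_word (h u)"
proof -
  interpret group_hom F2 F2 h by unfold_locales (rule assms)
  show ?thesis using hom_inv[of u] assms hom_reduced[OF assms] by (simp add: F2_inv)
qed

lemma hom_conj:
  assumes h: "h \<in> hom F2 F2" and "conj_F2 v w" "reduced w"
  shows "conj_F2 (h v) (h w)"
proof -
  obtain g where g: "reduced g" "v = g \<cdot> (w \<cdot> inverse_word g)" using assms conj_F2_iff by blast
  have "h v = h g \<cdot> (h w \<cdot> inverse_word (h g))"
    using g assms by (simp add: hom_mul reduced_inverse reduced_foldr_push hom_inverse)
  then show ?thesis using conj_F2I hom_reduced[OF h] g assms by metis
qed

lemma mul_replicate: "replicate m x \<cdot> w = (push x ^^ m) w"
  by (induction m) simp_all

lemma push_bpow: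
  assumes "reduced w"
  shows "push (Gen_b, True) (bpow j \<cdot> w) = bpow (j + 1) \<cdot> w"
    "push (Gen_b, False) (bpow j \<cdot> w) = bpow (j - 1) \<cdot> w"
proof -
  have red: "reduced ((push x ^^ m) w)" for x m
    using reduced_foldr_push[OF assms, of "replicate m x"] by (simp add: mul_replicate)
  show "push (Gen_b, True) (bpow j \<cdot> w) = bpow (j + 1) \<cdot> w"
  proof (cases "0 \<le> j")
    case True
    then have "nat (j + 1) = Suc (nat j)" by linarith
    then show ?thesis using True by (cases "j = 0") (simp_all add: bpow_def mul_replicate)
  next
    case False
    then have "nat (- j) = Suc (nat (- (j + 1)))" by linarith
    then show ?thesis using False push_push_inv[OF red, of "(Gen_b, True)"] push_push_inv[OF assms, of "(Gen_b, True)"]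
      by (cases "j = -1") (simp_all add: bpow_def mul_replicate)
  qed
  show "push (Gen_b, False) (bpow j \<cdot> w) = bpow (j - 1) \<cdot> w"
  proof (cases "j \<le> 0")
    case True
    then have "nat (1 - j) = Suc (nat (- j))" by linarith
    then show ?thesis using True by (simp add: bpow_def mul_replicate)
  next
    case False
    then have "nat j = Suc (nat (j - 1))" by linarith
    then show ?thesis using False push_push_inv[OF red, of "(Gen_b, False)"] push_push_inv[OF assms, of "(Gen_b, False)"]
      by (cases "j = 1") (simp_all add: bpow_def mul_replicate)
  qed
qed

lemma push_b_commute:
  assumes "reduced w"
  shows "push (Gen_b, s) (push (Gen_b, t) w) = push (Gen_b, t) (push (Gen_b, s) w)"
  using push_push_inv[OF assms, of "(Gen_b, s)"] push_push_inv[OF assms, of "(Gen_b, t)"]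
  by (cases s; cases t) simp_all

lemma bpow_push_commute:
  assumes "reduced w"
  shows "bpow j \<cdot> push (Gen_b, s) w = push (Gen_b, s) (bpow j \<cdot> w)"
proof -
  have red: "reduced ((push x ^^ m) w)" for x m
    using reduced_foldr_push[OF assms, of "replicate m x"] by (simp add: mul_replicate)
  have "(push (Gen_b, t) ^^ m) (push (Gen_b, s) w) = push (Gen_b, s) ((push (Gen_b, t) ^^ m) w)" for t m
    by (induction m) (simp_all add: push_b_commute[OF red])
  then show ?thesis by (simp add: bpow_def mul_replicate)
qed

text \<open>\<sigma> puts \<open>b\<close> behind each \<open>a\<close> and \<open>b^-1\<close> in
  front of each \<open>a^-1\<close>. An exponent between two \<open>a\<close> thus gains 1, between
  two \<open>a^-1\<close> it loses 1; in \<open>a b^j a^-1\<close> the two contributions cancel, and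
  in \<open>a^-1 b^j a\<close> there are none.\<close>

definition shift :: "(nat \<Rightarrow> bool) \<Rightarrow> nat \<Rightarrow> int"
  where "shift E i = (if E i = E (Suc i) then (if E i then 1 else - 1) else 0)"

lemma sg_bpow: "sg (bpow j @ w) = bpow j \<cdot> sg w"
proof -
  have "sg (replicate m (Gen_b, s) @ w) = replicate m (Gen_b, s) \<cdot> sg w" for m s
    by (induction m) (simp_all add: sg_Cons)
  then show ?thesis by (simp add: bpow_def)
qed

text \<open>The \<open>b^-1\<close> that \<sigma> puts in front of \<open>a^-1\<close>. It is
  charged to the preceding block, so only the one at the start of the word is left over; it becomes
  the conjugator in \<open>conj_sg_wrd\<close>.\<close>

definition bpre :: "bool \<Rightarrow> word"
  where "bpre e = (if e then [] else [(Gen_b, False)])"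

lemma sg_blk:
  assumes "reduced w" "sg r = bpre (E (Suc i)) \<cdot> w"
  shows "sg (blk (E i) (J i) @ r) = bpre (E i) \<cdot> (blk (E i) (J i + shift E i) \<cdot> w)"
proof -
  have sgb: "sg (bpow (J i) @ r) = bpow (J i) \<cdot> (bpre (E (Suc i)) \<cdot> w)"
    by (simp add: sg_bpow assms)
  have red: "reduced (bpow j \<cdot> w)" for j by (rule reduced_foldr_push[OF assms(1)])
  show ?thesis
    using assms(1) red
    by (cases "E i"; cases "E (Suc i)")
      (simp_all add: blk_def sg_Cons sgb bpre_def shift_def push_bpow bpow_push_commute reduced_push)
qed

lemma sg_wrd:
  assumes "k \<le> n"
  shows "sg (wrd E J k n) =
    bpre (E k) \<cdot> (nform (wrd E (\<lambda>i. J i + shift E i) k n) \<cdot> inverse_word (bpre (E n)))"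
  using assms
proof (induction k rule: inc_induct)
  case base
  show ?case by (simp add: nform_def bpre_def)
next
  case (step k)
  let ?w = "nform (wrd E (\<lambda>i. J i + shift E i) (Suc k) n) \<cdot> inverse_word (bpre (E n))"
  have r: "reduced (inverse_word (bpre (E n)))" by (simp add: bpre_def)
  have w: "reduced ?w" by (rule reduced_foldr_push[OF r])
  have "blk (E k) (J k + shift E k) \<cdot> ?w = nform (wrd E (\<lambda>i. J i + shift E i) k n) \<cdot> inverse_word (bpre (E n))"
    using step r w by (simp add: mul_nform wrd_Cons)
  then show ?case using sg_blk[of ?w "wrd E J (Suc k) n" E k J, OF w] step
    by (simp add: wrd_Cons)
qed

text \<open>A nonzero shift occurs only between equal signs, where an exponent 0 does no harm;
  between opposite signs the exponent stays as it is. So no two \<open>a\<close>-letters can cancel,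
  under \<sigma> or under its inverse.\<close>

lemma periodic_form_shift:
  assumes "periodic_form E J n"
  shows "periodic_form E (\<lambda>i. J i + shift E i) n" "periodic_form E (\<lambda>i. J i - shift E i) n"
proof -
  have per: "E (i + n) = E i" "J (i + n) = J i" "J i = 0 \<Longrightarrow> E (Suc i) = E i" and n: "0 < n" for i
    using assms by (simp_all add: periodic_form_def)
  have "E (Suc (i + n)) = E (Suc i)" for i using per(1)[of "Suc i"] by simp
  then have "shift E (i + n) = shift E i" for i by (simp add: shift_def per)
  moreover have "E (Suc i) = E i" if "J i + shift E i = 0 \<or> J i - shift E i = 0" for i
    using that per(3)[of i] by (auto simp: shift_def split: if_splits)
  ultimately show "periodic_form E (\<lambda>i. J i + shift E i) n" "periodic_form E (\<lambda>i. J i - shift E i) n"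
    unfolding periodic_form_def using per(1,2) n by auto
qed

lemma periodic_form_cyc_reduced: "periodic_form E J n \<Longrightarrow> cyc_reduced (wrd E J 0 n)"
  using cyc_reduced_wrd[of n E J] by (simp add: periodic_form_def)

lemma conj_sg_wrd:
  assumes "periodic_form E J n"
  shows "conj_F2 (sg (wrd E J 0 n)) (wrd E (\<lambda>i. J i + shift E i) 0 n)"
proof -
  have r: "reduced (wrd E (\<lambda>i. J i + shift E i) 0 n)"
    using periodic_form_shift[OF assms] periodic_form_cyc_reduced by (auto simp: cyc_reduced_def)
  have "E n = E 0" using assms by (metis add_0 periodic_form_def)
  then show ?thesis
    using sg_wrd[of 0 n E J] conj_F2I[OF _ r, of "bpre (E 0)"]
    by (simp add: nform_reduced[OF r] bpre_def split: if_splits)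
qed

section \<open>Parsing a cyclically reduced word into blocks\<close>

lemma reduced_b_word:
  assumes "reduced c" "\<forall>l \<in> set c. fst l = Gen_b"
  shows "\<exists>j. c = bpow j"
  using assms
proof (induction c)
  case Nil
  then show ?case by (auto intro: exI[of _ 0] simp: bpow_def)
next
  case (Cons x c)
  obtain s where x: "x = (Gen_b, s)" using Cons.prems by (cases x) auto
  obtain j where j: "c = bpow j" using Cons by (auto dest: reduced_ConsD)
  show ?case
  proof (cases "j = 0")
    case True
    then have "x # c = bpow (if s then 1 else - 1)" using j x by (simp add: bpow_def)
    then show ?thesis by blast
  next
    case False
    then obtain m where m: "nat \<bar>j\<bar> = Suc m" by (cases "nat \<bar>j\<bar>") auto
    then have "(0 < j) = s" using Cons.prems(1) j x by (auto simp: bpow_def reduced_Cons)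
    moreover have "nat \<bar>j + (if s then 1 else - 1)\<bar> = Suc (nat \<bar>j\<bar>)" if "(0 < j) = s"
      using that False by (cases s) auto
    ultimately have "x # c = bpow (j + (if s then 1 else - 1))"
      using j x False by (cases s) (simp_all add: bpow_def)
    then show ?thesis by blast
  qed
qed

lemma parse_blocks:
  assumes "reduced c" "c \<noteq> []" "fst (hd c) = Gen_a"
  shows "\<exists>fs. c = concat (map (\<lambda>p. blk (fst p) (snd p)) fs)"
  using assms
proof (induction c rule: length_induct)
  case (1 c)
  obtain e c1 where c: "c = (Gen_a, e) # c1" using 1 by (cases c) auto
  define u v where "u = takeWhile (\<lambda>l. fst l = Gen_b) c1" and "v = dropWhile (\<lambda>l. fst l = Gen_b) c1"
  have c1: "c1 = u @ v" by (simp add: u_def v_def)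
  have "reduced (u @ v)" using 1(2) c c1 by (auto dest: reduced_ConsD)
  then have ru: "reduced u" and rv: "reduced v" by (auto simp: reduced_append)
  obtain j where j: "u = bpow j"
    using reduced_b_word[OF ru] unfolding u_def by (meson set_takeWhileD)
  have "v = [] \<or> fst (hd v) = Gen_a"
    unfolding v_def using hd_dropWhile[of "\<lambda>l. fst l = Gen_b" c1] by (metis gen.exhaust)
  moreover have "length v < length c" by (simp add: c c1)
  ultimately have "\<exists>fs. v = concat (map (\<lambda>p. blk (fst p) (snd p)) fs)"
    using 1(1) rv by (cases "v = []") (auto intro: exI[of _ "[]"])
  then obtain fs where "v = concat (map (\<lambda>p. blk (fst p) (snd p)) fs)" by blast
  then have "c = concat (map (\<lambda>p. blk (fst p) (snd p)) ((e, j) # fs))"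
    by (simp add: c c1 j blk_def)
  then show ?case by blast
qed

lemma ex_periodic_form:
  assumes "cyc_reduced c" "c \<noteq> []" "fst (hd c) = Gen_a"
  shows "\<exists>E J n. periodic_form E J n \<and> c = wrd E J 0 n"
proof -
  obtain fs where fs: "c = concat (map (\<lambda>p. blk (fst p) (snd p)) fs)"
    using parse_blocks assms by (auto simp: cyc_reduced_def)
  define n E J where "n = length fs" and "E = (\<lambda>i. fst (fs ! (i mod n)))" and "J = (\<lambda>i. snd (fs ! (i mod n)))"
  have n: "0 < n" using assms(2) fs by (auto simp: n_def)
  have "map (\<lambda>i. blk (E i) (J i)) [0..<n] = map (\<lambda>p. blk (fst p) (snd p)) fs"
    by (rule nth_equalityI) (simp_all add: n_def E_def J_def)
  then have c: "c = wrd E J 0 n" using fs by (simp add: wrd_def)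
  have "periodic_form E J n"
    using cyc_reduced_wrd[of n E J] assms(1) c n by (simp add: E_def J_def)
  then show ?thesis using c by blast
qed

text \<open>Rotation to an \<open>a\<close>-letter yields the block form. Only powers of
  \<open>b\<close> contain no such letter, the trivial word among them with exponent 0.\<close>

lemma conj_periodic_form_cases:
  assumes "reduced w"
  obtains (blocks) E J n where "periodic_form E J n" "conj_F2 (wrd E J 0 n) w"
    | (bpow) j where "conj_F2 (bpow j) w" "cyc_reduced (bpow j)"
proof -
  obtain c where c: "cyc_reduced c" "conj_F2 c w" using ex_cyc_reduced_conj assms by blast
  show thesis
  proof (cases "\<forall>l \<in> set c. fst l = Gen_b")
    case True
    then show ?thesis using reduced_b_word[of c] c that(2) by (auto simp: cyc_reduced_def)
  next
    case False
    then obtain u x v where x: "c = u @ x # v" "fst x \<noteq> Gen_b" by (meson split_list)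
    have "conj_F2 ((x # v) @ u) c" "cyc_reduced ((x # v) @ u)"
      using conj_F2_swap[of u "x # v"] cyc_reduced_swap[of u "x # v"] c x by auto
    moreover have "fst (hd ((x # v) @ u)) = Gen_a" using x(2) by (cases "fst x") auto
    ultimately obtain E J n where EJ: "periodic_form E J n" "(x # v) @ u = wrd E J 0 n"
      using ex_periodic_form[of "(x # v) @ u"] by auto
    have "conj_F2 (wrd E J 0 n) w"
      using EJ(2) \<open>conj_F2 ((x # v) @ u) c\<close> c(2) assms conj_F2_trans by metis
    then show ?thesis by (rule that(1)[OF EJ(1)])
  qed
qed

section \<open>Letter and turn counts and their change under a shear\<close>

definition na :: "word \<Rightarrow> int"
  where "na = stat (\<lambda>x y z. of_bool (fst x = Gen_a))"

definition nb :: "word \<Rightarrow> int"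
  where "nb = stat (\<lambda>x y z. of_bool (fst x = Gen_b))"

text \<open>The cyclic factors \<open>a b\<^sup>-\<^sup>1\<close> and \<open>b a\<^sup>-\<^sup>1\<close>: these are the places where \<open>\<sigma>\<close> and \<open>\<tau>\<close> cancel. The next two
  statistics count the occurrences that \<open>\<sigma>\<close> and \<open>\<tau>\<close> respectively destroy.\<close>

definition neg_turns :: "word \<Rightarrow> int"
  where "neg_turns = stat (\<lambda>x y z. of_bool (fst x \<noteq> fst y \<and> snd x \<and> \<not> snd y))"

definition aba :: "word \<Rightarrow> int"
  where "aba = stat (\<lambda>x y z. of_bool (z = x \<and> fst x = Gen_a \<and> fst y = Gen_b \<and> snd y \<noteq> snd x))"

definition bab :: "word \<Rightarrow> int"
  where "bab = stat (\<lambda>x y z. of_bool (z = x \<and> fst x = Gen_b \<and> fst y = Gen_a \<and> snd y \<noteq> snd x))"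

lemmas stat_defs = na_def nb_def neg_turns_def aba_def bab_def

lemma stat_wrd:
  assumes "periodic_form E J n" "conj_F2 (wrd E J 0 n) w" "reduced w"
  shows "stat g w = (\<Sum>i<n. blkval g (E i) (J i) (E (Suc i)) (nxt E J (Suc i)))"
  using assms stat_eq[OF assms(3) periodic_form_cyc_reduced[OF assms(1)] assms(2)]
    cyc3_wrd_periodic[of n E J g] by (simp add: periodic_form_def)

lemma stats_wrd:
  assumes "periodic_form E J n" "conj_F2 (wrd E J 0 n) w" "reduced w"
  shows "na w = int n" "nb w = (\<Sum>i<n. \<bar>J i\<bar>)"
    "neg_turns w = (\<Sum>i<n. of_bool (E i \<and> J i < 0) + of_bool (0 < J i \<and> \<not> E (Suc i)))"
    "aba w = (\<Sum>i<n. of_bool (E i = E (Suc i) \<and> J i = - (if E i then 1 else - 1)))"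
    "bab w = (\<Sum>i<n. of_bool (if E (Suc i) then J i < 0 \<and> J (Suc i) < 0 else 0 < J i \<and> 0 < J (Suc i)))"
proof -
  have "na w = (\<Sum>i<n. 1)"
    unfolding na_def stat_wrd[OF assms] by (intro sum.cong refl) (simp add: blkval_def Let_def)
  then show "na w = int n" by simp
  show "nb w = (\<Sum>i<n. \<bar>J i\<bar>)"
    unfolding nb_def stat_wrd[OF assms] by (intro sum.cong refl) (simp add: blkval_def Let_def)
  show "neg_turns w = (\<Sum>i<n. of_bool (E i \<and> J i < 0) + of_bool (0 < J i \<and> \<not> E (Suc i)))"
    unfolding neg_turns_def stat_wrd[OF assms] by (intro sum.cong refl) (auto simp: blkval_def Let_def)
  show "aba w = (\<Sum>i<n. of_bool (E i = E (Suc i) \<and> J i = - (if E i then 1 else - 1)))"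
    unfolding aba_def stat_wrd[OF assms]
    by (intro sum.cong refl) (auto simp: blkval_def Let_def abs_if split: if_splits)
  show "bab w = (\<Sum>i<n. of_bool (if E (Suc i) then J i < 0 \<and> J (Suc i) < 0 else 0 < J i \<and> 0 < J (Suc i)))"
    unfolding bab_def stat_wrd[OF assms]
    by (intro sum.cong refl) (auto simp: blkval_def Let_def nxt_def)
qed


lemma stats_bpow:
  assumes "conj_F2 (bpow j) w" "cyc_reduced (bpow j)" "reduced w"
  shows "na w = 0" "nb w = \<bar>j\<bar>" "neg_turns w = 0" "aba w = 0" "bab w = 0"
proof -
  have cnt: "cnt3 g (replicate m x @ take 2 (replicate m x @ replicate m x)) = int m * g x x x" for g m x
  proof -
    consider "m = 0" | "m = 1" | k where "m = Suc (Suc k)" by (metis One_nat_def not0_implies_Suc)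
    then show ?thesis
    proof cases
      case 3
      then show ?thesis using cnt3_replicate[of g k x x x "[]"]
        by (simp add: algebra_simps)
    qed simp_all
  qed
  have "stat g w = \<bar>j\<bar> * g (Gen_b, 0 < j) (Gen_b, 0 < j) (Gen_b, 0 < j)" for g
    using stat_eq[OF assms(3,2,1)] cnt[of g "nat \<bar>j\<bar>" "(Gen_b, 0 < j)"]
    unfolding cyc3_def bpow_def by simp
  then show "na w = 0" "nb w = \<bar>j\<bar>" "neg_turns w = 0" "aba w = 0" "bab w = 0"
    by (simp_all add: stat_defs)
qed

lemma cyc3_const: "cyc3 (\<lambda>_ _ _. 1) c = int (length c)"
proof -
  have "cnt3 (\<lambda>_ _ _. 1) (xs @ [u, v]) = int (length xs)" for xs :: word and u v
  proof (induction xs)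
    case (Cons x xs)
    then show ?case by (cases xs; cases "tl xs") auto
  qed simp
  moreover have "\<exists>u v. take 2 (c @ c) = [u, v]" if "c \<noteq> []"
    using that by (cases c; cases "tl c") auto
  ultimately show ?thesis by (cases "c = []") (auto simp: cyc3_def)
qed

lemma cyc_len_stats:
  assumes "reduced w"
  shows "int (cyc_len w) = na w + nb w"
proof -
  obtain c where c: "cyc_reduced c" "conj_F2 c w" using ex_cyc_reduced_conj assms by blast
  have "cnt3 (\<lambda>x y z. of_bool (fst x = Gen_a)) l + cnt3 (\<lambda>x y z. of_bool (fst x = Gen_b)) l
      = cnt3 (\<lambda>_ _ _. 1) l" for l
  proof (induction "\<lambda>(_::letter) (_::letter) (_::letter). 1 :: int" l rule: cnt3.induct)
    case (1 x y z r)
    then show ?case by (cases "fst x") auto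
  qed simp_all
  then show ?thesis
    using cyc_len_eq[OF assms c] cyc3_const[of c]
    by (simp add: na_def nb_def stat_eq[OF assms c] cyc3_def)
qed

lemma sum_shift_periodic:
  fixes f :: "nat \<Rightarrow> 'a::ab_group_add"
  assumes "f n = f 0"
  shows "(\<Sum>i<n. f (Suc i)) = (\<Sum>i<n. f i)"
  using sum.lessThan_Suc_shift[of f n] sum.lessThan_Suc[of f n] assms by simp

lemma conj_F2_common: "conj_F2 x y \<Longrightarrow> conj_F2 x z \<Longrightarrow> reduced y \<Longrightarrow> reduced z \<Longrightarrow> conj_F2 y z"
  using conj_F2_sym conj_F2_trans by blast

lemma periodic_mod:
  fixes f :: "nat \<Rightarrow> 'a"
  assumes "\<forall>i. f (i + n) = f i"
  shows "f i = f (i mod n)"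
proof -
  have "f (i mod n + k * n) = f (i mod n)" for k
    by (induction k) (simp_all add: assms add.assoc[symmetric] add.commute[of n])
  from this[of "i div n"] show ?thesis by simp
qed

text \<open>All identities are checked block by block. For \<open>bab\<close>: a counted factor is
  lost only when one of its two exponents moves from 1 or -1 to 0, and such a block is counted by
  \<open>aba\<close>; hence \<open>bab\<close> is unchanged when \<open>aba\<close>
  vanishes.\<close>

lemma sg_stats:
  assumes w: "reduced w"
  shows "na (sg w) = na w" "nb (sg w) = nb w + na w - 2 * neg_turns w"
    "neg_turns (sg w) = neg_turns w - aba w" "bab (sg w) \<le> bab w"
    "aba w = 0 \<Longrightarrow> bab (sg w) = bab w"
    "0 \<le> neg_turns w" "2 * neg_turns w \<le> na w + nb w" "0 \<le> aba w" "0 \<le> na w"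
proof -
  have "na (sg w) = na w \<and> nb (sg w) = nb w + na w - 2 * neg_turns w \<and>
    neg_turns (sg w) = neg_turns w - aba w \<and> bab (sg w) \<le> bab w \<and>
    (aba w = 0 \<longrightarrow> bab (sg w) = bab w) \<and>
    0 \<le> neg_turns w \<and> 2 * neg_turns w \<le> na w + nb w \<and> 0 \<le> aba w \<and> 0 \<le> na w"
    using w
  proof (cases w rule: conj_periodic_form_cases)
    case (blocks E J n)
    note form = stats_wrd[OF blocks w]
    let ?J = "\<lambda>i. J i + shift E i"
    have "conj_F2 (wrd E ?J 0 n) (sg w)"
      using conj_sg_wrd[OF blocks(1)] hom_conj[OF hom_shear(1) blocks(2) w]
      by (rule conj_F2_common) (use blocks(1) periodic_form_shift(1) periodic_form_cyc_reduced in
        \<open>auto simp: cyc_reduced_def\<close>)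
    note form' = stats_wrd[OF periodic_form_shift(1)[OF blocks(1)] this reduced_shear(1)]
    have valid: "J i = 0 \<Longrightarrow> E (Suc i) = E i" for i using blocks(1) by (auto simp: periodic_form_def)
    have per: "E n = E 0" using blocks(1) by (metis add_0 periodic_form_def)
    \<comment> \<open>For single blocks the length identity holds only up to the difference
      \<open>t i - t (Suc i)\<close>, which comes from blocks between opposite signs and telescopes
      to 0 around the cycle.\<close>
    define t :: "nat \<Rightarrow> int" where "t i = of_bool (E i)" for i
    have "\<bar>?J i\<bar> = \<bar>J i\<bar> + 1
        - 2 * (of_bool (E i \<and> J i < 0) + of_bool (0 < J i \<and> \<not> E (Suc i))) + (t i - t (Suc i))" for i
      using valid[of i] by (auto simp: shift_def t_def)
    then have nb: "nb (sg w) = nb w + na w - 2 * neg_turns w + ((\<Sum>i<n. t i) - (\<Sum>i<n. t (Suc i)))"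
      by (simp add: form form' sum.distrib sum_subtractf sum_distrib_left)
    have "of_bool (E i \<and> ?J i < 0) + of_bool (0 < ?J i \<and> \<not> E (Suc i)) =
        (of_bool (E i \<and> J i < 0) + of_bool (0 < J i \<and> \<not> E (Suc i))
          - of_bool (E i = E (Suc i) \<and> J i = - (if E i then 1 else - 1)) :: int)" for i
      by (auto simp: shift_def)
    then have nt: "neg_turns (sg w) = neg_turns w - aba w"
      by (simp add: form form' sum_subtractf)
    let ?q = "\<lambda>J i. of_bool (if E (Suc i) then J i < 0 \<and> J (Suc i) < (0::int) else 0 < J i \<and> 0 < J (Suc i)) :: int"
    have "?q ?J i \<le> ?q J i" for i by (auto simp: shift_def)
    then have q: "bab (sg w) \<le> bab w" unfolding form form' by (intro sum_mono)
    have q': "bab (sg w) = bab w" if "aba w = 0"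
    proof -
      have lt: "\<not> (E i = E (Suc i) \<and> J i = - (if E i then 1 else - 1))" if "i < n" for i
        using \<open>aba w = 0\<close> that unfolding form by (auto simp: sum_nonneg_eq_0_iff)
      \<comment> \<open>\<open>bab\<close> looks at blocks \<open>i\<close> and
        \<open>Suc i\<close>, and after the last block the indices continue cyclically; so the
        absence of destroyed factors is needed at every index, not only below
        \<open>n\<close>.\<close>
      have md: "E i = E (i mod n)" "E (Suc i) = E (Suc (i mod n))" "J i = J (i mod n)" for i
        using blocks(1) periodic_mod[of E n i] periodic_mod[of J n i] periodic_mod[of E n "Suc i"]
          periodic_mod[of E n "Suc (i mod n)"] by (simp_all add: periodic_form_def mod_Suc_eq)
      have "i mod n < n" for i using blocks(1) by (simp add: periodic_form_def)
      then have no: "\<not> (E i = E (Suc i) \<and> J i = - (if E i then 1 else - 1))" for i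
        using lt[of "i mod n"] unfolding md[of i, symmetric] by blast
      have "?q ?J i = ?q J i" for i using no[of i] no[of "Suc i"] by (auto simp: shift_def)
      then show ?thesis unfolding form form' by simp
    qed
    have "2 * (of_bool (E i \<and> J i < 0) + of_bool (0 < J i \<and> \<not> E (Suc i))) \<le> 1 + \<bar>J i\<bar>" for i
      by auto
    then have "2 * neg_turns w \<le> (\<Sum>i<n. 1 + \<bar>J i\<bar>)"
      unfolding form sum_distrib_left by (intro sum_mono)
    then have "2 * neg_turns w \<le> na w + nb w" by (simp add: form sum.distrib)
    moreover have "0 \<le> neg_turns w" "0 \<le> aba w" unfolding form by (intro sum_nonneg; simp)+
    moreover have "na (sg w) = na w" "0 \<le> na w" by (simp_all add: form form')
    moreover have "(\<Sum>i<n. t i) = (\<Sum>i<n. t (Suc i))"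
      using sum_shift_periodic[of t n] per by (simp add: t_def)
    ultimately show ?thesis using nb nt q q' by simp
  next
    case (bpow j)
    have "conj_F2 (bpow j) (sg w)"
      using hom_conj[OF hom_shear(1) bpow(1) w] sg_bpow[of j "[]"] bpow(2)
      by (simp add: mul_Nil2 cyc_reduced_def)
    then show ?thesis
      using stats_bpow[OF bpow w] stats_bpow[OF _ bpow(2) reduced_shear(1)] by simp
  qed
  then show "na (sg w) = na w" "nb (sg w) = nb w + na w - 2 * neg_turns w"
    "neg_turns (sg w) = neg_turns w - aba w" "bab (sg w) \<le> bab w"
    "aba w = 0 \<Longrightarrow> bab (sg w) = bab w"
    "0 \<le> neg_turns w" "2 * neg_turns w \<le> na w + nb w" "0 \<le> aba w" "0 \<le> na w"
    by blast+
qed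

section \<open>Permutations of the letters\<close>

definition letter_perm :: "(letter \<Rightarrow> letter) \<Rightarrow> bool"
  where "letter_perm p \<longleftrightarrow> inj p \<and> (\<forall>l. p (inv_letter l) = inv_letter (p l))"

lemma letter_perm_inv: "letter_perm p \<Longrightarrow> p (inv_letter l) = inv_letter (p l)"
  unfolding letter_perm_def by blast

lemma letter_perm_eq_inv: "letter_perm p \<Longrightarrow> p y = inv_letter (p x) \<longleftrightarrow> y = inv_letter x"
  by (metis injD letter_perm_def)

lemma map_push: "letter_perm p \<Longrightarrow> map p (push x w) = push (p x) (map p w)"
  by (cases w) (auto simp: letter_perm_eq_inv letter_perm_inv)

lemma map_mul: "letter_perm p \<Longrightarrow> map p (u \<cdot> v) = map p u \<cdot> map p v"
  by (induction u) (auto simp: map_push)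

lemma reduced_map: "letter_perm p \<Longrightarrow> reduced (map p w) = reduced w"
  by (induction w) (auto simp: reduced_Cons hd_map letter_perm_eq_inv)

lemma cyc_reduced_map: "letter_perm p \<Longrightarrow> cyc_reduced (map p w) = cyc_reduced w"
  by (cases "w = []") (auto simp: cyc_reduced_def reduced_map hd_map last_map letter_perm_eq_inv)

lemma inverse_word_map: "letter_perm p \<Longrightarrow> inverse_word (map p w) = map p (inverse_word w)"
  by (simp add: rev_map letter_perm_inv)

lemma hom_map: "letter_perm p \<Longrightarrow> map p \<in> hom F2 F2"
  by (auto simp: hom_def reduced_map map_mul)

lemma conj_F2_map: "letter_perm p \<Longrightarrow> conj_F2 v w \<Longrightarrow> reduced w \<Longrightarrow> conj_F2 (map p v) (map p w)"
  using hom_conj hom_map by blast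

lemma cyc_len_map:
  assumes "letter_perm p" "reduced w"
  shows "cyc_len (map p w) = cyc_len w"
proof -
  obtain c where "cyc_reduced c" "conj_F2 c w" using ex_cyc_reduced_conj assms by blast
  then show ?thesis
    using cyc_len_eq[of w c] cyc_len_eq[of "map p w" "map p c"] assms
    by (simp add: cyc_reduced_map reduced_map conj_F2_map)
qed

lemma stat_map:
  assumes "letter_perm p" "reduced w"
  shows "stat g (map p w) = stat (\<lambda>x y z. g (p x) (p y) (p z)) w"
proof -
  obtain c where "cyc_reduced c" "conj_F2 c w" using ex_cyc_reduced_conj assms by blast
  then show ?thesis
    using stat_eq[of w c] stat_eq[of "map p w" "map p c"] assms
    by (simp add: cyc_reduced_map reduced_map conj_F2_map cyc3_map)
qed

definition swap_gen :: "letter \<Rightarrow> letter"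
  where "swap_gen l = (case fst l of Gen_a \<Rightarrow> Gen_b | Gen_b \<Rightarrow> Gen_a, snd l)"

lemma swap_gen_simps [simp]: "swap_gen (Gen_a, s) = (Gen_b, s)" "swap_gen (Gen_b, s) = (Gen_a, s)"
  "swap_gen (swap_gen l) = l" "snd (swap_gen l) = snd l"
  "fst (swap_gen l) = Gen_a \<longleftrightarrow> fst l = Gen_b" "fst (swap_gen l) = Gen_b \<longleftrightarrow> fst l = Gen_a"
  by (cases l; auto simp: swap_gen_def split: gen.split)+

lemma map_swap_gen_invol [simp]: "map swap_gen (map swap_gen w) = w"
  by (simp add: comp_def)

lemma inj_swap_gen: "swap_gen x = swap_gen y \<longleftrightarrow> x = y"
  by (metis swap_gen_simps(3))

lemma letter_perm_swap [simp]: "letter_perm swap_gen"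
  unfolding letter_perm_def
  by (auto simp: inj_def inj_swap_gen) (auto simp: swap_gen_def inv_letter_def split: gen.split)

lemma ta_Cons: "ta ((Gen_a, s) # w) = push (Gen_a, s) (ta w)"
  "ta ((Gen_b, True) # w) = push (Gen_b, True) (push (Gen_a, True) (ta w))"
  "ta ((Gen_b, False) # w) = push (Gen_a, False) (push (Gen_b, False) (ta w))"
  by (cases s; simp add: ta_def lift_def eval_letter_def F2_inv reduced_Cons)+

lemma tai_Cons: "tai ((Gen_a, s) # w) = push (Gen_a, s) (tai w)"
  "tai ((Gen_b, True) # w) = push (Gen_b, True) (push (Gen_a, False) (tai w))"
  "tai ((Gen_b, False) # w) = push (Gen_a, True) (push (Gen_b, False) (tai w))"
  by (cases s; simp add: tai_def lift_def eval_letter_def F2_inv reduced_Cons)+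

lemma letter_cases:
  obtains "l = (Gen_a, True)" | "l = (Gen_a, False)" | "l = (Gen_b, True)" | "l = (Gen_b, False)"
  by (cases l; cases "fst l"; cases "snd l") auto

lemma map_swap_sg: "map swap_gen (sg w) = ta (map swap_gen w)"
proof (induction w)
  case (Cons l w)
  then show ?case by (cases l rule: letter_cases) (simp_all add: sg_Cons ta_Cons map_push)
qed simp

lemma map_swap_sgi: "map swap_gen (sgi w) = tai (map swap_gen w)"
proof (induction w)
  case (Cons l w)
  then show ?case by (cases l rule: letter_cases) (simp_all add: sgi_Cons tai_Cons map_push)
qed simp

lemma map_swap_ta: "map swap_gen (ta w) = sg (map swap_gen w)"
  using map_swap_sg[of "map swap_gen w"] by (metis map_swap_gen_invol)

lemma stats_swap:
  assumes "reduced w"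
  shows "na (map swap_gen w) = nb w" "nb (map swap_gen w) = na w"
    "neg_turns (map swap_gen w) = neg_turns w"
    "aba (map swap_gen w) = bab w" "bab (map swap_gen w) = aba w"
proof -
  have "fst (swap_gen x) \<noteq> fst (swap_gen y) \<longleftrightarrow> fst x \<noteq> fst y" for x y
    by (auto simp: swap_gen_def split: gen.split)
  then show "neg_turns (map swap_gen w) = neg_turns w"
    using assms by (simp add: neg_turns_def stat_map)
qed (use assms in \<open>simp_all add: stat_defs stat_map inj_swap_gen\<close>)

lemma ta_stats:
  assumes w: "reduced w"
  shows "nb (ta w) = nb w" "na (ta w) = na w + nb w - 2 * neg_turns w"
    "neg_turns (ta w) = neg_turns w - bab w" "aba (ta w) \<le> aba w"
    "bab w = 0 \<Longrightarrow> aba (ta w) = aba w" "0 \<le> bab w" "0 \<le> nb w"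
  using sg_stats[of "map swap_gen w"] stats_swap[OF w] stats_swap[of "ta w"] w
  by (simp_all add: reduced_map map_swap_ta)

section \<open>Pulling back factors\<close>

definition xl :: letter where "xl = (Gen_a, True)"
definition yl :: letter where "yl = (Gen_b, False)"

lemma xl_neq_yl [simp]: "xl \<noteq> yl" "yl \<noteq> xl" by (simp_all add: xl_def yl_def)

text \<open>On words in \<open>x = a\<close> and \<open>y = b\<^sup>-\<^sup>1\<close> alone both inverse maps are positive substitutions (\<open>x \<mapsto> x y\<close> and
  \<open>y \<mapsto> x y\<close>). Hence a factor of this kind in the image of a cyclic word under a long chain comes from a long
  factor of the cyclic word itself; only the numbers of letters \<open>x\<close> and \<open>y\<close> matter for this.\<close>

definition occ :: "nat \<Rightarrow> nat \<Rightarrow> word \<Rightarrow> bool"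
  where "occ m k w \<longleftrightarrow> (\<exists>z r. set z \<subseteq> {xl, yl} \<and> count_list z xl = m \<and> count_list z yl = k \<and>
    cyc_reduced (z @ r) \<and> (conj_F2 (z @ r) w \<or> conj_F2 (z @ r) (inverse_word w)))"

definition whole :: "nat \<Rightarrow> nat \<Rightarrow> word \<Rightarrow> bool"
  where "whole m k w \<longleftrightarrow> (\<exists>z. set z \<subseteq> {xl, yl} \<and> count_list z xl = m \<and> count_list z yl = k \<and>
    (conj_F2 z w \<or> conj_F2 z (inverse_word w)))"

lemma reduced_mode: "set z \<subseteq> {xl, yl} \<Longrightarrow> reduced z"
proof (induction z)
  case (Cons l z)
  then show ?case by (cases z) (auto simp: reduced_Cons xl_def yl_def)
qed simp

lemma cyc_reduced_mode: "set z \<subseteq> {xl, yl} \<Longrightarrow> cyc_reduced z"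
proof -
  assume z: "set z \<subseteq> {xl, yl}"
  have "hd z \<noteq> inv_letter (last z)" if "z \<noteq> []"
  proof -
    have "hd z \<in> {xl, yl}" "last z \<in> {xl, yl}" using that z hd_in_set last_in_set by blast+
    then show ?thesis by (auto simp: xl_def yl_def)
  qed
  then show ?thesis using reduced_mode[OF z] by (simp add: cyc_reduced_def)
qed

lemma length_mode: "set z \<subseteq> {xl, yl} \<Longrightarrow> length z = count_list z xl + count_list z yl"
  by (induction z) auto

lemma conj_F2_inverse:
  assumes "conj_F2 v w" "reduced w"
  shows "conj_F2 (inverse_word v) (inverse_word w)"
proof -
  obtain g where g: "reduced g" "v = g \<cdot> (w \<cdot> inverse_word g)" using assms conj_F2_iff by blast
  then have "inverse_word v = g \<cdot> (inverse_word w \<cdot> inverse_word g)"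
    using assms by (simp add: inverse_word_mul reduced_inverse reduced_foldr_push foldr_push_assoc
        del: rev_map)
  then show ?thesis using conj_F2I[of g "inverse_word w"] g assms by (simp add: reduced_inverse)
qed

lemma cyc_len_inverse:
  assumes "reduced w"
  shows "cyc_len (inverse_word w) = cyc_len w"
proof -
  obtain c where c: "cyc_reduced c" "conj_F2 c w" using ex_cyc_reduced_conj assms by blast
  then show ?thesis
    using cyc_len_eq[OF assms c] cyc_len_eq[of "inverse_word w" "inverse_word c"] assms
    by (simp add: cyc_reduced_inverse conj_F2_inverse reduced_inverse)
qed

lemma occ_le_cyc_len:
  assumes "occ m k w" "reduced w"
  shows "m + k \<le> cyc_len w"
proof -
  obtain z r where z: "set z \<subseteq> {xl, yl}" "count_list z xl = m" "count_list z yl = k"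
    "cyc_reduced (z @ r)" "conj_F2 (z @ r) w \<or> conj_F2 (z @ r) (inverse_word w)"
    using assms(1) unfolding occ_def by blast
  have "cyc_len w = length (z @ r)"
    using z(4,5) cyc_len_eq cyc_len_inverse[OF assms(2)] reduced_inverse assms(2) by metis
  then show ?thesis using length_mode[OF z(1)] z by simp
qed

lemma whole_cyc_len:
  assumes "whole m k w" "reduced w"
  shows "m + k = cyc_len w"
proof -
  obtain z where z: "set z \<subseteq> {xl, yl}" "count_list z xl = m" "count_list z yl = k"
    "conj_F2 z w \<or> conj_F2 z (inverse_word w)"
    using assms(1) unfolding whole_def by blast
  have "cyc_len w = length z"
    using z(4) cyc_reduced_mode[OF z(1)] cyc_len_eq cyc_len_inverse[OF assms(2)] reduced_inverse assms(2)
    by metis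
  then show ?thesis using length_mode[OF z(1)] z by simp
qed

lemma inv_swap_mode: "inv_letter (swap_gen xl) = yl" "inv_letter (swap_gen yl) = xl"
  by (simp_all add: xl_def yl_def)

lemma inverse_swap_mode:
  assumes "set z \<subseteq> {xl, yl}"
  shows "set (inverse_word (map swap_gen z)) \<subseteq> {xl, yl}"
    "count_list (inverse_word (map swap_gen z)) xl = count_list z yl"
    "count_list (inverse_word (map swap_gen z)) yl = count_list z xl"
  using assms by (induction z) (auto simp: inv_swap_mode)

lemma conj_inverse_cases:
  assumes "conj_F2 c w \<or> conj_F2 c (inverse_word w)" "reduced w"
  shows "conj_F2 (inverse_word (map swap_gen c)) (map swap_gen w) \<or>
    conj_F2 (inverse_word (map swap_gen c)) (inverse_word (map swap_gen w))"
  using assms(1)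
proof
  assume "conj_F2 c w"
  then have "conj_F2 (map swap_gen c) (map swap_gen w)" using conj_F2_map assms(2) by simp
  then show ?thesis using conj_F2_inverse assms(2) reduced_map by (metis letter_perm_swap)
next
  assume "conj_F2 c (inverse_word w)"
  then have "conj_F2 (map swap_gen c) (map swap_gen (inverse_word w))"
    using conj_F2_map assms(2) reduced_inverse by simp
  then have "conj_F2 (map swap_gen c) (inverse_word (map swap_gen w))"
    by (simp only: inverse_word_map[OF letter_perm_swap])
  then have "conj_F2 (inverse_word (map swap_gen c)) (inverse_word (inverse_word (map swap_gen w)))"
    using conj_F2_inverse assms(2) reduced_inverse reduced_map by (metis letter_perm_swap)
  then show ?thesis by (simp only: inverse_word_inverse_word simp_thms)
qed

lemma occ_swap:
  assumes "occ m k w" "reduced w"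
  shows "occ k m (map swap_gen w)"
proof -
  obtain z r where z: "set z \<subseteq> {xl, yl}" "count_list z xl = m" "count_list z yl = k"
    "cyc_reduced (z @ r)" "conj_F2 (z @ r) w \<or> conj_F2 (z @ r) (inverse_word w)"
    using assms(1) unfolding occ_def by blast
  let ?z = "inverse_word (map swap_gen z)" and ?r = "inverse_word (map swap_gen r)"
  have rz: "inverse_word (map swap_gen (z @ r)) = ?r @ ?z" by simp
  have c: "cyc_reduced (?r @ ?z)"
    unfolding rz[symmetric] by (intro cyc_reduced_inverse) (use z in \<open>simp add: cyc_reduced_map del: map_append\<close>)
  have cz: "cyc_reduced (?z @ ?r)" using c cyc_reduced_swap by blast
  have "conj_F2 (?z @ ?r) (?r @ ?z)" using conj_F2_swap[OF c] .
  moreover have "conj_F2 (?r @ ?z) (map swap_gen w) \<or> conj_F2 (?r @ ?z) (inverse_word (map swap_gen w))"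
    using conj_inverse_cases[OF z(5) assms(2)] by (simp only: rz)
  ultimately have "conj_F2 (?z @ ?r) (map swap_gen w) \<or> conj_F2 (?z @ ?r) (inverse_word (map swap_gen w))"
    using conj_F2_trans[of "?z @ ?r" "?r @ ?z"] assms(2)
      reduced_inverse[of "map swap_gen w"] by (auto simp: reduced_map simp del: rev_map map_map)
  then show ?thesis unfolding occ_def using inverse_swap_mode[OF z(1)] z cz by blast
qed

lemma whole_swap:
  assumes "whole m k w" "reduced w"
  shows "whole k m (map swap_gen w)"
proof -
  obtain z where z: "set z \<subseteq> {xl, yl}" "count_list z xl = m" "count_list z yl = k"
    "conj_F2 z w \<or> conj_F2 z (inverse_word w)"
    using assms(1) unfolding whole_def by blast
  show ?thesis unfolding whole_def
    using inverse_swap_mode[OF z(1)] z conj_inverse_cases[OF z(4) assms(2)] by blast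
qed

lemma sgi_push: "sgi (push (Gen_a, True) w) = push (Gen_a, True) (push (Gen_b, False) (sgi w))"
  "sgi (push (Gen_a, False) w) = push (Gen_b, True) (push (Gen_a, False) (sgi w))"
  "sgi (push (Gen_b, s) w) = push (Gen_b, s) (sgi w)"
  unfolding sgi_def
  by (subst F2.lift_push; auto split: gen.split simp: reduced_Cons eval_letter_def F2_inv)+

lemma sgi_sg:
  assumes "reduced w"
  shows "sgi (sg w) = w"
proof -
  have "sgi (sg w) = nform w" for w
  proof (induction w)
    case (Cons l w)
    have "nform (l # w) = push l (nform w)" by (simp add: nform_def)
    then show ?case
      using Cons push_push_inv[OF reduced_nform, of "(Gen_b, False)" w] push_push_inv[OF reduced_nform, of "(Gen_b, True)" w]
      by (cases l rule: letter_cases)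
        (simp_all add: sg_Cons sgi_push push_push_inv[where x = "(Gen_b, False)", simplified] push_push_inv[where x = "(Gen_b, True)", simplified] reduced_push)
  qed (simp add: nform_def)
  then show ?thesis using nform_reduced assms by simp
qed

text \<open>The inverse of \<sigma> adds one \<open>y\<close> per \<open>x\<close>. A full cyclic
  word has no boundary at which a gain is lost, in contrast to \<open>occ_sg\<close>.\<close>

lemma whole_sg:
  assumes "whole m k (sg w)" "reduced w"
  shows "whole m (m + k) w"
proof -
  obtain z where z: "set z \<subseteq> {xl, yl}" "count_list z xl = m" "count_list z yl = k"
    "conj_F2 z (sg w) \<or> conj_F2 z (inverse_word (sg w))"
    using assms(1) unfolding whole_def by blast
  have "\<exists>z2. sgi z = z2 \<and> set z2 \<subseteq> {xl, yl} \<and> count_list z2 xl = count_list z xl \<and>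
      count_list z2 yl = count_list z xl + count_list z yl"
    using z(1)
  proof (induction z)
    case (Cons l z)
    then obtain z2 where z2: "sgi z = z2" "set z2 \<subseteq> {xl, yl}" "count_list z2 xl = count_list z xl"
      "count_list z2 yl = count_list z xl + count_list z yl" by auto
    have "push yl z2 = yl # z2" using push_eq_Cons[OF reduced_mode[of "yl # z2"]] z2(2) by simp
    moreover have "push xl (yl # z2) = xl # yl # z2"
      using push_eq_Cons[OF reduced_mode[of "xl # yl # z2"]] z2(2) by simp
    ultimately show ?case using Cons.prems z2
      by (auto simp: sgi_Cons xl_def[symmetric] yl_def[symmetric] simp del: push.simps)
        (auto simp: sgi_Cons xl_def yl_def simp del: push.simps)
  qed simp
  then obtain z2 where z2: "sgi z = z2" "set z2 \<subseteq> {xl, yl}" "count_list z2 xl = m"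
    "count_list z2 yl = m + k" using z by auto
  have "conj_F2 z2 (sgi (sg w)) \<or> conj_F2 z2 (sgi (inverse_word (sg w)))"
    using z(4) z2(1) hom_conj[OF hom_shear(2)] reduced_inverse reduced_shear by metis
  then have "conj_F2 z2 w \<or> conj_F2 z2 (inverse_word w)"
    using sgi_sg[OF assms(2)] hom_inverse[OF hom_shear(2), of "sg w"] by simp
  then show ?thesis unfolding whole_def using z2 by blast
qed

lemma replicate_yl_prefix:
  assumes "replicate m yl @ r = bpow j @ u" "u = [] \<or> fst (hd u) = Gen_a"
  shows "r = bpow (j + int m) @ u" "0 < m \<Longrightarrow> j \<le> - int m"
proof -
  have "r = bpow (j + int m) @ u \<and> (0 < m \<longrightarrow> j \<le> - int m)"
    using assms
  proof (induction m arbitrary: j)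
    case (Suc m)
    have j: "j < 0" and "nat \<bar>j\<bar> = Suc (nat \<bar>j + 1\<bar>)"
    proof -
      show "j < 0"
      proof (rule ccontr)
        assume j: "\<not> j < 0"
        show False
        proof (cases "j = 0")
          case True
          then have "yl # replicate m yl @ r = u" using Suc.prems(1) by (simp add: bpow_def)
          then show False using Suc.prems(2) by (auto simp: yl_def)
        next
          case False
          then obtain k where "nat j = Suc k" using j by (cases "nat j") auto
          then show False using Suc.prems(1) j False by (simp add: bpow_def yl_def)
        qed
      qed
      then show "nat \<bar>j\<bar> = Suc (nat \<bar>j + 1\<bar>)" by linarith
    qed
    then have "bpow j = yl # bpow (j + 1)" by (cases "j + 1 = 0") (auto simp: bpow_def yl_def)
    then have "replicate m yl @ r = bpow (j + 1) @ u" using Suc.prems by simp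
    from Suc.IH[OF this Suc.prems(2)] show ?case using j
      by (cases "m = 0") (auto simp: algebra_simps)
  qed simp
  then show "r = bpow (j + int m) @ u" "0 < m \<Longrightarrow> j \<le> - int m" by blast+
qed

lemma bpow_yl_suffix: "j \<le> - int s \<Longrightarrow> \<exists>r. bpow j = r @ replicate s yl"
proof -
  assume j: "j \<le> - int s"
  show ?thesis
  proof (cases "j = 0")
    case False
    then have "bpow j = replicate (nat \<bar>j\<bar> - s + s) yl" using j by (auto simp: bpow_def yl_def)
    then show ?thesis by (metis replicate_add)
  qed (use j in simp)
qed

lemma wrd_hd: "wrd E J k n = [] \<or> fst (hd (wrd E J k n)) = Gen_a"
  by (cases "k < n") (simp add: wrd_Cons blk_def, simp add: wrd_def)

lemma rev_bpow: "rev (bpow j) = bpow j"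
  by (simp add: bpow_def)

lemma replicate_yl_suffix:
  assumes "bpow j = r0 @ replicate s yl \<or> u @ (Gen_a, e) # bpow j = r0 @ replicate s yl" "0 < s"
  shows "j \<le> - int s"
  using assms(1)
proof
  assume "bpow j = r0 @ replicate s yl"
  then have "rev (bpow j) = rev (r0 @ replicate s yl)" by (rule arg_cong)
  then have "replicate s yl @ rev r0 = bpow j @ []" by (simp add: rev_bpow)
  then show ?thesis using replicate_yl_prefix(2)[of s "rev r0" j "[]"] assms(2) by simp
next
  assume "u @ (Gen_a, e) # bpow j = r0 @ replicate s yl"
  then have "rev (u @ (Gen_a, e) # bpow j) = rev (r0 @ replicate s yl)" by (rule arg_cong)
  then have "replicate s yl @ rev r0 = bpow j @ (Gen_a, e) # rev u" by (simp add: rev_bpow)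
  then show ?thesis using replicate_yl_prefix(2)[of s "rev r0" j "(Gen_a, e) # rev u"] assms(2) by simp
qed

text \<open>The \<open>a\<close>-letter after the last block is positive, so the last shift is 0 or
  1 and the inverse of \<sigma> can only lower the last exponent: \<open>y\<close> letters at the
  end of the word are kept.\<close>

lemma wrd_suffix:
  assumes "k < n" "E n" "c @ wrd E J k n = r0 @ replicate s yl"
  shows "\<exists>r3. d @ wrd E (\<lambda>i. J i - shift E i) k n = r3 @ replicate s yl"
proof (cases "s = 0")
  case False
  obtain n' where n': "n = Suc n'" using assms(1) by (cases n) auto
  have wrd: "wrd E J k n = wrd E J k n' @ (Gen_a, E n') # bpow (J n')" for J
    using wrd_append[of k n' n E J] wrd_Cons[of n' n E J] assms(1) by (simp add: n' blk_def)
  have "J n' \<le> - int s"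
    using replicate_yl_suffix[of "J n'" r0 s "c @ wrd E J k n'" "E n'"] assms(3) wrd[of J] False by simp
  then have "J n' - shift E n' \<le> - int s" using assms(2) by (auto simp: shift_def n')
  then obtain r where "bpow (J n' - shift E n') = r @ replicate s yl" using bpow_yl_suffix by blast
  then show ?thesis using wrd[of "\<lambda>i. J i - shift E i"] by simp
qed simp

text \<open>A gap between consecutive \<open>x\<close> of the factor lies between two positive
  \<open>a\<close>, so the inverse of \<sigma> gives it one more \<open>y\<close>. Behind the last
  \<open>x\<close> the next sign is unknown, and the \<open>y\<close> letters there are merely kept.
  The last conjunct protects \<open>y\<close> letters at the far end, which
  \<open>occ_pullback\<close> has rotated there.\<close>

lemma wrd_pullback:
  assumes "set z \<subseteq> {xl, yl}" "k \<le> n" "E n" "wrd E J k n = (xl # z) @ r"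
  shows "\<exists>z2 r2. wrd E (\<lambda>i. J i - shift E i) k n = z2 @ r2 \<and> set z2 \<subseteq> {xl, yl} \<and>
    count_list z2 xl = Suc (count_list z xl) \<and> count_list z2 yl = count_list z yl + count_list z xl \<and>
    (\<forall>s r0. r = r0 @ replicate s yl \<longrightarrow> (\<exists>r3. r2 = r3 @ replicate s yl))"
  using assms
proof (induction "length z" arbitrary: z k rule: less_induct)
  case less
  let ?J = "\<lambda>i. J i - shift E i"
  have kn: "k < n" using less.prems(2,4) by (cases "k = n") auto
  have Ek: "E k" and eq: "bpow (J k) @ wrd E J (Suc k) n = z @ r"
    using less.prems(4) kn by (auto simp: wrd_Cons blk_def xl_def)
  define m z' where "m = length (takeWhile (\<lambda>l. l = yl) z)" and "z' = dropWhile (\<lambda>l. l = yl) z"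
  have "takeWhile (\<lambda>l. l = yl) z = replicate m yl"
    unfolding m_def by (rule replicate_length_same[symmetric]) (auto dest: set_takeWhileD)
  then have z: "z = replicate m yl @ z'"
    using takeWhile_dropWhile_id[of "\<lambda>l. l = yl" z] by (simp add: z'_def)
  have pre: "z' @ r = bpow (J k + int m) @ wrd E J (Suc k) n" "0 < m \<Longrightarrow> J k \<le> - int m"
    using replicate_yl_prefix[of m "z' @ r" "J k" "wrd E J (Suc k) n"] eq wrd_hd z by auto
  have J: "?J k \<le> J k" using Ek by (simp add: shift_def)
  have rep: "bpow (?J k) = replicate m yl @ bpow (?J k + int m)" if "0 < m"
  proof -
    have neg: "?J k \<le> - int m" using J pre(2)[OF that] by linarith
    then have "nat \<bar>?J k\<bar> = m + nat \<bar>?J k + int m\<bar>" by linarith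
    then show ?thesis using neg that by (cases "?J k + int m = 0") (auto simp: bpow_def yl_def replicate_add)
  qed
  show ?case
  proof (cases z')
    case Nil
    let ?r2 = "bpow (?J k + int m) @ wrd E ?J (Suc k) n"
    have w: "wrd E ?J k n = (xl # z) @ ?r2"
      using kn Ek rep z Nil by (cases "m = 0") (auto simp: wrd_Cons blk_def xl_def)
    have c: "count_list z xl = 0" using z Nil by (simp add: count_list_0_iff)
    have "\<exists>r3. ?r2 = r3 @ replicate s yl" if r: "r = r0 @ replicate s yl" for s r0
    proof (cases "s = 0")
      case s: False
      show ?thesis
      proof (cases "Suc k = n")
        case True
        have "bpow (J k + int m) = r0 @ replicate s yl" using pre(1) Nil True r by simp
        then have "J k + int m \<le> - int s" using replicate_yl_suffix[of "J k + int m" r0 s] s by blast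
        then have "?J k + int m \<le> - int s" using J by linarith
        from bpow_yl_suffix[OF this] show ?thesis using True by simp
      next
        case False
        then have "Suc k < n" using kn by simp
        then show ?thesis
          using wrd_suffix[of "Suc k" n E "bpow (J k + int m)" J r0 s] less.prems(3) pre(1) Nil r by simp
      qed
    qed simp
    then show ?thesis
      by (intro exI[of _ "xl # z"] exI[of _ ?r2]) (use w c less.prems(1) in auto)
  next
    case (Cons l z'')
    then have "l = xl" using hd_dropWhile[of "\<lambda>l. l = yl" z] less.prems(1) z
      unfolding z'_def[symmetric] by auto
    then have z': "z' = xl # z''" using Cons by simp
    have "bpow (J k + int m) = []"
    proof (rule ccontr)
      assume "bpow (J k + int m) \<noteq> []"
      then have "fst (hd (bpow (J k + int m) @ wrd E J (Suc k) n)) = Gen_b"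
        by (auto simp: bpow_def hd_append)
      then show False using pre(1)[symmetric] z' by (simp add: xl_def)
    qed
    then have Jk: "J k = - int m" by (simp add: bpow_def)
    then have w1: "wrd E J (Suc k) n = (xl # z'') @ r" using pre(1) z' by (simp add: bpow_def)
    then have kn': "Suc k < n" by (cases "Suc k < n") (auto simp: wrd_def)
    then have "E (Suc k)" using w1 by (simp add: wrd_Cons blk_def xl_def)
    then have "?J k = - int (Suc m)" using Ek Jk by (simp add: shift_def)
    then have b: "bpow (?J k) = replicate (Suc m) yl"
      by (simp only: bpow_def) (simp add: yl_def nat_add_distrib)
    have len: "length z'' < length z" and sz: "set z'' \<subseteq> {xl, yl}"
      using z z' less.prems(1) by auto
    obtain z2 r2 where z2: "wrd E ?J (Suc k) n = z2 @ r2" "set z2 \<subseteq> {xl, yl}"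
      "count_list z2 xl = Suc (count_list z'' xl)" "count_list z2 yl = count_list z'' yl + count_list z'' xl"
      "\<forall>s r0. r = r0 @ replicate s yl \<longrightarrow> (\<exists>r3. r2 = r3 @ replicate s yl)"
      using less.hyps[OF len sz _ less.prems(3) w1] kn' by auto
    have cr: "count_list (replicate q yl) xl = 0" "count_list (replicate q yl) yl = q" for q
      by (induction q) auto
    show ?thesis
      by (intro exI[of _ "xl # replicate (Suc m) yl @ z2"] exI[of _ r2])
        (use kn Ek b z2 z z' cr in \<open>auto simp: wrd_Cons blk_def xl_def[symmetric] simp del: replicate_Suc\<close>)
  qed
qed

lemma occ_pullback:
  assumes z: "set z \<subseteq> {xl, yl}" "xl \<in> set z" and c: "cyc_reduced (z @ r)" "conj_F2 (z @ r) (sg w)" and w: "reduced w"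
  shows "\<exists>z2 r2. set z2 \<subseteq> {xl, yl} \<and> count_list z2 xl = count_list z xl \<and>
    count_list z2 yl = count_list z xl + count_list z yl - 1 \<and> cyc_reduced (z2 @ r2) \<and> conj_F2 (z2 @ r2) w"
proof -
  obtain z0 z1 where z01: "z = z0 @ xl # z1" "xl \<notin> set z0" by (metis split_list_first z(2))
  have "\<forall>l \<in> set z0. l = yl" using z01 z(1) by auto
  then have z0: "z0 = replicate (length z0) yl" by (simp add: replicate_length_same)
  define m where "m = length z0"
  have zz: "z = replicate m yl @ xl # z1" using z01 z0 m_def by metis
  \<comment> \<open>The block form has to start with an \<open>a\<close>-letter, so the leading
    \<open>y\<close> letters of the factor are rotated to the end. They survive the pullback and are
    rotated back afterwards.\<close>
  let ?c = "(xl # z1) @ r @ replicate m yl"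
  have cr: "cyc_reduced ?c" and "conj_F2 ?c (z @ r)"
    using c(1) cyc_reduced_swap[of "replicate m yl" "(xl # z1) @ r"] conj_F2_swap[of "replicate m yl" "(xl # z1) @ r"]
    by (simp_all add: zz)
  then have csg: "conj_F2 ?c (sg w)" using conj_F2_trans c(2) reduced_shear(1) by blast
  obtain E J n where EJ: "periodic_form E J n" "?c = wrd E J 0 n"
    using ex_periodic_form[OF cr] by (auto simp: xl_def)
  let ?J = "\<lambda>i. J i - shift E i"
  have pf: "periodic_form E ?J n" using periodic_form_shift(2)[OF EJ(1)] .
  have "0 < n" "E n = E 0" using EJ(1) by (auto simp: periodic_form_def) (metis add_0)+
  moreover have "E 0" using EJ(2) \<open>0 < n\<close> by (simp add: wrd_Cons blk_def xl_def)
  ultimately obtain z2 r2 where z2: "wrd E ?J 0 n = z2 @ r2" "set z2 \<subseteq> {xl, yl}"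
    "count_list z2 xl = Suc (count_list z1 xl)" "count_list z2 yl = count_list z1 yl + count_list z1 xl"
    "\<exists>r3. r2 = r3 @ replicate m yl"
    using wrd_pullback[of z1 0 n E J "r @ replicate m yl"] EJ(2) zz z(1) by auto
  then obtain r3 where r3: "r2 = r3 @ replicate m yl" by blast
  have red: "cyc_reduced (wrd E ?J 0 n)" using pf periodic_form_cyc_reduced by blast
  have "conj_F2 (sg (wrd E ?J 0 n)) (wrd E J 0 n)" using conj_sg_wrd[OF pf] by simp
  then have "conj_F2 (sg (wrd E ?J 0 n)) (sg w)"
    using csg EJ(2) conj_F2_trans reduced_shear(1) by metis
  then have "conj_F2 (sgi (sg (wrd E ?J 0 n))) (sgi (sg w))" using hom_conj hom_shear reduced_shear by blast
  then have "conj_F2 (wrd E ?J 0 n) w" using sgi_sg w red by (simp add: cyc_reduced_def)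
  moreover have "conj_F2 ((replicate m yl @ z2) @ r3) (wrd E ?J 0 n)" "cyc_reduced ((replicate m yl @ z2) @ r3)"
    using conj_F2_swap[of "z2 @ r3" "replicate m yl"] cyc_reduced_swap[of "z2 @ r3" "replicate m yl"] red z2(1) r3
    by simp_all
  moreover have cr: "count_list (replicate q yl) xl = 0" "count_list (replicate q yl) yl = q" for q
    by (induction q) auto
  ultimately show ?thesis
    using z2 zz w by (intro exI[of _ "replicate m yl @ z2"] exI[of _ r3]) (auto intro: conj_F2_trans)
qed

lemma occ_sg:
  assumes "occ m k (sg w)" "0 < m" "reduced w"
  shows "occ m (m + k - 1) w"
proof -
  obtain z r where z: "set z \<subseteq> {xl, yl}" "count_list z xl = m" "count_list z yl = k"
    "cyc_reduced (z @ r)" "conj_F2 (z @ r) (sg w) \<or> conj_F2 (z @ r) (sg (inverse_word w))"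
    using assms(1) hom_inverse[OF hom_shear(1) assms(3)] unfolding occ_def by auto
  have x: "xl \<in> set z" using z(2) assms(2) by (metis count_list_0_iff less_numeral_extra(3))
  show ?thesis
    using z(5)
  proof
    assume "conj_F2 (z @ r) (sg w)"
    from occ_pullback[OF z(1) x z(4) this assms(3)] show ?thesis using z unfolding occ_def by blast
  next
    assume "conj_F2 (z @ r) (sg (inverse_word w))"
    from occ_pullback[OF z(1) x z(4) this reduced_inverse[OF assms(3)]] show ?thesis
      using z unfolding occ_def by blast
  qed
qed

section \<open>Blocks whose exponent opposes the surrounding signs\<close>

lemma wrd_rotate:
  assumes "periodic_form E J n" "i < n"
  shows "periodic_form (\<lambda>t. E (t + i)) (\<lambda>t. J (t + i)) n"
    "conj_F2 (wrd (\<lambda>t. E (t + i)) (\<lambda>t. J (t + i)) 0 n) (wrd E J 0 n)"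
proof -
  have per: "E (t + n) = E t" "J (t + n) = J t" for t using assms(1) by (simp_all add: periodic_form_def)
  have "E (t + n + i) = E (t + i)" "J (t + n + i) = J (t + i)" for t
    using per[of "t + i"] by (simp_all add: ac_simps)
  then show "periodic_form (\<lambda>t. E (t + i)) (\<lambda>t. J (t + i)) n"
    using assms(1) by (simp add: periodic_form_def)
  have sh: "wrd (\<lambda>t. E (t + m)) (\<lambda>t. J (t + m)) 0 k = wrd E J m (k + m)" for m k
    unfolding wrd_def by (simp add: comp_def flip: map_add_upt)
  have "wrd E J n (n + i) = wrd E J 0 i"
    using sh[of n i] by (simp add: per add.commute)
  then have "wrd (\<lambda>t. E (t + i)) (\<lambda>t. J (t + i)) 0 n = wrd E J i n @ wrd E J 0 i"
    using wrd_append[of i n "n + i" E J] assms(2) by (simp add: sh)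
  moreover have "wrd E J 0 n = wrd E J 0 i @ wrd E J i n" using wrd_append assms(2) by simp
  ultimately show "conj_F2 (wrd (\<lambda>t. E (t + i)) (\<lambda>t. J (t + i)) 0 n) (wrd E J 0 n)"
    using conj_F2_swap periodic_form_cyc_reduced[OF assms(1)] by simp
qed

lemma count_replicate_yl: "count_list (replicate q yl) xl = 0" "count_list (replicate q yl) yl = q"
  by (induction q) auto

text \<open>\<open>a b^-j a\<close> is \<open>x y^j x\<close>; with negative signs the inverse word
  has this factor, which \<open>occ\<close> admits too. If there is just one block, both
  \<open>a\<close>-letters are the same letter of the cyclic word, and this is the case of
  \<open>whole\<close>.\<close>

lemma first_block_negative:
  assumes "periodic_form E J n" "conj_F2 (wrd E J 0 n) w" "reduced w"
    "E 0 = E (Suc 0)" "J 0 = (if E 0 then - int j else int j)" "0 < j"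
  shows "occ 2 j w \<or> whole 1 j w"
proof -
  have n: "0 < n" using assms(1) by (simp add: periodic_form_def)
  have cr: "cyc_reduced (wrd E J 0 n)" using periodic_form_cyc_reduced assms(1) by blast
  have ci: "conj_F2 (inverse_word (wrd E J 0 n)) (inverse_word w)"
    using conj_F2_inverse assms(2,3) by blast
  have b: "bpow (J 0) = replicate j (Gen_b, \<not> E 0)" using assms(5,6) by (auto simp: bpow_def)
  have inv: "inverse_word (replicate j (Gen_b, True)) = replicate j yl" by (simp add: yl_def)
  show ?thesis
  proof (cases "n = 1")
    case True
    then have wd: "wrd E J 0 n = (Gen_a, E 0) # replicate j (Gen_b, \<not> E 0)"
      by (simp add: wrd_Cons blk_def b)
    have "whole 1 j w"
    proof (cases "E 0")
      case True
      then show ?thesis unfolding whole_def using assms(2) wd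
        by (intro exI[of _ "xl # replicate j yl"]) (auto simp: count_replicate_yl xl_def[symmetric] yl_def[symmetric])
    next
      case False
      then have "inverse_word (wrd E J 0 n) = replicate j yl @ [xl]" using wd inv by (simp add: xl_def)
      then show ?thesis unfolding whole_def using ci
        by (intro exI[of _ "replicate j yl @ [xl]"]) (auto simp: count_replicate_yl)
    qed
    then show ?thesis ..
  next
    case False
    then have "Suc 0 < n" using n by simp
    then obtain r where wd: "wrd E J 0 n = (Gen_a, E 0) # replicate j (Gen_b, \<not> E 0) @ (Gen_a, E 0) # r"
      by (simp add: wrd_Cons blk_def b assms(4))
    let ?z = "xl # replicate j yl @ [xl]"
    have z: "set ?z \<subseteq> {xl, yl}" "count_list ?z xl = 2" "count_list ?z yl = j"
      by (auto simp: count_replicate_yl)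
    have "occ 2 j w"
    proof (cases "E 0")
      case True
      then have "wrd E J 0 n = ?z @ r" using wd by (simp add: xl_def yl_def)
      then show ?thesis unfolding occ_def using z assms(2) cr by metis
    next
      case False
      then have "inverse_word (wrd E J 0 n) = inverse_word r @ ?z" using wd inv by (simp add: xl_def)
      then have ri: "cyc_reduced (inverse_word r @ ?z)" "conj_F2 (inverse_word r @ ?z) (inverse_word w)"
        using cyc_reduced_inverse[OF cr] ci by simp_all
      have "cyc_reduced (?z @ inverse_word r)" using ri(1) cyc_reduced_swap by blast
      moreover have "conj_F2 (?z @ inverse_word r) (inverse_word w)"
        using conj_F2_trans[OF conj_F2_swap[OF ri(1)] ri(2)] reduced_inverse assms(3) by blast
      ultimately show ?thesis unfolding occ_def using z by blast
    qed
    then show ?thesis ..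
  qed
qed

lemma block_negative:
  assumes "periodic_form E J n" "conj_F2 (wrd E J 0 n) w" "reduced w" "i < n"
    "E i = E (Suc i)" "J i = (if E i then - int j else int j)" "0 < j"
  shows "occ 2 j w \<or> whole 1 j w"
proof -
  have "conj_F2 (wrd (\<lambda>t. E (t + i)) (\<lambda>t. J (t + i)) 0 n) w"
    using wrd_rotate(2)[OF assms(1,4)] assms(2,3) conj_F2_trans by blast
  from first_block_negative[OF wrd_rotate(1)[OF assms(1,4)] this assms(3)] show ?thesis
    using assms(5-7) by simp
qed

lemma aba_block:
  assumes "reduced w" "aba w \<noteq> 0"
  shows "occ 2 1 w \<or> whole 1 1 w"
  using assms(1)
proof (cases w rule: conj_periodic_form_cases)
  case (blocks E J n)
  have "\<exists>i<n. E i = E (Suc i) \<and> J i = - (if E i then 1 else - 1)"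
  proof (rule ccontr)
    assume "\<not> ?thesis"
    then have "aba w = 0" unfolding stats_wrd(4)[OF blocks assms(1)] by (intro sum.neutral) auto
    then show False using assms(2) by simp
  qed
  then obtain i where "i < n" "E i = E (Suc i)" "J i = - (if E i then 1 else - 1)" by blast
  then show ?thesis using block_negative[OF blocks assms(1), of i 1] by (auto split: if_splits)
next
  case (bpow j)
  then show ?thesis using stats_bpow(4)[OF bpow assms(1)] assms(2) by simp
qed

text \<open>Without negative blocks the increment under \<sigma> equals the number of blocks between
  equal signs, hence is nonnegative. If it is 0, every \<open>shift\<close> is 0 and \<sigma> fixes
  the cyclic word.\<close>

lemma no_negative_block:
  assumes w: "reduced w" and no: "\<And>j. 0 < j \<Longrightarrow> \<not> occ 2 j w \<and> \<not> whole 1 j w"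
  shows "2 * neg_turns w \<le> na w" "2 * neg_turns w = na w \<Longrightarrow> conj_F2 (sg w) w"
proof -
  have "2 * neg_turns w \<le> na w \<and> (2 * neg_turns w = na w \<longrightarrow> conj_F2 (sg w) w)"
    using w
  proof (cases w rule: conj_periodic_form_cases)
    case (blocks E J n)
    note form = stats_wrd[OF blocks w]
    define t :: "nat \<Rightarrow> int" where "t i = of_bool (E i)" for i
    have valid: "J i = 0 \<Longrightarrow> E (Suc i) = E i" for i using blocks(1) by (auto simp: periodic_form_def)
    have per: "E n = E 0" using blocks(1) by (metis add_0 periodic_form_def)
    have nonneg: "0 \<le> (if E i then J i else - J i)" if "i < n" "E i = E (Suc i)" for i
    proof (rule ccontr)
      assume "\<not> ?thesis"
      then have "J i = (if E i then - int (nat \<bar>J i\<bar>) else int (nat \<bar>J i\<bar>))" "0 < nat \<bar>J i\<bar>"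
        by (auto split: if_splits)
      then show False using block_negative[OF blocks w that] no by blast
    qed
    have "1 - 2 * (of_bool (E i \<and> J i < 0) + of_bool (0 < J i \<and> \<not> E (Suc i))) =
        of_bool (E i = E (Suc i)) + (t (Suc i) - t i)" if "i < n" for i
      using valid[of i] nonneg[OF that]
      by (cases "J i" "0 :: int" rule: linorder_cases; cases "E i"; cases "E (Suc i)") (auto simp: t_def)
    then have "(\<Sum>i<n. 1 - 2 * (of_bool (E i \<and> J i < 0) + of_bool (0 < J i \<and> \<not> E (Suc i)))) =
        (\<Sum>i<n. of_bool (E i = E (Suc i)) + (t (Suc i) - t i))"
      by (intro sum.cong) auto
    moreover have "na w - 2 * neg_turns w =
        (\<Sum>i<n. 1 - 2 * (of_bool (E i \<and> J i < 0) + of_bool (0 < J i \<and> \<not> E (Suc i))))"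
      unfolding form by (simp only: sum_subtractf sum_distrib_left sum_constant) simp
    ultimately have "na w - 2 * neg_turns w = (\<Sum>i<n. of_bool (E i = E (Suc i)) + (t (Suc i) - t i))"
      by simp
    also have "\<dots> = (\<Sum>i<n. of_bool (E i = E (Suc i)))"
      using sum_shift_periodic[of t n] per by (simp add: sum.distrib sum_subtractf t_def)
    finally have A: "na w - 2 * neg_turns w = (\<Sum>i<n. of_bool (E i = E (Suc i)))" .
    have "conj_F2 (sg w) w" if "2 * neg_turns w = na w"
    proof -
      have "E i \<noteq> E (Suc i)" if "i < n" for i
        using A \<open>2 * neg_turns w = na w\<close> that by (auto simp: sum_nonneg_eq_0_iff)
      then have "wrd E (\<lambda>i. J i + shift E i) 0 n = wrd E J 0 n"
        unfolding wrd_def by (intro arg_cong[of _ _ concat] map_cong) (auto simp: shift_def)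
      then have "conj_F2 (sg (wrd E J 0 n)) w"
        using conj_sg_wrd[OF blocks(1)] conj_F2_trans blocks(2) w by metis
      then show ?thesis
        using hom_conj[OF hom_shear(1) blocks(2) w] conj_F2_common w reduced_shear(1) conj_F2_sym by blast
    qed
    moreover have "0 \<le> na w - 2 * neg_turns w" unfolding A by (simp add: sum_nonneg)
    ultimately show ?thesis by simp
  next
    case (bpow j)
    have "conj_F2 (bpow j) (sg w)"
      using hom_conj[OF hom_shear(1) bpow(1) w] sg_bpow[of j "[]"] bpow(2)
      by (simp add: mul_Nil2 cyc_reduced_def)
    then have "conj_F2 (sg w) w" using bpow(1) conj_F2_common w reduced_shear(1) by blast
    then show ?thesis using stats_bpow[OF bpow w] by simp
  qed
  then show "2 * neg_turns w \<le> na w" "2 * neg_turns w = na w \<Longrightarrow> conj_F2 (sg w) w" by blast+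
qed

section \<open>How long a factor can survive along a chain\<close>

definition run :: "bool list \<Rightarrow> word \<Rightarrow> word"
  where "run ss w = fold (\<lambda>s. if s then sg else ta) ss w"

lemma run_Nil [simp]: "run [] w = w"
  by (simp add: run_def)

lemma run_append: "run (ss @ ts) w = run ts (run ss w)"
  by (simp add: run_def)

lemma run_snoc [simp]: "run (ss @ [True]) w = sg (run ss w)" "run (ss @ [False]) w = ta (run ss w)"
  by (simp_all add: run_def)

lemma run_Cons: "run (s # ss) w = run ss (if s then sg w else ta w)"
  by (simp add: run_def)

lemma reduced_run: "reduced w \<Longrightarrow> reduced (run ss w)"
proof (induction ss rule: rev_induct)
  case (snoc s ss)
  then show ?case by (cases s) auto
qed simp

lemma conj_run: "conj_F2 v w \<Longrightarrow> reduced w \<Longrightarrow> conj_F2 (run ss v) (run ss w)"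
proof (induction ss rule: rev_induct)
  case (snoc s ss)
  then have "conj_F2 (run ss v) (run ss w)" by blast
  from hom_conj[OF _ this reduced_run[OF snoc.prems(2)]] show ?case
    using hom_shear by (cases s) simp_all
qed simp

lemma map_swap_run: "map swap_gen (run ss w) = run (map Not ss) (map swap_gen w)"
proof (induction ss rule: rev_induct)
  case (snoc s ss)
  then show ?case by (cases s) (simp_all add: map_swap_sg map_swap_ta)
qed simp

lemma occ_ta:
  assumes "occ m k (ta w)" "0 < k" "reduced w"
  shows "occ (m + k - 1) k w"
proof -
  have "occ k m (sg (map swap_gen w))"
    using occ_swap[OF assms(1) reduced_shear(3)] by (simp add: map_swap_ta)
  then have "occ k (k + m - 1) (map swap_gen w)" using occ_sg assms by (simp add: reduced_map)
  then show ?thesis using occ_swap[of k "k + m - 1" "map swap_gen w"] assms(3)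
    by (simp add: reduced_map add.commute del: map_map)
qed

lemma whole_ta:
  assumes "whole m k (ta w)" "reduced w"
  shows "whole (m + k) k w"
proof -
  have "whole k m (sg (map swap_gen w))"
    using whole_swap[OF assms(1) reduced_shear(3)] by (simp add: map_swap_ta)
  then have "whole k (k + m) (map swap_gen w)" using whole_sg assms by (simp add: reduced_map)
  then show ?thesis using whole_swap[of k "k + m" "map swap_gen w"] assms(2)
    by (simp add: reduced_map add.commute del: map_map)
qed

text \<open>A factor of the infinite periodic word may wrap around once: \<open>x y\<^sup>j\<close> as a whole cyclic word
  contains \<open>x y\<^sup>j x\<close>.\<close>

definition factor :: "nat \<Rightarrow> nat \<Rightarrow> word \<Rightarrow> bool"
  where "factor m k w \<longleftrightarrow> occ m k w \<or> (\<exists>c d. whole c d w \<and> m \<le> c + 1 \<and> k \<le> d)"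

lemma factor_sg: "factor m k (sg w) \<Longrightarrow> 0 < m \<Longrightarrow> reduced w \<Longrightarrow> factor m (m + k - 1) w"
  unfolding factor_def using occ_sg whole_sg by fastforce

lemma factor_ta: "factor m k (ta w) \<Longrightarrow> 0 < k \<Longrightarrow> reduced w \<Longrightarrow> factor (m + k - 1) k w"
  unfolding factor_def using occ_ta whole_ta by fastforce

lemma factor_le_cyc_len: "factor m k w \<Longrightarrow> reduced w \<Longrightarrow> m + k \<le> cyc_len w + 1"
  unfolding factor_def using occ_le_cyc_len whole_cyc_len by fastforce

text \<open>With at least two letters of each kind, every step back gains \<open>m - 1\<close> or
  \<open>k - 1\<close> letters, hence at least one, and both counts stay at least 2. The factor
  cannot outgrow the initial word, apart from the wrap-around letter.\<close>

lemma factor_run: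
  assumes "factor m k (run ss w)" "2 \<le> m" "2 \<le> k" "reduced w"
  shows "length ss + m + k \<le> cyc_len w + 1"
  using assms
proof (induction ss arbitrary: m k rule: rev_induct)
  case Nil
  then show ?case using factor_le_cyc_len by simp
next
  case (snoc s ss)
  show ?case
  proof (cases s)
    case True
    then have "factor m (m + k - 1) (run ss w)"
      using snoc.prems factor_sg reduced_run by simp
    then have "length ss + m + (m + k - 1) \<le> cyc_len w + 1"
      by (rule snoc.IH) (use snoc.prems in auto)
    then show ?thesis using snoc.prems by simp
  next
    case False
    then have "factor (m + k - 1) k (run ss w)"
      using snoc.prems factor_ta reduced_run by simp
    then have "length ss + (m + k - 1) + k \<le> cyc_len w + 1"
      by (rule snoc.IH) (use snoc.prems in auto)
    then show ?thesis using snoc.prems by simp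
  qed
qed

text \<open>Undoing the last \<sigma> turns \<open>j\<close> letters \<open>y\<close> into
  \<open>j + 1\<close>, hence into at least two, which is the range of
  \<open>factor_run\<close>.\<close>

lemma factor_run_True:
  assumes "factor 2 j (run (ss @ [True]) w)" "0 < j" "reduced w"
  shows "length ss + 3 \<le> cyc_len w"
proof -
  have "factor 2 (j + 1) (run ss w)" using factor_sg[of 2 j "run ss w"] assms reduced_run by simp
  from factor_run[OF this] assms show ?thesis by simp
qed

text \<open>Undoing \<tau> gains nothing for \<open>x y x\<close>, because it has a single
  \<open>y\<close>: 2 + 1 - 1 = 2. Any number of final \<tau> is therefore possible, but the last
  \<sigma> before them must come early.\<close>

lemma factor_run_late:
  assumes "factor 2 1 (run ss w)" "reduced w"
  shows "True \<notin> set (drop (cyc_len w) ss)"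
  using assms
proof (induction ss rule: rev_induct)
  case (snoc s ss)
  show ?case
  proof (cases s)
    case True
    then show ?thesis using factor_run_True[of 1 ss w] snoc.prems by simp
  next
    case False
    then have "factor 2 1 (run ss w)" using factor_ta[of 2 1 "run ss w"] snoc.prems reduced_run by simp
    then show ?thesis using snoc False by (cases "cyc_len w \<le> length ss") auto
  qed
qed simp

lemma aba_run_late:
  assumes "aba (run ss w) \<noteq> 0" "reduced w"
  shows "True \<notin> set (drop (cyc_len w) ss)"
proof (rule factor_run_late)
  show "factor 2 1 (run ss w)"
    using aba_block[OF reduced_run assms(1)] assms(2) unfolding factor_def by fastforce
qed (rule assms)

text \<open>A late \<sigma> leaves no negative block, so the increment of another \<sigma> is
  nonnegative. If that increment is 0, \<sigma> fixes the word it has just produced, and cancelling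
  one \<sigma> shows that it fixed the word before.\<close>

lemma run_True_late:
  assumes w: "reduced w" and "cyc_len w \<le> Suc (length ss)"
  shows "2 * neg_turns (run (ss @ [True]) w) \<le> na (run (ss @ [True]) w)"
    "2 * neg_turns (run (ss @ [True]) w) = na (run (ss @ [True]) w) \<Longrightarrow> conj_F2 (sg (run ss w)) (run ss w)"
proof -
  have red: "reduced (run (ss @ [True]) w)" by simp
  have no: "\<not> occ 2 j (run (ss @ [True]) w) \<and> \<not> whole 1 j (run (ss @ [True]) w)" if "0 < j" for j
  proof -
    have "\<not> factor 2 j (run (ss @ [True]) w)" using factor_run_True[OF _ that w] assms(2) by fastforce
    then show ?thesis unfolding factor_def by fastforce
  qed
  show "2 * neg_turns (run (ss @ [True]) w) \<le> na (run (ss @ [True]) w)"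
    using no_negative_block[OF red no] by blast
  assume "2 * neg_turns (run (ss @ [True]) w) = na (run (ss @ [True]) w)"
  then have "conj_F2 (sg (sg (run ss w))) (sg (run ss w))"
    using no_negative_block[OF red no] by simp
  then have "conj_F2 (sgi (sg (sg (run ss w)))) (sgi (sg (run ss w)))"
    using hom_conj[OF hom_shear(2)] by simp
  then show "conj_F2 (sg (run ss w)) (run ss w)" using sgi_sg reduced_run w by simp
qed

section \<open>Growth along chains\<close>

text \<open>Below, \<open>L\<close> is the cyclic length along a chain starting from a fixed word, and \<open>p\<close>, \<open>q\<close> count the
  factors of the reached cyclic word that the next \<open>\<sigma>\<close> or \<open>\<tau>\<close> destroys; \<open>M\<close> bounds the length of the
  initial word.\<close>

locale growth =
  fixes L p q :: "bool list \<Rightarrow> int" and M :: nat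
  assumes L_pos: "0 < L ss"
    and A_True: "L (ss @ [True, True]) - L (ss @ [True]) = L (ss @ [True]) - L ss + 2 * p ss"
    and A_False: "L (ss @ [False, True]) - L (ss @ [False]) = L (ss @ [True]) - L ss + (L (ss @ [False, False]) - L (ss @ [False]))"
    and B_False: "L (ss @ [False, False]) - L (ss @ [False]) = L (ss @ [False]) - L ss + 2 * q ss"
    and B_True: "L (ss @ [True, False]) - L (ss @ [True]) = L (ss @ [False]) - L ss + (L (ss @ [True, True]) - L (ss @ [True]))"
    and p_nonneg: "0 \<le> p ss" and q_nonneg: "0 \<le> q ss"
    and p_False: "p (ss @ [False]) \<le> p ss" "q ss = 0 \<Longrightarrow> p (ss @ [False]) = p ss"
    and q_True: "q (ss @ [True]) \<le> q ss" "p ss = 0 \<Longrightarrow> q (ss @ [True]) = q ss"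
    and p_late: "p ss \<noteq> 0 \<Longrightarrow> True \<notin> set (drop M ss)"
    and q_late: "q ss \<noteq> 0 \<Longrightarrow> False \<notin> set (drop M ss)"
    and A_late: "M \<le> Suc (length ss) \<Longrightarrow> L (ss @ [True]) \<le> L (ss @ [True, True])"
    and B_late: "M \<le> Suc (length ss) \<Longrightarrow> L (ss @ [False]) \<le> L (ss @ [False, False])"
    and A_fix: "M \<le> Suc (length ss) \<Longrightarrow> L (ss @ [True, True]) = L (ss @ [True]) \<Longrightarrow>
      L (ss @ True # rs) = L (ss @ rs)"
    and B_fix: "M \<le> Suc (length ss) \<Longrightarrow> L (ss @ [False, False]) = L (ss @ [False]) \<Longrightarrow>
      L (ss @ False # rs) = L (ss @ rs)"
    and A_lower: "- int M \<le> L (ss @ [True]) - L ss"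
    and B_lower: "- int M \<le> L (ss @ [False]) - L ss"
begin

abbreviation A :: "bool list \<Rightarrow> int" where "A ss \<equiv> L (ss @ [True]) - L ss"
abbreviation B :: "bool list \<Rightarrow> int" where "B ss \<equiv> L (ss @ [False]) - L ss"

lemma A_snoc_True: "A (ss @ [True]) = A ss + 2 * p ss"
  and A_snoc_False: "A (ss @ [False]) = A ss + B (ss @ [False])"
  and B_snoc_False: "B (ss @ [False]) = B ss + 2 * q ss"
  and B_snoc_True: "B (ss @ [True]) = B ss + A (ss @ [True])"
  using A_True A_False B_False B_True by simp_all

lemma p_end_True: "M \<le> length ss \<Longrightarrow> p (ss @ [True]) = 0"
  using p_late[of "ss @ [True]"] by auto

lemma q_end_False: "M \<le> length ss \<Longrightarrow> q (ss @ [False]) = 0"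
  using q_late[of "ss @ [False]"] by auto

text \<open>Makes every later statement about \<sigma> available for \<tau> without returning to
  words.\<close>

lemma swapped: "growth (\<lambda>ss. L (map Not ss)) (\<lambda>ss. q (map Not ss)) (\<lambda>ss. p (map Not ss)) M"
proof
  have notin: "True \<notin> set (drop M (map Not ss)) \<longleftrightarrow> False \<notin> set (drop M ss)"
    "False \<notin> set (drop M (map Not ss)) \<longleftrightarrow> True \<notin> set (drop M ss)" for ss
    by (auto simp: drop_map image_iff; metis (full_types))+
  show "True \<notin> set (drop M ss)" if "q (map Not ss) \<noteq> 0" for ss
    using q_late[OF that] notin by simp
  show "False \<notin> set (drop M ss)" if "p (map Not ss) \<noteq> 0" for ss
    using p_late[OF that] notin by simp
next
  fix ss rs :: "bool list"
  let ?n = "map Not ss"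
  show "0 < L ?n" by (rule L_pos)
  show "0 \<le> q ?n" by (rule q_nonneg)
  show "0 \<le> p ?n" by (rule p_nonneg)
  show "L (map Not (ss @ [True, True])) - L (map Not (ss @ [True])) = L (map Not (ss @ [True])) - L ?n + 2 * q ?n"
    using B_False[of ?n] by simp
  show "L (map Not (ss @ [False, True])) - L (map Not (ss @ [False])) =
      L (map Not (ss @ [True])) - L ?n + (L (map Not (ss @ [False, False])) - L (map Not (ss @ [False])))"
    using B_True[of ?n] by simp
  show "L (map Not (ss @ [False, False])) - L (map Not (ss @ [False])) = L (map Not (ss @ [False])) - L ?n + 2 * p ?n"
    using A_True[of ?n] by simp
  show "L (map Not (ss @ [True, False])) - L (map Not (ss @ [True])) =
      L (map Not (ss @ [False])) - L ?n + (L (map Not (ss @ [True, True])) - L (map Not (ss @ [True])))"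
    using A_False[of ?n] by simp
  show "q (map Not (ss @ [False])) \<le> q ?n" using q_True(1)[of ?n] by simp
  show "q (map Not (ss @ [False])) = q ?n" if "p ?n = 0" using q_True(2)[OF that] by simp
  show "p (map Not (ss @ [True])) \<le> p ?n" using p_False(1)[of ?n] by simp
  show "p (map Not (ss @ [True])) = p ?n" if "q ?n = 0" using p_False(2)[OF that] by simp
  show "L (map Not (ss @ [True])) \<le> L (map Not (ss @ [True, True]))" if "M \<le> Suc (length ss)"
    using B_late[of ?n] that by simp
  show "L (map Not (ss @ [False])) \<le> L (map Not (ss @ [False, False]))" if "M \<le> Suc (length ss)"
    using A_late[of ?n] that by simp
  show "L (map Not (ss @ True # rs)) = L (map Not (ss @ rs))"
    if "M \<le> Suc (length ss)" "L (map Not (ss @ [True, True])) = L (map Not (ss @ [True]))"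
    using B_fix[of ?n "map Not rs"] that by simp
  show "L (map Not (ss @ False # rs)) = L (map Not (ss @ rs))"
    if "M \<le> Suc (length ss)" "L (map Not (ss @ [False, False])) = L (map Not (ss @ [False]))"
    using A_fix[of ?n "map Not rs"] that by simp
  show "- int M \<le> L (map Not (ss @ [True])) - L ?n" using B_lower[of ?n] by simp
  show "- int M \<le> L (map Not (ss @ [False])) - L ?n" using A_lower[of ?n] by simp
qed

text \<open>The recursion that feeds the mediant inequality: both summands are increments at shorter
  chains. It requires that \<tau> keeps \<open>p\<close>. If \<open>q ss\<close> is not 0, the late
  letters of \<open>ss\<close> are all \<sigma>, and after a late \<sigma> already
  \<open>p ss = 0\<close>.\<close>

lemma A_False_True:
  assumes "M < length ss"
  shows "A (ss @ [False] @ [True]) = A (ss @ [True]) + B (ss @ [False])"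
proof -
  have "p (ss @ [False]) = p ss"
  proof (cases "q ss = 0")
    case False
    obtain ss' s where ss: "ss = ss' @ [s]" using assms by (cases ss rule: rev_cases) auto
    then have "M \<le> length ss'" using assms by simp
    then have "s" using q_late[OF False] by (cases s) (auto simp: ss)
    then have "p ss = 0" using p_end_True[OF \<open>M \<le> length ss'\<close>] ss by simp
    then show ?thesis using p_False(1)[of ss] p_nonneg[of "ss @ [False]"] by simp
  qed (rule p_False(2))
  then show ?thesis
    using A_snoc_True[of "ss @ [False]"] A_snoc_False[of ss] A_snoc_True[of ss] by simp
qed

text \<open>Used to translate the hypotheses on powers \<open>k\<close> and \<open>k + 1\<close>
  into statements about the second \<sigma>: after a late \<sigma> no factor is left for the next
  one to destroy, so the increment stays constant.\<close>

lemma A_replicate_True: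
  "M \<le> length ss \<Longrightarrow> A (ss @ replicate (Suc n) True) = A (ss @ [True])"
proof (induction n)
  case (Suc n)
  have "p (ss @ replicate (Suc n) True) = 0"
    using p_end_True[of "ss @ replicate n True"] Suc by (simp add: replicate_append_same)
  then show ?case
    using Suc A_snoc_True[of "ss @ replicate (Suc n) True"] by (simp add: replicate_append_same)
qed simp

text \<open>If no factor \<open>a b^-1 a\<close> is left, the recursion writes the increment as a
  nonnegative number plus a positive one. Otherwise \<open>ss\<close> ends in at least
  \<open>M + 4\<close> steps \<tau>, on which B is a positive constant; A starts no lower than
  \<open>- M\<close> and gains that constant at each step.\<close>

lemma A_positive:
  assumes len: "2 * M + 4 \<le> length ss" and B: "0 < B (ss @ [False])"
  shows "0 < A (ss @ [False])"
proof (cases "p (ss @ [False]) = 0")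
  case True
  then have "A (ss @ [False]) = A (ss @ [False] @ [True])"
    using A_snoc_True[of "ss @ [False]"] by simp
  also have "\<dots> = A (ss @ [True]) + B (ss @ [False])" using A_False_True len by simp
  finally show ?thesis using A_late[of ss] B len by simp
next
  case False
  define s0 where "s0 = take M ss"
  define n where "n = length ss - M"
  have s0: "length s0 = M" using len by (simp add: s0_def)
  have "True \<notin> set (drop M ss)" using p_late[OF False] len by auto
  then have "drop M ss = replicate n False"
    unfolding n_def by (intro replicate_eqI) (auto simp: le_less)
  then have ss: "ss = s0 @ replicate n False" by (metis append_take_drop_id s0_def)
  define b where "b = B (s0 @ [False])"
  have Bb: "B (s0 @ replicate (Suc i) False) = b" for i
  proof (induction i)
    case (Suc i)
    have "q (s0 @ replicate (Suc i) False) = 0"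
      using q_end_False[of "s0 @ replicate i False"] s0 by (simp add: replicate_append_same)
    then show ?case
      using Suc B_snoc_False[of "s0 @ replicate (Suc i) False"] by (simp add: replicate_append_same)
  qed (simp add: b_def)
  have Ai: "A (s0 @ replicate i False) = A s0 + int i * b" for i
  proof (induction i)
    case (Suc i)
    then show ?case
      using A_snoc_False[of "s0 @ replicate i False"] Bb[of i]
      by (simp add: replicate_append_same algebra_simps)
  qed simp
  have "0 < b" using B Bb[of n] ss by (simp add: replicate_append_same)
  then have "int (Suc n) * 1 \<le> int (Suc n) * b" by (intro mult_left_mono) auto
  moreover have "int M < int (Suc n)" using len by (simp add: n_def)
  ultimately have "int M < int (Suc n) * b" by (metis mult.right_neutral order.strict_trans2)
  then have "0 < A s0 + int (Suc n) * b" using A_lower[of s0] by linarith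
  then have "0 < A (s0 @ replicate (Suc n) False)" by (simp only: Ai)
  then show ?thesis using ss by (simp add: replicate_append_same)
qed

end

section \<open>Comparing the growth of two words along the same chains\<close>

definition ratio_within :: "real \<Rightarrow> real \<Rightarrow> int \<Rightarrow> int \<Rightarrow> bool"
  where "ratio_within lo hi x y \<longleftrightarrow> lo * y \<le> x \<and> x \<le> hi * y"

text \<open>The mediant inequality, which drives the induction on the length of the chain.\<close>

lemma ratio_within_add:
  "ratio_within lo hi x y \<Longrightarrow> ratio_within lo hi x' y' \<Longrightarrow> ratio_within lo hi (x + x') (y + y')"
  by (simp add: ratio_within_def algebra_simps)

text \<open>Removes the cutoff at 1 that \<open>incr\<close> imposes; both increments must be
  positive or both 0.\<close>

lemma ratio_within_max1:
  "ratio_within lo hi (max 1 x) (max 1 y) \<Longrightarrow> 0 < x \<and> 0 < y \<or> x = 0 \<and> y = 0 \<Longrightarrow> ratio_within lo hi x y"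
  by (auto simp: ratio_within_def max_def split: if_splits)

definition ratios_within :: "real \<Rightarrow> real \<Rightarrow> (bool list \<Rightarrow> int) \<Rightarrow> (bool list \<Rightarrow> int) \<Rightarrow> bool list \<Rightarrow> bool"
  where "ratios_within lo hi L L' ss \<longleftrightarrow> ratio_within lo hi (L ss) (L' ss) \<and>
    (\<forall>s. ratio_within lo hi (max 1 (L (ss @ [s]) - L ss)) (max 1 (L' (ss @ [s]) - L' ss)))"

locale growth_pair = g: growth L p q M + g': growth L' p' q' M
  for L p q L' p' q' :: "bool list \<Rightarrow> int" and M :: nat +
  fixes lo hi :: real
  assumes zero_True: "length ss = Suc M \<Longrightarrow>
      L (ss @ [True, True]) = L (ss @ [True]) \<longleftrightarrow> L' (ss @ [True, True]) = L' (ss @ [True])"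
    and zero_False: "length ss = Suc M \<Longrightarrow>
      L (ss @ [False, False]) = L (ss @ [False]) \<longleftrightarrow> L' (ss @ [False, False]) = L' (ss @ [False])"
    and initial: "length ss \<le> 2 * M + 5 \<Longrightarrow> ratios_within lo hi L L' ss"
begin

lemma ratios_within_Not:
  "ratios_within lo hi (\<lambda>ss. L (map Not ss)) (\<lambda>ss. L' (map Not ss)) ss \<longleftrightarrow> ratios_within lo hi L L' (map Not ss)"
proof -
  have "(\<forall>s. P (\<not> s)) \<longleftrightarrow> (\<forall>s. P s)" for P :: "bool \<Rightarrow> bool"
  proof
    assume all: "\<forall>s. P (\<not> s)"
    show "\<forall>s. P s"
    proof
      fix s
      from spec[OF all, of "\<not> s"] show "P s" by (simp only: not_not)
    qed
  next
    assume all: "\<forall>s. P s"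
    show "\<forall>s. P (\<not> s)"
    proof
      fix s
      from spec[OF all, of "\<not> s"] show "P (\<not> s)" .
    qed
  qed
  from this[of "\<lambda>s. ratio_within lo hi (max 1 (L (map Not ss @ [s]) - L (map Not ss)))
      (max 1 (L' (map Not ss @ [s]) - L' (map Not ss)))"]
  show ?thesis by (simp add: ratios_within_def)
qed

lemma swapped_pair:
  "growth_pair (\<lambda>ss. L (map Not ss)) (\<lambda>ss. q (map Not ss)) (\<lambda>ss. p (map Not ss))
    (\<lambda>ss. L' (map Not ss)) (\<lambda>ss. q' (map Not ss)) (\<lambda>ss. p' (map Not ss)) M lo hi"
proof (intro growth_pair.intro g.swapped g'.swapped growth_pair_axioms.intro)
  show "ratios_within lo hi (\<lambda>ss. L (map Not ss)) (\<lambda>ss. L' (map Not ss)) ss"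
    if "length ss \<le> 2 * M + 5" for ss
    unfolding ratios_within_Not by (rule initial) (use that in simp)
next
  fix ss :: "bool list" assume len: "length ss = Suc M"
  show "(L (map Not (ss @ [True, True])) = L (map Not (ss @ [True]))) =
      (L' (map Not (ss @ [True, True])) = L' (map Not (ss @ [True])))"
    using zero_False[of "map Not ss"] len by simp
  show "(L (map Not (ss @ [False, False])) = L (map Not (ss @ [False]))) =
      (L' (map Not (ss @ [False, False])) = L' (map Not (ss @ [False])))"
    using zero_True[of "map Not ss"] len by simp
qed

text \<open>Late increments are nonnegative, so a sum of two of them vanishes only if both do. The
  recursion thus carries the equivalence from length \<open>M + 1\<close> to all longer
  chains.\<close>

lemma zeros:
  assumes "M < length ss"
  shows "(g.A (ss @ [True]) = 0 \<longleftrightarrow> g'.A (ss @ [True]) = 0) \<and> (g.B (ss @ [False]) = 0 \<longleftrightarrow> g'.B (ss @ [False]) = 0)"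
  using assms
proof (induction ss rule: rev_induct)
  case (snoc s ss)
  show ?case
  proof (cases "length ss = M")
    case True
    then show ?thesis using zero_True[of "ss @ [s]"] zero_False[of "ss @ [s]"] by simp
  next
    case False
    then have len: "M < length ss" using snoc.prems by simp
    note IH = snoc.IH[OF len]
    have late: "0 \<le> g.A (ss @ [True])" "0 \<le> g'.A (ss @ [True])" "0 \<le> g.B (ss @ [False])" "0 \<le> g'.B (ss @ [False])"
      using g.A_late[of ss] g'.A_late[of ss] g.B_late[of ss] g'.B_late[of ss] len by simp_all
    show ?thesis
    proof (cases s)
      case True
      have "g.B (ss @ [True] @ [False]) = g.B (ss @ [False]) + g.A (ss @ [True])"
        "g'.B (ss @ [True] @ [False]) = g'.B (ss @ [False]) + g'.A (ss @ [True])"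
        using growth.A_False_True[OF g.swapped, of "map Not ss"] growth.A_False_True[OF g'.swapped, of "map Not ss"] len
        by (simp_all add: comp_def)
      moreover have "g.A (ss @ [True] @ [True]) = g.A (ss @ [True])" "g'.A (ss @ [True] @ [True]) = g'.A (ss @ [True])"
        using g.A_snoc_True[of "ss @ [True]"] g'.A_snoc_True[of "ss @ [True]"] g.p_end_True g'.p_end_True len by simp_all
      ultimately show ?thesis using True IH late by simp linarith
    next
      case False
      have "g.A (ss @ [False] @ [True]) = g.A (ss @ [True]) + g.B (ss @ [False])"
        "g'.A (ss @ [False] @ [True]) = g'.A (ss @ [True]) + g'.B (ss @ [False])"
        using g.A_False_True g'.A_False_True len by simp_all
      moreover have "g.B (ss @ [False] @ [False]) = g.B (ss @ [False])" "g'.B (ss @ [False] @ [False]) = g'.B (ss @ [False])"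
        using g.B_snoc_False[of "ss @ [False]"] g'.B_snoc_False[of "ss @ [False]"] g.q_end_False g'.q_end_False len by simp_all
      ultimately show ?thesis using False IH late by simp linarith
    qed
  qed
qed simp

lemma ratios_within_snocI:
  assumes "ratio_within lo hi (L ss) (L' ss)" "ratio_within lo hi (g.A ss) (g'.A ss)" "ratio_within lo hi (g.B ss) (g'.B ss)"
    "0 < g.A ss" "0 < g'.A ss" "0 < g.B ss" "0 < g'.B ss"
  shows "ratios_within lo hi L L' ss"
proof -
  have "ratio_within lo hi (max 1 (L (ss @ [s]) - L ss)) (max 1 (L' (ss @ [s]) - L' ss))" for s
    using assms by (cases s) (simp_all add: max_def)
  then show ?thesis using assms(1) by (simp add: ratios_within_def)
qed

lemma ratios_within_snoc_True:
  assumes IH: "\<And>rs. length rs \<le> length ss \<Longrightarrow> ratios_within lo hi L L' rs" and len: "2 * M + 5 \<le> length ss"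
  shows "ratios_within lo hi L L' (ss @ [True])"
proof -
  have lenM: "M < length ss" using len by simp
  note zero = zeros[OF lenM]
  have late: "0 \<le> g.A (ss @ [True])" "0 \<le> g'.A (ss @ [True])"
    using g.A_late[of ss] g'.A_late[of ss] lenM by simp_all
  show ?thesis
  proof (cases "g.A (ss @ [True]) = 0")
    case True
    \<comment> \<open>By \<open>zeros\<close> the increment vanishes for both words, so \<sigma> can
      be deleted from the chain for both at once.\<close>
    then have z: "L (ss @ [True, True]) = L (ss @ [True])" "L' (ss @ [True, True]) = L' (ss @ [True])"
      using zero by simp_all
    have "L (ss @ True # rs) = L (ss @ rs)" "L' (ss @ True # rs) = L' (ss @ rs)" for rs
      using g.A_fix[OF _ z(1)] g'.A_fix[OF _ z(2)] lenM by simp_all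
    from this[of "[]"] this[of "[_]"] have "ratios_within lo hi L L' (ss @ [True]) = ratios_within lo hi L L' ss"
      by (simp add: ratios_within_def)
    then show ?thesis using IH[of ss] by simp
  next
    case False
    then have pos: "0 < g.A (ss @ [True])" "0 < g'.A (ss @ [True])" using late zero by linarith+
    obtain rs s where ss: "ss = rs @ [s]" using len by (cases ss rule: rev_cases) auto
    have lenr: "2 * M + 4 \<le> length rs" "M < length rs" "M \<le> length rs" using len ss by simp_all
    note zr = zeros[OF lenr(2)]
    have IHss: "ratio_within lo hi (L ss) (L' ss)" "ratio_within lo hi (max 1 (g.A ss)) (max 1 (g'.A ss))"
      "ratio_within lo hi (max 1 (g.B ss)) (max 1 (g'.B ss))"
      using IH[of ss] unfolding ratios_within_def by auto
    have lr: "0 \<le> g.A (rs @ [True])" "0 \<le> g'.A (rs @ [True])" "0 \<le> g.B (rs @ [False])" "0 \<le> g'.B (rs @ [False])"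
      using g.A_late[of rs] g'.A_late[of rs] g.B_late[of rs] g'.B_late[of rs] lenr by simp_all
    have snoc: "L (ss @ [True]) = L ss + g.A ss" "L' (ss @ [True]) = L' ss + g'.A ss"
      "g.B (ss @ [True]) = g.B ss + g.A (ss @ [True])" "g'.B (ss @ [True]) = g'.B ss + g'.A (ss @ [True])"
      using g.B_snoc_True[of ss] g'.B_snoc_True[of ss] by simp_all
    show ?thesis
    proof (cases s)
      case True
      have A: "g.A (ss @ [True]) = g.A ss" "g'.A (ss @ [True]) = g'.A ss"
        using g.A_snoc_True[of ss] g'.A_snoc_True[of ss] g.p_end_True[OF lenr(3)] g'.p_end_True[OF lenr(3)]
        by (simp_all add: ss True)
      \<comment> \<open>The swapped \<open>A_positive\<close> is applied to \<open>rs\<close>, which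
        is one letter shorter than \<open>ss\<close>; its bound \<open>2 * M + 4\<close> is the
        reason for requiring \<open>2 * M + 5\<close> here.\<close>
      have Bpos: "0 < g.B ss" "0 < g'.B ss"
        using growth.A_positive[OF g.swapped, of "map Not rs"] growth.A_positive[OF g'.swapped, of "map Not rs"]
          lenr pos A ss True by (simp_all add: comp_def)
      have r: "ratio_within lo hi (g.A ss) (g'.A ss)" "ratio_within lo hi (g.B ss) (g'.B ss)"
        using ratio_within_max1[OF IHss(2)] ratio_within_max1[OF IHss(3)] Bpos pos A by simp_all
      have rL: "ratio_within lo hi (L (ss @ [True])) (L' (ss @ [True]))"
        using ratio_within_add[OF IHss(1) r(1)] by simp
      have rA: "ratio_within lo hi (g.A (ss @ [True])) (g'.A (ss @ [True]))"
        by (simp only: A r(1))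
      have rB: "ratio_within lo hi (g.B (ss @ [True])) (g'.B (ss @ [True]))"
        using ratio_within_add[OF r(2) rA] by (simp only: snoc(3,4))
      show ?thesis
        by (intro ratios_within_snocI rL rA rB) (use pos Bpos snoc in linarith)+
    next
      case s: False
      show ?thesis
      proof (cases "g.B (rs @ [False]) = 0")
        case True
        \<comment> \<open>The \<tau> at the end of \<open>ss\<close> has no effect for either word
          and is deleted from the middle of the chain, which leaves a chain covered by the induction
          hypothesis.\<close>
        then have z: "L (rs @ [False, False]) = L (rs @ [False])" "L' (rs @ [False, False]) = L' (rs @ [False])"
          using zr by simp_all
        have "L (rs @ False # ts) = L (rs @ ts)" "L' (rs @ False # ts) = L' (rs @ ts)" for ts
          using g.B_fix[OF _ z(1)] g'.B_fix[OF _ z(2)] lenr by simp_all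
        then have "ratios_within lo hi L L' (ss @ [True]) = ratios_within lo hi L L' (rs @ [True])"
          by (simp add: ratios_within_def ss s)
        then show ?thesis using IH[of "rs @ [True]"] ss by simp
      next
        case False
        then have Bpos: "0 < g.B ss" "0 < g'.B ss" using lr zr ss s by auto
        then have Apos: "0 < g.A ss" "0 < g'.A ss"
          using g.A_positive[OF lenr(1)] g'.A_positive[OF lenr(1)] ss s by simp_all
        have A: "g.A (ss @ [True]) = g.A (rs @ [True]) + g.B ss" "g'.A (ss @ [True]) = g'.A (rs @ [True]) + g'.B ss"
          using g.A_False_True[OF lenr(2)] g'.A_False_True[OF lenr(2)] by (simp_all add: ss s)
        \<comment> \<open>\<open>rs @ [True]\<close> is not a prefix of the present chain, but it is
          as long as \<open>ss\<close>; this is why the induction hypothesis ranges over all chains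
          up to that length.\<close>
        have "ratio_within lo hi (max 1 (g.A (rs @ [True]))) (max 1 (g'.A (rs @ [True])))"
          using IH[of "rs @ [True]"] ss unfolding ratios_within_def by auto
        then have r: "ratio_within lo hi (g.A (rs @ [True])) (g'.A (rs @ [True]))"
          by (rule ratio_within_max1) (use lr zr in linarith)
        have r2: "ratio_within lo hi (g.A ss) (g'.A ss)" "ratio_within lo hi (g.B ss) (g'.B ss)"
          using ratio_within_max1[OF IHss(2)] ratio_within_max1[OF IHss(3)] Apos Bpos by simp_all
        have r3: "ratio_within lo hi (g.A (ss @ [True])) (g'.A (ss @ [True]))"
          unfolding A using r r2(2) by (rule ratio_within_add)
        have rL: "ratio_within lo hi (L (ss @ [True])) (L' (ss @ [True]))"
          using ratio_within_add[OF IHss(1) r2(1)] by simp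
        have rB: "ratio_within lo hi (g.B (ss @ [True])) (g'.B (ss @ [True]))"
          using ratio_within_add[OF r2(2) r3] by (simp only: snoc(3,4))
        show ?thesis
          by (intro ratios_within_snocI rL r3 rB) (use pos Bpos snoc in linarith)+
      qed
    qed
  qed
qed

lemma ratios_within_all: "ratios_within lo hi L L' ss"
proof (induction "length ss" arbitrary: ss rule: less_induct)
  case less
  show ?case
  proof (cases "length ss \<le> 2 * M + 5")
    case False
    then obtain rs s where ss: "ss = rs @ [s]" by (cases ss rule: rev_cases) auto
    have len: "2 * M + 5 \<le> length rs" using False ss by simp
    show ?thesis
    proof (cases s)
      case True
      then show ?thesis using ratios_within_snoc_True[OF _ len] less ss by simp
    next
      case False
      have "ratios_within lo hi (\<lambda>ss. L (map Not ss)) (\<lambda>ss. L' (map Not ss)) (map Not rs @ [True])"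
        by (rule growth_pair.ratios_within_snoc_True[OF swapped_pair])
          (use less ss len ratios_within_Not in auto)
      then show ?thesis unfolding ratios_within_Not using ss False by (simp add: comp_def)
    qed
  qed (rule initial)
qed

end

section \<open>Nielsen reduction\<close>

lemma ex_cancellation:
  assumes "reduced u" "reduced v"
  shows "\<exists>u1 p v1. u = u1 @ inverse_word p \<and> v = p @ v1 \<and> reduced (u1 @ v1)"
  using assms
proof (induction u arbitrary: v rule: rev_induct)
  case Nil
  then show ?case by (intro exI[of _ "[]"] exI[of _ v]) simp
next
  case (snoc x u)
  show ?case
  proof (cases "v \<noteq> [] \<and> hd v = inv_letter x")
    case True
    then obtain v' where v: "v = inv_letter x # v'" by (cases v) auto
    have "reduced u" "reduced v'" using snoc.prems v by (auto simp: reduced_append dest: reduced_ConsD)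
    from snoc.IH[OF this] obtain u1 p v1 where "u = u1 @ inverse_word p" "v' = p @ v1" "reduced (u1 @ v1)"
      by blast
    then show ?thesis
      by (intro exI[of _ u1] exI[of _ "inv_letter x # p"] exI[of _ v1]) (simp add: v)
  next
    case False
    then show ?thesis
      using snoc.prems by (rule_tac exI[of _ "u @ [x]"], rule_tac exI[of _ "[]"], rule_tac exI[of _ v])
        (auto simp: reduced_append reduced_Cons)
  qed
qed

lemma mul_cancellation: "reduced (u1 @ v1) \<Longrightarrow> reduced (p @ v1) \<Longrightarrow> (u1 @ inverse_word p) \<cdot> (p @ v1) = u1 @ v1"
proof -
  assume r: "reduced (u1 @ v1)" "reduced (p @ v1)"
  then have p: "reduced p" "reduced v1" by (auto simp: reduced_append)
  have "inverse_word p \<cdot> (p @ v1) = inverse_word p \<cdot> (p \<cdot> v1)" using r by (simp add: foldr_push_append)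
  also have "\<dots> = v1" using p by (rule inverse_mul_cancel)
  finally show ?thesis using r by (simp add: foldr_push_append)
qed

lemma self_inverse_word: "reduced q \<Longrightarrow> inverse_word q = q \<Longrightarrow> q = []"
proof (induction "length q" arbitrary: q rule: less_induct)
  case less
  show ?case
  proof (rule ccontr)
    assume "q \<noteq> []"
    then obtain x q' where q: "q = x # q'" by (cases q) auto
    show False
    proof (cases q' rule: rev_cases)
      case Nil
      then show False using less.prems q by simp
    next
      case (snoc m y)
      then have "y = inv_letter x" "inverse_word m = m" using less.prems(2) q by auto
      moreover have "reduced m" using less.prems(1) q snoc by (auto simp: reduced_append dest: reduced_ConsD)
      ultimately have "m = []" using less.hyps[of m] q snoc by simp
      then show False using less.prems(1) q snoc \<open>y = inv_letter x\<close> by (simp add: reduced_Cons)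
    qed
  qed
qed

lemma reduced_mul_self_inverse: "reduced (p @ inverse_word p) \<Longrightarrow> p = []"
  by (cases p rule: rev_cases) (auto simp: reduced_append reduced_Cons)

text \<open>If half of \<open>u\<close> or more cancelled in \<open>u u\<close>, its middle part
  would equal its own inverse and hence be empty, and \<open>u\<close> would be a word followed by
  its inverse.\<close>

lemma square_cancellation:
  assumes "u = u1 @ inverse_word p" "u = p @ v1" "reduced u" "u \<noteq> []"
  shows "length p < length u1"
proof (rule ccontr)
  assume "\<not> ?thesis"
  then obtain p' where p': "p = u1 @ p'"
    using assms(1,2) by (metis append_eq_append_conv_if append_take_drop_id not_less take_all_iff append_eq_conv_conj)
  then have "inverse_word p' @ inverse_word u1 = p' @ v1" using assms(1,2) by simp
  then have "inverse_word p' = p'" by (metis append_eq_append_conv length_map length_rev)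
  moreover have "reduced p'" using assms(2,3) p' by (simp add: reduced_append)
  ultimately have "p' = []" using self_inverse_word by blast
  then show False using assms p' reduced_mul_self_inverse by auto
qed

definition is_aut :: "(word \<Rightarrow> word) \<Rightarrow> bool"
  where "is_aut \<phi> \<longleftrightarrow> \<phi> \<in> hom F2 F2 \<and> bij_betw \<phi> {w. reduced w} {w. reduced w}"

lemma is_autD:
  assumes "is_aut \<phi>"
  shows "\<phi> \<in> hom F2 F2" "reduced w \<Longrightarrow> reduced (\<phi> w)" "\<phi> [] = []"
    "reduced w \<Longrightarrow> \<phi> w = [] \<Longrightarrow> w = []" "reduced w \<Longrightarrow> \<exists>t. reduced t \<and> \<phi> t = w"
proof -
  show h: "\<phi> \<in> hom F2 F2" using assms by (simp add: is_aut_def)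
  show "reduced w \<Longrightarrow> reduced (\<phi> w)" for w using hom_reduced h by blast
  interpret group_hom F2 F2 \<phi> by unfold_locales (rule h)
  show one: "\<phi> [] = []" using hom_one by simp
  have "inj_on \<phi> {w. reduced w}" using assms by (simp add: is_aut_def bij_betw_def)
  then show "reduced w \<Longrightarrow> \<phi> w = [] \<Longrightarrow> w = []" for w using one by (auto simp: inj_on_def)
  have "\<phi> ` {w. reduced w} = {w. reduced w}" using assms by (simp add: is_aut_def bij_betw_def)
  then show "reduced w \<Longrightarrow> \<exists>t. reduced t \<and> \<phi> t = w" for w by (metis (mono_tags) imageE mem_Collect_eq)
qed

text \<open>Both factors lose the same number of letters, so the total loss is halved;
  \<open>canc_split\<close> shows that the division is exact.\<close>

definition canc :: "(word \<Rightarrow> word) \<Rightarrow> letter \<Rightarrow> letter \<Rightarrow> nat"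
  where "canc \<phi> l m = (length (\<phi> [l]) + length (\<phi> [m]) - length (\<phi> [l] \<cdot> \<phi> [m])) div 2"

lemma canc_split:
  assumes "is_aut \<phi>"
  obtains u1 p v1 where "\<phi> [l] = u1 @ inverse_word p" "\<phi> [m] = p @ v1" "reduced (u1 @ v1)"
    "\<phi> [l] \<cdot> \<phi> [m] = u1 @ v1" "length p = canc \<phi> l m"
proof -
  have r: "reduced (\<phi> [l])" "reduced (\<phi> [m])" using is_autD(2)[OF assms] by simp_all
  obtain u1 p v1 where s: "\<phi> [l] = u1 @ inverse_word p" "\<phi> [m] = p @ v1" "reduced (u1 @ v1)"
    using ex_cancellation[OF r] by blast
  have "\<phi> [l] \<cdot> \<phi> [m] = u1 @ v1" using mul_cancellation s r by metis
  moreover from this have "length p = canc \<phi> l m" by (simp add: canc_def s)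
  ultimately show thesis using that s by blast
qed

text \<open>The image of every inner letter keeps at least one letter after cancellation on both
  sides. The induction records which part of the first image survives, so a further letter on the
  left cannot cancel past it.\<close>

lemma length_ge_if_reduced:
  assumes \<phi>: "is_aut \<phi>"
    and N: "\<And>l m n. m \<noteq> inv_letter l \<Longrightarrow> n \<noteq> inv_letter m \<Longrightarrow> canc \<phi> l m + canc \<phi> m n < length (\<phi> [m])"
    and "reduced (l # t)"
  shows "length (l # t) \<le> length (\<phi> (l # t))"
proof -
  have "\<exists>rest. \<phi> (l # t) = take (length (\<phi> [l]) - (if t = [] then 0 else canc \<phi> l (hd t))) (\<phi> [l]) @ rest
      \<and> length t \<le> length rest" if "reduced (l # t)" for l t
    using that
  proof (induction t arbitrary: l)
    case (Cons m t)
    have red: "reduced (m # t)" "m \<noteq> inv_letter l" using Cons.prems by (auto simp: reduced_Cons)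
    define k where "k = (if t = [] then 0 else canc \<phi> m (hd t))"
    obtain rest where rest: "\<phi> (m # t) = take (length (\<phi> [m]) - k) (\<phi> [m]) @ rest" "length t \<le> length rest"
      using Cons.IH[OF red(1)] unfolding k_def by blast
    obtain u1 p v1 where s: "\<phi> [l] = u1 @ inverse_word p" "\<phi> [m] = p @ v1" "reduced (u1 @ v1)" "length p = canc \<phi> l m"
      using canc_split[OF \<phi>] by metis
    have "canc \<phi> l m + k < length (\<phi> [m])"
      using N[of m l "hd t"] N[of m l m] red by (auto simp: k_def reduced_Cons)
    then obtain v2 where v2: "v2 = take (length v1 - k) v1" "v2 \<noteq> []" "length (\<phi> [m]) - k = length p + (length v1 - k)"
      using s by fastforce
    have tk: "take (length p + j) (p @ v1) = p @ take j v1" for j by simp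
    have "take (length (\<phi> [m]) - k) (\<phi> [m]) = p @ v2"
      unfolding v2(3) unfolding s(2) v2(1) by (rule tk)
    then have m: "\<phi> (m # t) = p @ v2 @ rest" using rest(1) by simp
    have rm: "reduced (p @ v2 @ rest)" using is_autD(2)[OF \<phi> red(1)] m by simp
    have "v1 = v2 @ drop (length v1 - k) v1" by (simp add: v2)
    then have "reduced (u1 @ v2)" using s(3) by (metis append_assoc reduced_append)
    then have r: "reduced (u1 @ v2 @ rest)" using rm v2(2) by (simp add: reduced_append)
    have "\<phi> (l # m # t) = \<phi> ([l] \<cdot> (m # t))" using red(2) by simp
    also have "\<dots> = \<phi> [l] \<cdot> \<phi> (m # t)" using hom_mul is_autD(1)[OF \<phi>] red by simp
    also have "\<dots> = u1 @ v2 @ rest" using mul_cancellation[OF r rm] s(1) m by simp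
    finally have "\<phi> (l # m # t) = u1 @ v2 @ rest" .
    moreover have "length (m # t) \<le> length (v2 @ rest)" using rest(2) v2(2) by (cases v2) auto
    ultimately show ?case using s by simp
  qed simp
  then obtain rest where rest: "\<phi> (l # t) = take (length (\<phi> [l]) - (if t = [] then 0 else canc \<phi> l (hd t))) (\<phi> [l]) @ rest"
    "length t \<le> length rest" using assms(3) by blast
  have "(if t = [] then 0 else canc \<phi> l (hd t)) < length (\<phi> [l])"
    using N[of l l "hd t"] N[of l l l] assms(3) by (auto simp: reduced_Cons)
  then show ?thesis using rest by simp
qed

text \<open>The second hypothesis says that no elementary Nielsen move, followed by a conjugation, shortens the
  basis \<open>\<phi> a\<close>, \<open>\<phi> b\<close>. Conjugation is needed to exclude that \<open>\<phi> m\<close> cancels completely, one half on each side.\<close>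

lemma minimal_reduced:
  assumes \<phi>: "is_aut \<phi>"
    and min: "\<And>l m g. fst l \<noteq> fst m \<Longrightarrow> reduced g \<Longrightarrow>
      length (\<phi> [l]) + length (\<phi> [m]) \<le>
        length (g \<cdot> ((\<phi> [l] \<cdot> \<phi> [m]) \<cdot> inverse_word g)) + length (g \<cdot> (\<phi> [m] \<cdot> inverse_word g))"
    and lm: "m \<noteq> inv_letter l" and mn: "n \<noteq> inv_letter m"
  shows "canc \<phi> l m + canc \<phi> m n < length (\<phi> [m])"
proof -
  have red: "reduced (\<phi> [l])" for l using is_autD(2)[OF \<phi>] by simp
  have ne: "\<phi> [l] \<noteq> []" for l using is_autD(4)[OF \<phi>, of "[l]"] by auto
  have inv: "\<phi> [inv_letter l] = inverse_word (\<phi> [l])" for l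
    using hom_inverse[OF is_autD(1)[OF \<phi>], of "[l]"] by simp
  have sq: "2 * canc \<phi> l l < length (\<phi> [l])" for l
  proof -
    obtain u1 p v1 where s: "\<phi> [l] = u1 @ inverse_word p" "\<phi> [l] = p @ v1" "length p = canc \<phi> l l"
      using canc_split[OF \<phi>] by metis
    from square_cancellation[OF s(1,2) red ne] s(1,3) show ?thesis by simp
  qed
  have half: "2 * canc \<phi> l m \<le> length (\<phi> [m])" "2 * canc \<phi> l m \<le> length (\<phi> [l])" if "fst l \<noteq> fst m" for l m
  proof -
    obtain u1 p v1 where s: "\<phi> [l] = u1 @ inverse_word p" "\<phi> [m] = p @ v1" "\<phi> [l] \<cdot> \<phi> [m] = u1 @ v1" "length p = canc \<phi> l m"
      using canc_split[OF \<phi>] by metis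
    have "length (\<phi> [l]) \<le> length (\<phi> [l] \<cdot> \<phi> [m])"
      using min[OF that, of "[]"] red by (simp add: mul_Nil2 reduced_foldr_push)
    then show "2 * canc \<phi> l m \<le> length (\<phi> [m])" using s by simp
    have "length (\<phi> [inv_letter m] \<cdot> \<phi> [inv_letter l]) = length (\<phi> [l] \<cdot> \<phi> [m])"
      using inverse_word_mul[OF red red, of l m] by (metis inv length_map length_rev)
    moreover have "length (\<phi> [inv_letter m]) \<le> length (\<phi> [inv_letter m] \<cdot> \<phi> [inv_letter l])"
      using min[of "inv_letter m" "inv_letter l" "[]"] that red
      by (simp add: mul_Nil2 reduced_foldr_push inv_letter_def)
    ultimately show "2 * canc \<phi> l m \<le> length (\<phi> [l])" using s by (simp add: inv)
  qed
  have same: "l = m" if "fst l = fst m" "m \<noteq> inv_letter l" for l m :: letter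
    using that by (cases l; cases m) (auto simp: inv_letter_def)
  show ?thesis
  proof (cases "fst l = fst m \<or> fst m = fst n")
    case True
    then consider "l = m" "m = n" | "l = m" "fst m \<noteq> fst n" | "fst l \<noteq> fst m" "m = n"
      using same lm mn by metis
    then show ?thesis
    proof cases
      case 1
      then show ?thesis using sq[of m] by simp
    next
      case 2
      then show ?thesis using sq[of m] half(2)[of m n] by simp
    next
      case 3
      then show ?thesis using sq[of m] half(1)[of l m] by simp
    qed
  next
    case False
    then have fl: "fst l \<noteq> fst m" and fn: "fst m \<noteq> fst n" by auto
    show ?thesis
    proof (rule ccontr)
      assume "\<not> ?thesis"
      then have h: "2 * canc \<phi> l m = length (\<phi> [m])" "2 * canc \<phi> m n = length (\<phi> [m])"
        using half(1)[OF fl] half(2)[OF fn] by linarith+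
      obtain u1 p v1 where s: "\<phi> [l] = u1 @ inverse_word p" "\<phi> [m] = p @ v1" "\<phi> [l] \<cdot> \<phi> [m] = u1 @ v1" "length p = canc \<phi> l m"
        using canc_split[OF \<phi>] by metis
      obtain m1 q n1 where t: "\<phi> [m] = m1 @ inverse_word q" "\<phi> [n] = q @ n1" "length q = canc \<phi> m n"
        using canc_split[OF \<phi>] by metis
      have "length p = length m1" using h s(4) t(1,3) by simp
      then have v1: "v1 = inverse_word q" "m1 = p" using s(2) t(1) by auto
      have lpq: "length p = length q" using h s(4) t(3) by simp
      \<comment> \<open>There are only two generators, so \<open>l\<close> and \<open>n\<close> both
        belong to the one that \<open>m\<close> does not belong to.\<close>
      have "fst n = fst l" using fl fn by (cases "fst l"; cases "fst m"; cases "fst n") auto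
      then have "n = l \<or> n = inv_letter l" using same[of n l] by (metis inv_letter_simps(1))
      then show False
      proof
        assume "n = inv_letter l"
        then have "p @ inverse_word u1 = q @ n1" using s(1) t(2) inv by simp
        then have "p = q" using lpq by (simp add: append_eq_append_conv)
        then have "\<phi> [m] = p @ inverse_word p" using s(2) v1 by simp
        then show False using reduced_mul_self_inverse red[of m] ne[of m] by (metis append_Nil list.map(1) rev.simps(1))
      next
        \<comment> \<open>Here \<phi> maps \<open>l\<close> to \<open>q z p^-1\<close> and
          \<open>m\<close> to \<open>p q^-1\<close>. The Nielsen move gives \<open>q z q^-1\<close>,
          and conjugation by \<open>q^-1\<close> turns the new basis into \<open>z\<close> and
          \<open>q^-1 p\<close>, shorter by at least the length of the image of \<open>m\<close>.
          Without the conjugation the total length need not drop.\<close>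
        assume "n = l"
        then have "u1 @ inverse_word p = q @ n1" using s(1) t(2) by simp
        moreover have "length q \<le> length u1" using half(2)[OF fl] s(1,4) lpq by simp
        ultimately obtain z where z: "u1 = q @ z" by (metis append_eq_append_conv_if append_take_drop_id)
        have rq: "reduced q" "reduced z" "reduced p"
          using red[of l] red[of m] s(1,2) z by (auto simp: reduced_append)
        have prod: "\<phi> [l] \<cdot> \<phi> [m] = q @ z @ inverse_word q" using s(3) z v1 by simp
        have "reduced (q @ z @ inverse_word q)" using reduced_foldr_push[OF red[of m], of "\<phi> [l]"] prod by simp
        then have rz: "reduced (q @ z @ inverse_word q)" "reduced (z @ inverse_word q)" by (auto simp: reduced_append)
        have q1: "q @ z @ inverse_word q = q \<cdot> (z \<cdot> inverse_word q)" using rz by (simp add: foldr_push_append)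
        have i: "reduced (inverse_word q)" using rq(1) reduced_inverse by blast
        have canc2: "(w \<cdot> inverse_word q) \<cdot> q = w" if "reduced w" for w
          using that rq(1) foldr_push_inverse[OF rq(1)] by (simp add: foldr_push_assoc mul_Nil2)
        have "inverse_word q \<cdot> ((\<phi> [l] \<cdot> \<phi> [m]) \<cdot> q) = (inverse_word q \<cdot> (q \<cdot> (z \<cdot> inverse_word q))) \<cdot> q"
          unfolding prod q1 by (simp add: foldr_push_assoc rq(1))
        also have "\<dots> = z"
          using inverse_mul_cancel[OF rq(1) reduced_foldr_push[OF i, of z]] canc2[OF rq(2)] by simp
        finally have 1: "inverse_word q \<cdot> ((\<phi> [l] \<cdot> \<phi> [m]) \<cdot> q) = z" .
        have "\<phi> [m] = p \<cdot> inverse_word q" using s(2) v1 red[of m] by (simp add: foldr_push_append)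
        then have 2: "inverse_word q \<cdot> (\<phi> [m] \<cdot> q) = inverse_word q \<cdot> p" using canc2[OF rq(3)] by simp
        have "length (inverse_word q \<cdot> p) \<le> length q + length p"
          using length_mult[of "inverse_word q" p] by simp
        moreover have "length (\<phi> [l]) = length q + length z + length p" using s(1) z by simp
        moreover have "length (\<phi> [l]) + length (\<phi> [m]) \<le> length z + length (inverse_word q \<cdot> p)"
          using min[OF fl i] 1 2 by simp
        moreover have "0 < length (\<phi> [m])" using ne[of m] by simp
        ultimately show False by linarith
      qed
    qed
  qed
qed

lemma hom_compose_apply: "f \<in> hom F2 F2 \<Longrightarrow> h \<in> hom F2 F2 \<Longrightarrow> (\<lambda>w. f (h w)) \<in> hom F2 F2"
  using hom_compose[of h F2 F2 f F2] by (simp add: comp_def)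

lemma hom_conj_by:
  assumes "h \<in> hom F2 F2" "reduced g"
  shows "(\<lambda>w. g \<cdot> (h w \<cdot> inverse_word g)) \<in> hom F2 F2"
proof -
  have i: "reduced (inverse_word g)" using assms(2) reduced_inverse by blast
  have "g \<cdot> (h (u \<cdot> v) \<cdot> inverse_word g) = (g \<cdot> (h u \<cdot> inverse_word g)) \<cdot> (g \<cdot> (h v \<cdot> inverse_word g))"
    if "reduced u" "reduced v" for u v
  proof -
    have r: "reduced (h u)" "reduced (h v)" using that hom_reduced assms(1) by auto
    have rv: "reduced (h v \<cdot> inverse_word g)" using i reduced_foldr_push by blast
    have "(g \<cdot> (h u \<cdot> inverse_word g)) \<cdot> (g \<cdot> (h v \<cdot> inverse_word g)) =
        g \<cdot> (h u \<cdot> (inverse_word g \<cdot> (g \<cdot> (h v \<cdot> inverse_word g))))"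
      using rv assms(2) by (simp add: foldr_push_assoc reduced_foldr_push i)
    also have "\<dots> = g \<cdot> (h u \<cdot> (h v \<cdot> inverse_word g))"
      using inverse_mul_cancel[OF assms(2) rv] by simp
    also have "\<dots> = g \<cdot> (h (u \<cdot> v) \<cdot> inverse_word g)"
      using hom_mul[OF assms(1) that] i by (simp add: foldr_push_assoc)
    finally show ?thesis by simp
  qed
  then show ?thesis using i by (auto simp: hom_def reduced_foldr_push)
qed

lemma hom_eq_gens:
  assumes "h \<in> hom F2 F2" "h' \<in> hom F2 F2"
    "h [(Gen_a, True)] = h' [(Gen_a, True)]" "h [(Gen_b, True)] = h' [(Gen_b, True)]" "reduced w"
  shows "h w = h' w"
  using F2.F2_hom_unique[OF assms(1,2)] assms(3-5) by (simp add: elt_a_def elt_b_def)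

lemma conj_by_gens:
  assumes h: "h \<in> hom F2 F2" and h': "h' \<in> hom F2 F2" and g: "reduced g"
    and "h [(Gen_a, True)] = g \<cdot> (h' [(Gen_a, True)] \<cdot> inverse_word g)"
    and "h [(Gen_b, True)] = g \<cdot> (h' [(Gen_b, True)] \<cdot> inverse_word g)"
    and w: "reduced w"
  shows "conj_F2 (h w) (h' w)"
proof -
  have "h w = g \<cdot> (h' w \<cdot> inverse_word g)"
    using hom_eq_gens[OF h hom_conj_by[OF h' g]] assms(4-6) by simp
  then show ?thesis using conj_F2I[OF g] hom_reduced[OF h' w] by metis
qed

section \<open>Signed permutations and shears up to conjugation\<close>

definition perm_of :: "letter \<Rightarrow> letter \<Rightarrow> letter \<Rightarrow> letter"
  where "perm_of l m x = (case x of (Gen_a, s) \<Rightarrow> if s then l else inv_letter l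
    | (Gen_b, s) \<Rightarrow> if s then m else inv_letter m)"

lemma perm_of_simps [simp]: "perm_of l m (Gen_a, s) = (if s then l else inv_letter l)"
  "perm_of l m (Gen_b, s) = (if s then m else inv_letter m)"
  by (simp_all add: perm_of_def)

lemma letter_perm_of: "fst l \<noteq> fst m \<Longrightarrow> letter_perm (perm_of l m)"
  unfolding letter_perm_def inj_def
  by (cases l; cases m; intro conjI allI impI)
    (auto simp: perm_of_def inv_letter_def split: prod.splits gen.splits if_splits)

lemma letter_perm_eq_perm_of:
  assumes "letter_perm p"
  shows "p = perm_of (p (Gen_a, True)) (p (Gen_b, True))" "fst (p (Gen_a, True)) \<noteq> fst (p (Gen_b, True))"
proof -
  have "p (g, False) = inv_letter (p (g, True))" for g
    using letter_perm_inv[OF assms, of "(g, True)"] by simp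
  then show "p = perm_of (p (Gen_a, True)) (p (Gen_b, True))"
    by (intro ext) (auto simp: perm_of_def split: prod.splits gen.splits)
  show "fst (p (Gen_a, True)) \<noteq> fst (p (Gen_b, True))"
  proof
    assume "fst (p (Gen_a, True)) = fst (p (Gen_b, True))"
    then have "p (Gen_a, True) = p (Gen_b, True) \<or> p (Gen_a, True) = p (Gen_b, False)"
      using \<open>\<And>g. p (g, False) = inv_letter (p (g, True))\<close>[of Gen_b]
      by (cases "p (Gen_a, True)"; cases "p (Gen_b, True)") auto
    then show False using assms by (auto simp: letter_perm_def inj_def)
  qed
qed

definition flip_b :: "letter \<Rightarrow> letter"
  where "flip_b = perm_of (Gen_a, True) (Gen_b, False)"

lemma letter_perm_flip_b [simp]: "letter_perm flip_b"
  unfolding flip_b_def by (rule letter_perm_of) simp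

lemma letter_perm_comp: "letter_perm p \<Longrightarrow> letter_perm q \<Longrightarrow> letter_perm (p \<circ> q)"
  by (simp add: letter_perm_def inj_compose del: split_paired_All)

lemma letter_perm_id [simp]: "letter_perm id"
  by (simp add: letter_perm_def)

lemma flip_b_simps [simp]: "flip_b (Gen_a, s) = (Gen_a, s)" "flip_b (Gen_b, s) = (Gen_b, \<not> s)"
  by (simp_all add: flip_b_def)

lemma flip_b_flip_b [simp]: "flip_b (flip_b l) = l"
  by (cases l rule: letter_cases) simp_all

lemma map_flip_b_flip_b [simp]: "map flip_b (map flip_b w) = w"
  by (simp add: comp_def)

lemma map_flip_sgi: "map flip_b (sgi w) = sg (map flip_b w)"
proof (induction w)
  case (Cons l w)
  then show ?case by (cases l rule: letter_cases) (simp_all add: sg_Cons sgi_Cons map_push)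
qed simp

lemma sg_sgi:
  assumes "reduced w"
  shows "sg (sgi w) = w"
  using sgi_sg[of "map flip_b w"] assms
  by (metis letter_perm_flip_b map_flip_b_flip_b map_flip_sgi reduced_map)

lemma map_flip_tai:
  assumes "reduced w"
  shows "conj_F2 (map flip_b (tai w)) (ta (map flip_b w))"
  by (rule conj_by_gens[OF hom_compose_apply[OF hom_map hom_shear(4)] hom_compose_apply[OF hom_shear(3) hom_map] _ _ _ assms,
        where g = "[(Gen_a, True)]"])
    (simp_all add: ta_Cons tai_Cons)

text \<open>A signed permutation carries the inverse of \<sigma> to one of the four shears, up to an
  inner automorphism. This is what allows all permutations to be collected on the outside.\<close>

lemma sgi_map_perm:
  assumes p: "letter_perm p"
  shows "\<exists>e \<in> {sg, sgi, ta, tai}. \<forall>w. reduced w \<longrightarrow> conj_F2 (sgi (map p w)) (map p (e w))"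
proof -
  define l m where "l = p (Gen_a, True)" and "m = p (Gen_b, True)"
  have pe: "p = perm_of l m" "fst l \<noteq> fst m" using letter_perm_eq_perm_of[OF p] by (auto simp: l_def m_def)
  have gens: "conj_F2 (sgi (map p w)) (map p (e w))"
    if "e \<in> {sg, sgi, ta, tai}" "reduced g"
      "sgi [l] = g \<cdot> (map (perm_of l m) (e [(Gen_a, True)]) \<cdot> inverse_word g)"
      "sgi [m] = g \<cdot> (map (perm_of l m) (e [(Gen_b, True)]) \<cdot> inverse_word g)" "reduced w" for e g w
  proof -
    have "e \<in> hom F2 F2" using that(1) hom_shear by auto
    from conj_by_gens[OF hom_compose_apply[OF hom_shear(2) hom_map[OF p]] hom_compose_apply[OF hom_map[OF p] this] that(2)]
    show ?thesis using that(3-5) by (simp add: pe(1))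
  qed
  have cases: "(\<exists>s t. l = (Gen_a, s) \<and> m = (Gen_b, t)) \<or> (\<exists>s t. l = (Gen_b, s) \<and> m = (Gen_a, t))"
    using pe(2) by (cases l rule: letter_cases; cases m rule: letter_cases) auto
  then consider s t where "l = (Gen_a, s)" "m = (Gen_b, t)" | s t where "l = (Gen_b, s)" "m = (Gen_a, t)" by blast
  then show ?thesis
  proof cases
    case 1
    have "conj_F2 (sgi (map p w)) (map p ((if s = t then sgi else sg) w))" if "reduced w" for w
      by (rule gens[where g = "if s then [] else [(Gen_b, True)]", OF _ _ _ _ that])
        (use 1 in \<open>cases s; cases t; simp add: sg_Cons sgi_Cons\<close>)+
    then show ?thesis by (intro bexI[of _ "if s = t then sgi else sg"]) auto
  next
    case 2
    have "conj_F2 (sgi (map p w)) (map p ((if s = t then tai else ta) w))" if "reduced w" for w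
      by (rule gens[where g = "if t then [] else [(Gen_b, True)]", OF _ _ _ _ that])
        (use 2 in \<open>cases s; cases t; simp add: sg_Cons sgi_Cons ta_Cons tai_Cons\<close>)+
    then show ?thesis by (intro bexI[of _ "if s = t then tai else ta"]) auto
  qed
qed

text \<open>The relation that removes mixed signs: an inverse shear meeting the other positive shear
  becomes a positive shear followed by a signed permutation of order 4.\<close>

lemma sgi_ta:
  assumes "reduced w"
  shows "conj_F2 (sgi (ta w)) (map (perm_of (Gen_b, False) (Gen_a, True)) (sg w))"
  by (rule conj_by_gens[OF hom_compose_apply[OF hom_shear(2,3)] hom_compose_apply[OF hom_map hom_shear(1)] _ _ _ assms,
        where g = "[(Gen_b, True)]"])
    (simp_all add: letter_perm_of sg_Cons sgi_Cons ta_Cons)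

lemma tai_sg:
  assumes "reduced w"
  shows "conj_F2 (tai (sg w)) (map (perm_of (Gen_b, True) (Gen_a, False)) (ta w))"
  by (rule conj_by_gens[OF hom_compose_apply[OF hom_shear(4,1)] hom_compose_apply[OF hom_map hom_shear(3)] _ _ _ assms,
        where g = "[(Gen_a, True)]"])
    (simp_all add: letter_perm_of sg_Cons ta_Cons tai_Cons)

lemma tai_ta:
  assumes "reduced w"
  shows "tai (ta w) = w"
  using sgi_sg[of "map swap_gen w"] assms
  by (metis letter_perm_swap map_swap_gen_invol map_swap_sgi map_swap_ta reduced_map)

text \<open>Chains of the second type are, up to conjugation, chains of the first type with \<open>b\<close> inverted.\<close>

definition decomp :: "(word \<Rightarrow> word) \<Rightarrow> bool"
  where "decomp \<phi> \<longleftrightarrow> (\<exists>p q ss. letter_perm p \<and> q \<in> {id, flip_b} \<and>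
    (\<forall>w. reduced w \<longrightarrow> conj_F2 (\<phi> w) (map p (run ss (map q w)))))"

lemma decompI:
  assumes "letter_perm p" "q \<in> {id, flip_b}" "\<And>w. reduced w \<Longrightarrow> conj_F2 (\<phi> w) (map p (run ss (map q w)))"
  shows "decomp \<phi>"
  unfolding decomp_def using assms by blast

text \<open>A further shear extends the chain, cancels its last letter, or meets the other kind and
  is traded for a permutation. On the empty chain a negative shear becomes positive by inverting
  \<open>b\<close> on both sides, which toggles \<open>q\<close>.\<close>

lemma decomp_run:
  assumes q: "q \<in> {id, flip_b}" and e: "e \<in> {sg, sgi, ta, tai}"
  shows "decomp (\<lambda>w. e (run ss (map q w)))"
proof -
  have qr: "reduced (map q w)" if "reduced w" for w using q that reduced_map by auto
  note rr = reduced_run[OF qr]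
  have app: "decomp (\<lambda>w. run ts (map q' w))" if "q' \<in> {id, flip_b}" for ts q'
    by (rule decompI[of id q' _ ts]) (use that in \<open>auto intro!: conj_F2_refl reduced_run simp: reduced_map\<close>)
  consider "e = sg" | "e = ta" | "e = sgi" | "e = tai" using e by blast
  then show ?thesis
  proof cases
    case 1
    then show ?thesis using app[OF q, of "ss @ [True]"] by simp
  next
    case 2
    then show ?thesis using app[OF q, of "ss @ [False]"] by simp
  next
    case 3
    show ?thesis
    proof (cases ss rule: rev_cases)
      case Nil
      define q' where "q' = (if q = id then flip_b else id)"
      show ?thesis
      proof (rule decompI[of flip_b q' _ "[True]"])
        fix w assume w: "reduced w"
        have qq: "map flip_b (map q w) = map q' w" using q by (auto simp: q'_def)
        have "map flip_b (sgi (map q w)) = sg (map q' w)"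
          using map_flip_sgi[of "map q w"] unfolding qq .
        then have "sgi (map q w) = map flip_b (sg (map q' w))"
          using map_flip_b_flip_b[of "sgi (map q w)"] by metis
        then show "conj_F2 (e (run ss (map q w))) (map flip_b (run [True] (map q' w)))"
          using 3 Nil by (simp add: run_def conj_F2_refl reduced_map)
      qed (simp_all add: q'_def)
    next
      case (snoc rs s)
      show ?thesis
      proof (cases s)
        case True
        have "conj_F2 (e (run ss (map q w))) (run rs (map q w))" if "reduced w" for w
          using 3 snoc True sgi_sg[OF rr[OF that]] by (simp add: conj_F2_refl rr that)
        then show ?thesis by (intro decompI[of id q _ rs] q) simp_all
      next
        case False
        have "conj_F2 (e (run ss (map q w))) (map (perm_of (Gen_b, False) (Gen_a, True)) (run (rs @ [True]) (map q w)))"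
          if "reduced w" for w
          using 3 snoc False sgi_ta[OF rr[OF that]] by simp
        moreover have "letter_perm (perm_of (Gen_b, False) (Gen_a, True))" by (rule letter_perm_of) simp
        ultimately show ?thesis by (intro decompI[of "perm_of (Gen_b, False) (Gen_a, True)" q _ "rs @ [True]"] q)
      qed
    qed
  next
    case 4
    show ?thesis
    proof (cases ss rule: rev_cases)
      case Nil
      define q' where "q' = (if q = id then flip_b else id)"
      show ?thesis
      proof (rule decompI[of flip_b q' _ "[False]"])
        fix w assume w: "reduced w"
        have qq: "map flip_b (map q w) = map q' w" using q by (auto simp: q'_def)
        have "conj_F2 (map flip_b (tai (map q w))) (ta (map q' w))"
          using map_flip_tai[OF qr[OF w]] unfolding qq .
        then have "conj_F2 (tai (map q w)) (map flip_b (ta (map q' w)))"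
          using conj_F2_map[OF letter_perm_flip_b] map_flip_b_flip_b[of "tai (map q w)"] reduced_shear(3) by metis
        then show "conj_F2 (e (run ss (map q w))) (map flip_b (run [False] (map q' w)))"
          using 4 Nil by (simp add: run_def)
      qed (simp_all add: q'_def)
    next
      case (snoc rs s)
      show ?thesis
      proof (cases s)
        case False
        have "conj_F2 (e (run ss (map q w))) (run rs (map q w))" if "reduced w" for w
          using 4 snoc False tai_ta[OF rr[OF that]] by (simp add: conj_F2_refl rr that)
        then show ?thesis by (intro decompI[of id q _ rs] q) simp_all
      next
        case True
        have "conj_F2 (e (run ss (map q w))) (map (perm_of (Gen_b, True) (Gen_a, False)) (run (rs @ [False]) (map q w)))"
          if "reduced w" for w
          using 4 snoc True tai_sg[OF rr[OF that]] by simp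
        moreover have "letter_perm (perm_of (Gen_b, True) (Gen_a, False))" by (rule letter_perm_of) simp
        ultimately show ?thesis by (intro decompI[of "perm_of (Gen_b, True) (Gen_a, False)" q _ "rs @ [False]"] q)
      qed
    qed
  qed
qed

lemma decomp_map:
  assumes "decomp \<psi>" "letter_perm p" "\<And>w. reduced w \<Longrightarrow> conj_F2 (\<phi> w) (map p (\<psi> w))"
  shows "decomp \<phi>"
proof -
  obtain p' q ss where d: "letter_perm p'" "q \<in> {id, flip_b}"
    "\<And>w. reduced w \<Longrightarrow> conj_F2 (\<psi> w) (map p' (run ss (map q w)))"
    using assms(1) unfolding decomp_def by blast
  have "conj_F2 (\<phi> w) (map (p \<circ> p') (run ss (map q w)))" if w: "reduced w" for w
  proof -
    have r: "reduced (map p' (run ss (map q w)))"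
      using d(1,2) w by (auto simp: reduced_map intro!: reduced_run)
    have "conj_F2 (map p (\<psi> w)) (map p (map p' (run ss (map q w))))"
      using conj_F2_map[OF assms(2) d(3)[OF w] r] .
    then have "conj_F2 (\<phi> w) (map p (map p' (run ss (map q w))))"
      using conj_F2_trans[OF assms(3)[OF w]] r assms(2) reduced_map by blast
    then show ?thesis by simp
  qed
  then show ?thesis by (intro decompI[OF letter_perm_comp[OF assms(2) d(1)] d(2)])
qed

lemma decomp_sgi:
  assumes "decomp \<psi>"
  shows "decomp (\<lambda>w. sgi (\<psi> w))"
proof -
  obtain p q ss where d: "letter_perm p" "q \<in> {id, flip_b}"
    "\<And>w. reduced w \<Longrightarrow> conj_F2 (\<psi> w) (map p (run ss (map q w)))"
    using assms(1) unfolding decomp_def by blast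
  obtain e where e: "e \<in> {sg, sgi, ta, tai}" "\<And>w. reduced w \<Longrightarrow> conj_F2 (sgi (map p w)) (map p (e w))"
    using sgi_map_perm[OF d(1)] by blast
  show ?thesis
  proof (rule decomp_map[OF decomp_run[OF d(2) e(1)] d(1)])
    fix w assume w: "reduced w"
    have r: "reduced (run ss (map q w))" using d(2) w by (auto simp: reduced_map intro!: reduced_run)
    have "conj_F2 (sgi (\<psi> w)) (sgi (map p (run ss (map q w))))"
      using hom_conj[OF hom_shear(2) d(3)[OF w]] r d(1) reduced_map by blast
    moreover have "reduced (map p (e (run ss (map q w))))" using e(1) d(1) by (auto simp: reduced_map)
    ultimately show "conj_F2 (sgi (\<psi> w)) (map p (e (run ss (map q w))))"
      using conj_F2_trans e(2)[OF r] by blast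
  qed
qed

section \<open>Every automorphism is a chain up to conjugation and permutation\<close>

lemma is_aut_compose: "is_aut f \<Longrightarrow> is_aut h \<Longrightarrow> is_aut (\<lambda>w. f (h w))"
  using bij_betw_trans[of h "{w. reduced w}" "{w. reduced w}" f "{w. reduced w}"]
  by (simp add: is_aut_def hom_compose_apply comp_def)

lemma is_aut_auto: "\<phi> \<in> auto F2 \<Longrightarrow> is_aut \<phi>"
  by (simp add: is_aut_def auto_def Bij_def)

lemma sigma_eq: "reduced w \<Longrightarrow> sigma w = sg w"
  by (simp add: sigma_def sg_def elt_a_def elt_b_def)

lemma tau_eq: "reduced w \<Longrightarrow> tau w = ta w"
  by (simp add: tau_def ta_def elt_a_def elt_b_def)

lemma is_aut_sg: "is_aut sg"
proof -
  have "bij_betw sg {w. reduced w} {w. reduced w} = bij_betw sigma {w. reduced w} {w. reduced w}"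
    by (intro bij_betw_cong) (simp add: sigma_eq)
  then show ?thesis using is_aut_auto[OF sigma_auto] hom_shear(1) by (simp add: is_aut_def)
qed

lemma perm_inverse:
  assumes "letter_perm p"
  obtains p' where "letter_perm p'" "\<And>w. map p (map p' w) = w" "\<And>w. map p' (map p w) = w"
proof -
  have inj: "inj p" using assms by (simp add: letter_perm_def)
  have "finite (UNIV :: letter set)"
  proof -
    have "(UNIV :: letter set) \<subseteq> {(Gen_a, True), (Gen_a, False), (Gen_b, True), (Gen_b, False)}"
      using letter_cases by blast
    then show ?thesis using finite_subset by blast
  qed
  then have surj: "surj p" using inj finite_UNIV_inj_surj by blast
  have 1: "p (inv_into UNIV p x) = x" "inv_into UNIV p (p x) = x" for x using surj inj by (simp_all add: surj_f_inv_f)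
  have "inv_into UNIV p (inv_letter x) = inv_letter (inv_into UNIV p x)" for x
    using letter_perm_inv[OF assms, of "inv_into UNIV p x"] 1 by metis
  then have "letter_perm (inv_into UNIV p)" using surj by (auto simp: letter_perm_def surj_imp_inj_inv)
  then show thesis using that 1 by (simp add: comp_def)
qed

lemma is_aut_map:
  assumes "letter_perm p"
  shows "is_aut (map p)"
proof -
  obtain p' where p': "letter_perm p'" "\<And>w. map p (map p' w) = w" "\<And>w. map p' (map p w) = w"
    using perm_inverse[OF assms] by blast
  have "bij_betw (map p) {w. reduced w} {w. reduced w}"
    by (rule bij_betw_byWitness[where f' = "map p'"])
      (use p' assms in \<open>auto simp: reduced_map simp del: map_map\<close>)
  then show ?thesis using hom_map[OF assms] by (simp add: is_aut_def)
qed

lemma is_aut_conj: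
  assumes "is_aut \<phi>" "reduced g"
  shows "is_aut (\<lambda>w. g \<cdot> (\<phi> w \<cdot> inverse_word g))"
proof -
  have i: "reduced (inverse_word g)" using assms(2) reduced_inverse by blast
  have cancel: "(x \<cdot> inverse_word g) \<cdot> g = x" "(x \<cdot> g) \<cdot> inverse_word g = x" if "reduced x" for x
    using that assms(2) i foldr_push_inverse[OF assms(2)] mul_inverse[OF assms(2)]
    by (simp_all add: foldr_push_assoc mul_Nil2)
  have "bij_betw (\<lambda>x. g \<cdot> (x \<cdot> inverse_word g)) {w. reduced w} {w. reduced w}"
  proof (rule bij_betw_byWitness[where f' = "\<lambda>x. inverse_word g \<cdot> (x \<cdot> g)"])
    show "\<forall>x\<in>{w. reduced w}. inverse_word g \<cdot> ((g \<cdot> (x \<cdot> inverse_word g)) \<cdot> g) = x"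
    proof (intro ballI)
      fix x assume "x \<in> {w. reduced w}"
      then have x: "reduced x" by simp
      have "inverse_word g \<cdot> ((g \<cdot> (x \<cdot> inverse_word g)) \<cdot> g) = inverse_word g \<cdot> (g \<cdot> ((x \<cdot> inverse_word g) \<cdot> g))"
        using foldr_push_assoc[OF assms(2)] by simp
      then show "inverse_word g \<cdot> ((g \<cdot> (x \<cdot> inverse_word g)) \<cdot> g) = x"
        using cancel(1)[OF x] inverse_mul_cancel[OF assms(2) x] by simp
    qed
    show "\<forall>x\<in>{w. reduced w}. g \<cdot> ((inverse_word g \<cdot> (x \<cdot> g)) \<cdot> inverse_word g) = x"
    proof (intro ballI)
      fix x assume "x \<in> {w. reduced w}"
      then have x: "reduced x" by simp
      have "g \<cdot> ((inverse_word g \<cdot> (x \<cdot> g)) \<cdot> inverse_word g) = g \<cdot> (inverse_word g \<cdot> ((x \<cdot> g) \<cdot> inverse_word g))"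
        using foldr_push_assoc[OF i] by simp
      then show "g \<cdot> ((inverse_word g \<cdot> (x \<cdot> g)) \<cdot> inverse_word g) = x"
        using cancel(2)[OF x] mul_inverse_cancel[OF assms(2) x] by simp
    qed
  qed (auto intro!: reduced_foldr_push i assms(2))
  then have "bij_betw (\<lambda>w. g \<cdot> (\<phi> w \<cdot> inverse_word g)) {w. reduced w} {w. reduced w}"
    using bij_betw_trans[of \<phi>] assms(1) by (auto simp: is_aut_def comp_def)
  then show ?thesis using hom_conj_by[OF is_autD(1)[OF assms(1)] assms(2)] by (simp add: is_aut_def)
qed

text \<open>The preimage of a letter is no longer than the letter itself, so every letter is the
  image of a letter.\<close>

lemma letter_image_perm:
  assumes \<phi>: "is_aut \<phi>" and len: "\<And>t. reduced t \<Longrightarrow> length t \<le> length (\<phi> t)"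
  shows "\<exists>p. letter_perm p \<and> (\<forall>w. reduced w \<longrightarrow> \<phi> w = map p w)"
proof -
  have pre: "\<exists>k. \<phi> [k] = [l]" for l
  proof -
    obtain t where t: "reduced t" "\<phi> t = [l]" using is_autD(5)[OF \<phi>, of "[l]"] by auto
    then have "length t \<le> 1" "t \<noteq> []" using len[of t] is_autD(3)[OF \<phi>] by auto
    then have "t = [hd t]" by (cases t) auto
    then show ?thesis using t(2) by metis
  qed
  then obtain f where f: "\<And>l. \<phi> [f l] = [l]" by metis
  have inv: "\<phi> [inv_letter l] = inverse_word (\<phi> [l])" for l
    using hom_inverse[OF is_autD(1)[OF \<phi>], of "[l]"] by simp
  have inj: "inj_on \<phi> {w. reduced w}" using \<phi> by (simp add: is_aut_def bij_betw_def)
  have "f (inv_letter l) = inv_letter (f l)" for l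
    using f[of "inv_letter l"] inv[of "f l"] f[of l] inj_onD[OF inj, of "[f (inv_letter l)]" "[inv_letter (f l)]"]
    by simp
  moreover have "inj f" by (rule injI) (metis f list.inject)
  ultimately have "letter_perm f" by (simp add: letter_perm_def)
  then obtain p where p: "letter_perm p" "\<And>w. map f (map p w) = w" using perm_inverse by metis
  have "\<phi> [l] = map p [l]" for l
    using f[of "p l"] p(2)[of "[l]"] by simp
  then have "\<phi> w = map p w" if "reduced w" for w
    using hom_eq_gens[OF is_autD(1)[OF \<phi>] hom_map[OF p(1)] _ _ that] by blast
  then show ?thesis using p(1) by blast
qed

text \<open>Nielsen moves change \<phi> by precomposition, and the compensating inverse has to go
  somewhere: it is handed to \<psi>. Hence the statement about a composition, with \<psi> arbitrary
  in the induction on the length of the basis.\<close>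

lemma decomp_compose:
  assumes "is_aut \<phi>" "decomp \<psi>"
  shows "decomp (\<lambda>w. \<phi> (\<psi> w))"
  using assms
proof (induction "length (\<phi> [(Gen_a, True)]) + length (\<phi> [(Gen_b, True)])" arbitrary: \<phi> \<psi> rule: less_induct)
  case less
  note \<phi> = less.prems(1)
  have red: "reduced (\<psi> w)" if "reduced w" for w
  proof -
    obtain p q ss where d: "letter_perm p" "q \<in> {id, flip_b}"
      "\<And>w. reduced w \<Longrightarrow> conj_F2 (\<psi> w) (map p (run ss (map q w)))"
      using less.prems(2) unfolding decomp_def by blast
    have "reduced (map p (run ss (map q w)))"
      using d(1,2) that by (auto simp: reduced_map intro!: reduced_run)
    then show ?thesis using conj_F2_reduced d(3)[OF that] by blast
  qed
  have len: "length (\<phi> [l]) = length (\<phi> [(fst l, True)])" for l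
  proof (cases "snd l")
    case False
    then have "l = inv_letter (fst l, True)" by (cases l) simp
    then show ?thesis
      using hom_inverse[OF is_autD(1)[OF \<phi>], of "[(fst l, True)]"] by (metis length_map length_rev list.map(1) list.map(2) reduced_single rev.simps(1) rev.simps(2) append_Nil)
  qed (cases l, simp)
  define nrm where "nrm = length (\<phi> [(Gen_a, True)]) + length (\<phi> [(Gen_b, True)])"
  have nrm: "length (\<phi> [l]) + length (\<phi> [m]) = nrm" if "fst l \<noteq> fst m" for l m
    using that len[of l] len[of m] unfolding nrm_def by (cases "fst l"; cases "fst m") simp_all
  show ?case
  proof (cases "\<forall>l m g. fst l \<noteq> fst m \<longrightarrow> reduced g \<longrightarrow>
      length (\<phi> [l]) + length (\<phi> [m]) \<le>
        length (g \<cdot> ((\<phi> [l] \<cdot> \<phi> [m]) \<cdot> inverse_word g)) + length (g \<cdot> (\<phi> [m] \<cdot> inverse_word g))")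
    case True
    have "length t \<le> length (\<phi> t)" if "reduced t" for t
    proof (cases t)
      case (Cons x t')
      then show ?thesis
        using length_ge_if_reduced[OF \<phi> minimal_reduced[OF \<phi>]] True that by blast
    qed simp
    then obtain p where "letter_perm p" "\<And>w. reduced w \<Longrightarrow> \<phi> w = map p w"
      using letter_image_perm[OF \<phi>] by blast
    then show ?thesis using decomp_map[OF less.prems(2)] red conj_F2_refl reduced_map by metis
  next
    case False
    then obtain l m g where lmg: "fst l \<noteq> fst m" "reduced g"
      "length (g \<cdot> ((\<phi> [l] \<cdot> \<phi> [m]) \<cdot> inverse_word g)) + length (g \<cdot> (\<phi> [m] \<cdot> inverse_word g)) < nrm"
      using nrm by (metis not_le)
    \<comment> \<open>With this permutation, precomposing \<phi> with \<open>map p\<close> after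
      \<open>sg\<close> gives the basis consisting of the product of the images of \<open>l\<close>
      and \<open>m\<close> and the image of \<open>m\<close>. So all moves are instances of one
      shear, and \<open>decomp_sgi\<close> suffices for its inverse.\<close>
    define p where "p = perm_of l m"
    have p: "letter_perm p" unfolding p_def by (rule letter_perm_of[OF lmg(1)])
    obtain p' where p': "letter_perm p'" "\<And>w. map p (map p' w) = w" using perm_inverse[OF p] by metis
    define \<phi>' where "\<phi>' = (\<lambda>w. g \<cdot> (\<phi> (map p (sg w)) \<cdot> inverse_word g))"
    have aut: "is_aut \<phi>'"
      unfolding \<phi>'_def
      by (intro is_aut_conj lmg(2) is_aut_compose[OF \<phi>] is_aut_compose[OF is_aut_map[OF p] is_aut_sg])
    have "l # [m] = [l] \<cdot> [m]" using lmg(1) by (cases l; cases m) auto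
    then have "\<phi> [l, m] = \<phi> [l] \<cdot> \<phi> [m]" using hom_mul[OF is_autD(1)[OF \<phi>], of "[l]" "[m]"] by simp
    then have "length (\<phi>' [(Gen_a, True)]) + length (\<phi>' [(Gen_b, True)]) < nrm"
      using lmg(3) by (simp add: \<phi>'_def sg_Cons p_def)
    then have D: "decomp (\<lambda>w. \<phi>' (sgi (map p' (\<psi> w))))"
      using less.hyps[OF _ aut decomp_sgi[OF decomp_map[OF less.prems(2) p'(1)]]] red
        conj_F2_refl p'(1) reduced_map unfolding nrm_def by metis
    show ?thesis
    proof (rule decomp_map[OF D letter_perm_id])
      fix w assume w: "reduced w"
      have r: "reduced (\<phi> (\<psi> w))" using is_autD(2)[OF \<phi> red[OF w]] .
      have "sg (sgi (map p' (\<psi> w))) = map p' (\<psi> w)"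
        using sg_sgi red[OF w] p'(1) reduced_map by blast
      then have "\<phi>' (sgi (map p' (\<psi> w))) = g \<cdot> (\<phi> (\<psi> w) \<cdot> inverse_word g)"
        by (simp add: \<phi>'_def p'(2) del: map_map)
      then have "conj_F2 (\<phi>' (sgi (map p' (\<psi> w)))) (\<phi> (\<psi> w))" using conj_F2I[OF lmg(2) r] by simp
      then show "conj_F2 (\<phi> (\<psi> w)) (map id (\<phi>' (sgi (map p' (\<psi> w)))))"
        using conj_F2_sym r by simp
    qed
  qed
qed

theorem aut_decomp:
  assumes "is_aut \<phi>"
  shows "decomp \<phi>"
proof -
  have "decomp (\<lambda>w. w)"
    by (rule decompI[of id id _ "[]"]) (simp_all add: conj_F2_refl)
  from decomp_compose[OF assms this] show ?thesis .
qed

section \<open>Bounded translation equivalence\<close>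

lemma cyc_len_pos:
  assumes "reduced w" "w \<noteq> []"
  shows "0 < cyc_len w"
proof (rule ccontr)
  assume "\<not> 0 < cyc_len w"
  moreover obtain c where c: "cyc_reduced c" "conj_F2 c w" using ex_cyc_reduced_conj assms by blast
  ultimately have "c = []" using cyc_len_eq[OF assms(1) c] by simp
  then have "conj_F2 w []" using c(2) conj_F2_sym assms(1) by blast
  then show False using assms(2) mul_inverse by (auto simp: conj_F2_iff)
qed

lemma cyc_len_sg: "reduced w \<Longrightarrow> int (cyc_len (sg w)) - int (cyc_len w) = na w - 2 * neg_turns w"
  using sg_stats(1,2)[of w] by (simp add: cyc_len_stats)

lemma cyc_len_ta: "reduced w \<Longrightarrow> int (cyc_len (ta w)) - int (cyc_len w) = nb w - 2 * neg_turns w"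
  using ta_stats(1,2)[of w] by (simp add: cyc_len_stats)

lemma run_neq_Nil:
  assumes "reduced w" "w \<noteq> []"
  shows "run ss w \<noteq> []"
  using assms
proof (induction ss rule: rev_induct)
  case (snoc s ss)
  have "sg v \<noteq> []" "ta v \<noteq> []" if "reduced v" "v \<noteq> []" for v
    using sgi_sg[OF that(1)] tai_ta[OF that(1)] that(2) by (metis shear_Nil)+
  then show ?case using snoc reduced_run by (cases s) simp_all
qed simp

lemma neg_turns_run_le: "reduced w \<Longrightarrow> neg_turns (run ss w) \<le> neg_turns w"
proof (induction ss rule: rev_induct)
  case (snoc s ss)
  have "neg_turns (sg v) \<le> neg_turns v" "neg_turns (ta v) \<le> neg_turns v" if "reduced v" for v
    using sg_stats(3,8)[OF that] ta_stats(3,6)[OF that] by simp_all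
  then have "neg_turns (run (ss @ [s]) w) \<le> neg_turns (run ss w)"
    using reduced_run[OF snoc.prems] by (cases s) simp_all
  then show ?case using snoc by simp
qed simp

lemma run_swap:
  assumes "reduced w"
  shows "cyc_len (run ss (map swap_gen w)) = cyc_len (run (map Not ss) w)"
    "aba (run ss (map swap_gen w)) = bab (run (map Not ss) w)"
proof -
  have "run ss (map swap_gen w) = map swap_gen (run (map Not ss) w)"
    using map_swap_run[of "map Not ss" w] by (simp add: comp_def)
  then show "cyc_len (run ss (map swap_gen w)) = cyc_len (run (map Not ss) w)"
    "aba (run ss (map swap_gen w)) = bab (run (map Not ss) w)"
    using cyc_len_map[OF letter_perm_swap] stats_swap reduced_run assms by simp_all
qed

lemma run_True_late_cyc_len:
  assumes w: "reduced w" and late: "cyc_len w \<le> Suc (length ss)"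
  shows "cyc_len (run (ss @ [True]) w) \<le> cyc_len (run (ss @ [True, True]) w)"
    "cyc_len (run (ss @ [True, True]) w) = cyc_len (run (ss @ [True]) w) \<Longrightarrow>
      cyc_len (run (ss @ True # rs) w) = cyc_len (run (ss @ rs) w)"
proof -
  have eq: "run (ss @ [True, True]) w = sg (run (ss @ [True]) w)"
    using run_snoc(1)[of "ss @ [True]" w] by simp
  note diff = cyc_len_sg[OF reduced_run[OF w], of "ss @ [True]", folded eq]
  show "cyc_len (run (ss @ [True]) w) \<le> cyc_len (run (ss @ [True, True]) w)"
    using diff run_True_late(1)[OF w late] by simp
  assume "cyc_len (run (ss @ [True, True]) w) = cyc_len (run (ss @ [True]) w)"
  then have "conj_F2 (sg (run ss w)) (run ss w)" using diff run_True_late(2)[OF w late] by simp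
  from cyc_len_conj[OF conj_run[OF this reduced_run[OF w]]]
  show "cyc_len (run (ss @ True # rs) w) = cyc_len (run (ss @ rs) w)"
    by (simp add: run_append run_Cons reduced_run w)
qed

lemma growth_run:
  assumes w: "reduced w" "w \<noteq> []" and M: "cyc_len w \<le> M"
  shows "growth (\<lambda>ss. int (cyc_len (run ss w))) (\<lambda>ss. aba (run ss w)) (\<lambda>ss. bab (run ss w)) M"
proof
  fix ss rs :: "bool list"
  let ?v = "run ss w"
  let ?w = "map swap_gen w"
  have v: "reduced ?v" using reduced_run w(1) by blast
  have sw: "reduced ?w" "cyc_len ?w \<le> M" using w M cyc_len_map[OF letter_perm_swap w(1)] by (simp_all add: reduced_map)
  have st: "run [True] x = sg x" "run [False] x = ta x" for x by (simp_all add: run_def)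
  note len = cyc_len_sg cyc_len_ta
  show "0 < int (cyc_len ?v)" using cyc_len_pos[OF v run_neq_Nil[OF w]] by simp
  show "int (cyc_len (run (ss @ [True, True]) w)) - int (cyc_len (run (ss @ [True]) w)) =
      int (cyc_len (run (ss @ [True]) w)) - int (cyc_len ?v) + 2 * aba ?v"
    using len[OF v] len[OF reduced_shear(1), of ?v] sg_stats(1-3)[OF v] by (simp add: run_append st run_Cons)
  show "int (cyc_len (run (ss @ [False, True]) w)) - int (cyc_len (run (ss @ [False]) w)) =
      int (cyc_len (run (ss @ [True]) w)) - int (cyc_len ?v) +
      (int (cyc_len (run (ss @ [False, False]) w)) - int (cyc_len (run (ss @ [False]) w)))"
    using len[OF v] len[OF reduced_shear(3), of ?v] ta_stats(1-3)[OF v] by (simp add: run_append st run_Cons)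
  show "int (cyc_len (run (ss @ [False, False]) w)) - int (cyc_len (run (ss @ [False]) w)) =
      int (cyc_len (run (ss @ [False]) w)) - int (cyc_len ?v) + 2 * bab ?v"
    using len[OF v] len[OF reduced_shear(3), of ?v] ta_stats(1-3)[OF v] by (simp add: run_append st run_Cons)
  show "int (cyc_len (run (ss @ [True, False]) w)) - int (cyc_len (run (ss @ [True]) w)) =
      int (cyc_len (run (ss @ [False]) w)) - int (cyc_len ?v) +
      (int (cyc_len (run (ss @ [True, True]) w)) - int (cyc_len (run (ss @ [True]) w)))"
    using len[OF v] len[OF reduced_shear(1), of ?v] sg_stats(1-3)[OF v] by (simp add: run_append st run_Cons)
  show "0 \<le> aba ?v" "0 \<le> bab ?v" using sg_stats(8)[OF v] ta_stats(6)[OF v] .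
  show "aba (run (ss @ [False]) w) \<le> aba ?v" "bab (run (ss @ [True]) w) \<le> bab ?v"
    using sg_stats(4)[OF v] ta_stats(4)[OF v] by simp_all
  show "aba (run (ss @ [False]) w) = aba ?v" if "bab ?v = 0" using ta_stats(5)[OF v that] by simp
  show "bab (run (ss @ [True]) w) = bab ?v" if "aba ?v = 0" using sg_stats(5)[OF v that] by simp
  have sub: "set (drop M xs) \<subseteq> set (drop k xs)" if "k \<le> M" for k and xs :: "bool list"
    using set_drop_subset_set_drop[OF that] .
  show "True \<notin> set (drop M ss)" if "aba ?v \<noteq> 0"
    using aba_run_late[OF that w(1)] sub[OF M] by blast
  show "False \<notin> set (drop M ss)" if "bab ?v \<noteq> 0"
  proof -
    have "aba (run (map Not ss) ?w) \<noteq> 0" using that run_swap(2)[OF w(1), of "map Not ss"] by (simp add: comp_def)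
    then have "True \<notin> set (drop M (map Not ss))" using aba_run_late[OF _ sw(1)] sub[OF sw(2)] by blast
    then show ?thesis by (auto simp: drop_map)
  qed
  have swap_late: "cyc_len ?w \<le> Suc (length (map Not ss))" if "M \<le> Suc (length ss)" using that sw(2) by simp
  have sws: "cyc_len (run (map Not xs) ?w) = cyc_len (run xs w)" for xs
    using run_swap(1)[OF w(1), of "map Not xs"] by (simp add: comp_def)
  show "int (cyc_len (run (ss @ [True]) w)) \<le> int (cyc_len (run (ss @ [True, True]) w))" if "M \<le> Suc (length ss)"
    using run_True_late_cyc_len(1)[OF w(1)] that M by simp
  show "int (cyc_len (run (ss @ [False]) w)) \<le> int (cyc_len (run (ss @ [False, False]) w))" if "M \<le> Suc (length ss)"
    using run_True_late_cyc_len(1)[OF sw(1) swap_late[OF that]] sws[of "ss @ [False]"] sws[of "ss @ [False, False]"] by simp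
  show "int (cyc_len (run (ss @ True # rs) w)) = int (cyc_len (run (ss @ rs) w))"
    if "M \<le> Suc (length ss)" "int (cyc_len (run (ss @ [True, True]) w)) = int (cyc_len (run (ss @ [True]) w))"
    using run_True_late_cyc_len(2)[OF w(1)] that M by simp
  show "int (cyc_len (run (ss @ False # rs) w)) = int (cyc_len (run (ss @ rs) w))"
    if "M \<le> Suc (length ss)" "int (cyc_len (run (ss @ [False, False]) w)) = int (cyc_len (run (ss @ [False]) w))"
    using run_True_late_cyc_len(2)[OF sw(1) swap_late[OF that(1)], of "map Not rs"] that(2)
      sws[of "ss @ [False]"] sws[of "ss @ [False, False]"] sws[of "ss @ False # rs"] sws[of "ss @ rs"] by simp
  \<comment> \<open>Origin of the uniform lower bound: turns never increase along a chain, and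
    initially twice their number is at most the cyclic length.\<close>
  have "2 * neg_turns ?v \<le> int M"
    using neg_turns_run_le[OF w(1), of ss] sg_stats(7)[OF w(1)] cyc_len_stats[OF w(1)] M by linarith
  then show "- int M \<le> int (cyc_len (run (ss @ [True]) w)) - int (cyc_len ?v)"
    "- int M \<le> int (cyc_len (run (ss @ [False]) w)) - int (cyc_len ?v)"
    using len[OF v] sg_stats(9)[OF v] ta_stats(7)[OF v] by simp_all
qed

section \<open>Chains as elements of the automorphism group\<close>

lemma carrier_Aut_F2: "carrier Aut_F2 = auto F2"
  by (simp add: AutoGroup_def)

lemma Aut_F2_mult: "f \<in> auto F2 \<Longrightarrow> h \<in> auto F2 \<Longrightarrow> reduced w \<Longrightarrow> (f \<otimes>\<^bsub>Aut_F2\<^esub> h) w = f (h w)"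
  by (simp add: AutoGroup_def BijGroup_def auto_def compose_def)

lemma Aut_F2_one: "reduced w \<Longrightarrow> \<one>\<^bsub>Aut_F2\<^esub> w = w"
  by (simp add: AutoGroup_def BijGroup_def)

lemma auto_reduced: "f \<in> auto F2 \<Longrightarrow> reduced w \<Longrightarrow> reduced (f w)"
  using is_autD(2) is_aut_auto by blast

lemma Aut_F2_inv:
  assumes f: "f \<in> auto F2" and "reduced w" "reduced v" "f v = w"
  shows "(inv\<^bsub>Aut_F2\<^esub> f) w = v"
proof -
  have i: "inv\<^bsub>Aut_F2\<^esub> f \<in> auto F2" using Aut_F2.inv_closed[of f] f by (simp add: carrier_Aut_F2)
  have "(inv\<^bsub>Aut_F2\<^esub> f \<otimes>\<^bsub>Aut_F2\<^esub> f) v = v"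
    using Aut_F2.l_inv[of f] f assms(3) by (simp add: carrier_Aut_F2 Aut_F2_one)
  then show ?thesis using Aut_F2_mult[OF i f assms(3)] assms(4) by simp
qed

lemma Aut_F2_nat_pow:
  assumes f: "f \<in> auto F2" and eq: "\<And>w. reduced w \<Longrightarrow> f w = h w" and w: "reduced w"
  shows "(f [^]\<^bsub>Aut_F2\<^esub> (n::nat)) w = (h ^^ n) w"
  using w
proof (induction n arbitrary: w)
  case (Suc n)
  have p: "f [^]\<^bsub>Aut_F2\<^esub> n \<in> auto F2" using Aut_F2.nat_pow_closed[of f n] f by (simp add: carrier_Aut_F2)
  have "(f [^]\<^bsub>Aut_F2\<^esub> Suc n) w = (f [^]\<^bsub>Aut_F2\<^esub> n) (f w)"
    using Aut_F2_mult[OF p f Suc.prems] by simp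
  then show ?case
    using Suc.IH[OF auto_reduced[OF f Suc.prems]] eq[OF Suc.prems] by (simp add: funpow_swap1)
qed (simp add: Aut_F2_one)

definition shear :: "bool \<Rightarrow> bool \<Rightarrow> word \<Rightarrow> word"
  where "shear pos s = (if pos then if s then sg else ta else if s then sgi else tai)"

definition shears :: "bool \<Rightarrow> bool list \<Rightarrow> word \<Rightarrow> word"
  where "shears pos ss w = fold (shear pos) ss w"

lemma shears_True: "shears True ss w = run ss w"
  by (simp add: shears_def run_def shear_def cong: fold_cong)

lemma shears_append: "shears pos (ss @ ts) w = shears pos ts (shears pos ss w)"
  by (simp add: shears_def)

lemma shears_Nil [simp]: "shears pos [] w = w"
  by (simp add: shears_def)

lemma shears_replicate: "shears pos (replicate n s) w = (shear pos s ^^ n) w"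
  by (induction n arbitrary: w) (simp_all add: shears_def funpow_swap1)

lemma reduced_shear' [simp]: "reduced (shear pos s w)"
  by (simp add: shear_def)

lemma reduced_shears: "reduced w \<Longrightarrow> reduced (shears pos ss w)"
  by (induction ss arbitrary: w) (simp_all add: shears_def)

lemma tau_inverse_eq: "reduced w \<Longrightarrow> tai (ta w) = w" "reduced w \<Longrightarrow> ta (tai w) = w"
  using tai_ta sg_sgi[of "map swap_gen w"] 
  by (simp, metis letter_perm_swap map_swap_gen_invol map_swap_sgi map_swap_sg reduced_map)

definition signed :: "bool \<Rightarrow> (word \<Rightarrow> word) \<Rightarrow> word \<Rightarrow> word"
  where "signed pos f = (if pos then f else inv\<^bsub>Aut_F2\<^esub> f)"

lemma signed_auto: "f \<in> auto F2 \<Longrightarrow> signed pos f \<in> auto F2"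
  using Aut_F2.inv_closed[of f] by (simp add: signed_def carrier_Aut_F2)

lemma signed_sigma: "reduced w \<Longrightarrow> signed pos sigma w = shear pos True w"
  using Aut_F2_inv[OF sigma_auto, of w "sgi w"] by (simp add: signed_def shear_def sigma_eq sg_sgi)

lemma signed_tau: "reduced w \<Longrightarrow> signed pos tau w = shear pos False w"
  using Aut_F2_inv[OF tau_auto, of w "tai w"] by (simp add: signed_def shear_def tau_eq tau_inverse_eq)

lemma int_pow_signed:
  assumes "f \<in> auto F2"
  shows "f [^]\<^bsub>Aut_F2\<^esub> (if pos then int n else - int n) = signed pos f [^]\<^bsub>Aut_F2\<^esub> n"
  using assms Aut_F2.int_pow_neg_int[of f n] Aut_F2.nat_pow_inv[of f n]
  by (simp add: signed_def int_pow_int carrier_Aut_F2)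

lemma sigma_int_pow:
  "reduced w \<Longrightarrow> (sigma [^]\<^bsub>Aut_F2\<^esub> (if pos then int n else - int n)) w = shears pos (replicate n True) w"
  unfolding int_pow_signed[OF sigma_auto] shears_replicate
  by (rule Aut_F2_nat_pow[OF signed_auto[OF sigma_auto] signed_sigma])

lemma tau_int_pow:
  "reduced w \<Longrightarrow> (tau [^]\<^bsub>Aut_F2\<^esub> (if pos then int n else - int n)) w = shears pos (replicate n False) w"
  unfolding int_pow_signed[OF tau_auto] shears_replicate
  by (rule Aut_F2_nat_pow[OF signed_auto[OF tau_auto] signed_tau])

lemma letter_int_pow:
  "reduced w \<Longrightarrow> ((if s then sigma else tau) [^]\<^bsub>Aut_F2\<^esub> (if pos then int n else - int n)) w =
    shears pos (replicate n s) w"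
  by (cases s) (simp_all only: if_True if_False sigma_int_pow tau_int_pow)

definition chain :: "bool \<Rightarrow> (nat \<times> nat) list \<Rightarrow> word \<Rightarrow> word"
  where "chain pos = (if pos then chain1 else chain2)"

lemma chain_simps:
  "chain pos [] = \<one>\<^bsub>Aut_F2\<^esub>"
  "chain pos ((l, m) # ps) = chain pos ps \<otimes>\<^bsub>Aut_F2\<^esub>
    (tau [^]\<^bsub>Aut_F2\<^esub> (if pos then int m else - int m) \<otimes>\<^bsub>Aut_F2\<^esub> sigma [^]\<^bsub>Aut_F2\<^esub> (if pos then int l else - int l))"
  by (simp_all add: chain_def)

lemma chain_auto: "chain pos ps \<in> auto F2"
proof (induction ps)
  case (Cons p ps)
  then show ?case
    using sigma_auto tau_auto by (cases p) (simp add: chain_simps flip: carrier_Aut_F2)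
qed (simp add: chain_simps flip: carrier_Aut_F2)

definition flat :: "(nat \<times> nat) list \<Rightarrow> bool list"
  where "flat ps = concat (map (\<lambda>(l, m). replicate l True @ replicate m False) ps)"

lemma length_flat: "length (flat ps) = chain_length ps"
  by (induction ps) (auto simp: flat_def chain_length_def)

lemma chain_apply: "reduced w \<Longrightarrow> chain pos ps w = shears pos (flat ps) w"
proof (induction ps arbitrary: w)
  case (Cons p ps)
  obtain l m where p: "p = (l, m)" by (cases p)
  let ?t = "tau [^]\<^bsub>Aut_F2\<^esub> (if pos then int m else - int m)" and ?s = "sigma [^]\<^bsub>Aut_F2\<^esub> (if pos then int l else - int l)"
  have au: "?t \<in> auto F2" "?s \<in> auto F2" "?t \<otimes>\<^bsub>Aut_F2\<^esub> ?s \<in> auto F2"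
    using sigma_auto tau_auto by (simp_all flip: carrier_Aut_F2)
  have r: "reduced (?t (?s w))" using au(1,2) Cons.prems auto_reduced by blast
  have "chain pos (p # ps) w = chain pos ps (?t (?s w))"
    unfolding p chain_simps using Aut_F2_mult[OF chain_auto au(3) Cons.prems] Aut_F2_mult[OF au(1,2) Cons.prems] by simp
  also have "\<dots> = shears pos (flat ps) (?t (?s w))" by (rule Cons.IH[OF r])
  also have "?t (?s w) = shears pos (replicate l True @ replicate m False) w"
    using tau_int_pow[OF auto_reduced[OF au(2) Cons.prems]] sigma_int_pow[OF Cons.prems] by (simp add: shears_append)
  finally show ?case by (simp add: p flat_def shears_append)
qed (simp add: chain_simps flat_def Aut_F2_one)

definition chains :: "bool \<Rightarrow> nat \<Rightarrow> (word \<Rightarrow> word) set"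
  where "chains pos N = {chain pos ps | ps. chain_length ps \<le> N}"

lemma Omega_chains: "Omega1 N = chains True N" "Omega2 N = chains False N"
  by (simp_all add: Omega1_def Omega2_def chains_def chain_def)

lemma chainsD:
  assumes "\<psi> \<in> chains pos N"
  obtains ss where "length ss \<le> N" "\<And>w. reduced w \<Longrightarrow> \<psi> w = shears pos ss w"
proof -
  obtain ps where ps: "\<psi> = chain pos ps" "chain_length ps \<le> N" using assms by (auto simp: chains_def)
  show thesis by (rule that[of "flat ps"]) (use ps chain_apply in \<open>auto simp: length_flat\<close>)
qed

lemma chainsI:
  assumes "length ss \<le> N"
  obtains \<psi> where "\<psi> \<in> chains pos N" "\<And>w. reduced w \<Longrightarrow> \<psi> w = shears pos ss w"
proof -
  \<comment> \<open>A chain may contain exponents 0, so each letter gets a pair of its own and runs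
    of equal letters need not be grouped.\<close>
  define ps :: "(nat \<times> nat) list" where "ps = map (\<lambda>s. if s then (1, 0) else (0, 1)) ss"
  have fl: "flat ps = ss" unfolding ps_def flat_def by (induction ss) auto
  show thesis
  proof (rule that[of "chain pos ps"])
    show "chain pos ps \<in> chains pos N" using assms length_flat[of ps] fl by (auto simp: chains_def)
  qed (simp add: chain_apply fl)
qed

definition flip :: "bool \<Rightarrow> word \<Rightarrow> word"
  where "flip pos w = (if pos then w else map flip_b w)"

lemma reduced_flip [simp]: "reduced (flip pos w) = reduced w"
  by (simp add: flip_def reduced_map)

lemma flip_eq_Nil [simp]: "flip pos w = [] \<longleftrightarrow> w = []"
  by (simp add: flip_def)

lemma cyc_len_flip: "reduced w \<Longrightarrow> cyc_len (flip pos w) = cyc_len w"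
  by (simp add: flip_def cyc_len_map)

text \<open>Inverting \<open>b\<close> carries the inverse of \<sigma> to \<sigma> exactly, but the
  inverse of \<tau> to \<tau> only up to an inner automorphism; hence the comparison of cyclic
  lengths and not of words.\<close>

lemma cyc_len_shears:
  assumes "reduced w"
  shows "cyc_len (shears pos ss w) = cyc_len (run ss (flip pos w))"
proof (cases pos)
  case False
  have "conj_F2 (map flip_b (shears False ss w)) (run ss (map flip_b w))"
    using assms
  proof (induction ss arbitrary: w)
    case Nil
    then show ?case by (simp add: conj_F2_refl reduced_map)
  next
    case (Cons s ss)
    have "conj_F2 (map flip_b (shear False s w)) (shear True s (map flip_b w))"
      using map_flip_sgi[of w] map_flip_tai[OF Cons.prems] by (simp add: shear_def conj_F2_refl)
    then have "conj_F2 (run ss (map flip_b (shear False s w))) (run ss (shear True s (map flip_b w)))"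
      by (rule conj_run) simp
    then have "conj_F2 (map flip_b (shears False ss (shear False s w))) (run ss (shear True s (map flip_b w)))"
      using conj_F2_trans[OF Cons.IH[OF reduced_shear']] reduced_run[OF reduced_shear'] by blast
    then show ?case by (cases s) (simp_all add: shears_def run_Cons shear_def)
  qed
  then show ?thesis
    using cyc_len_conj[of "map flip_b (shears False ss w)" "run ss (map flip_b w)"]
      cyc_len_map[OF letter_perm_flip_b reduced_shears[OF assms, of False ss]] False assms
    by (simp add: flip_def reduced_run reduced_map)
qed (simp add: shears_True flip_def)

lemma incr_shear:
  assumes "reduced w" "\<And>x. reduced x \<Longrightarrow> \<psi> x = shears pos ss x" "\<And>x. reduced x \<Longrightarrow> \<beta> x = shear pos s x"
  shows "incr \<beta> \<psi> w = real_of_int (max 1 (int (cyc_len (run (ss @ [s]) (flip pos w))) - int (cyc_len (run ss (flip pos w)))))"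
proof -
  have "\<beta> (\<psi> w) = shears pos (ss @ [s]) w"
    using assms reduced_shears by (simp add: shears_append) (simp add: shears_def)
  then show ?thesis
    unfolding incr_def using cyc_len_shears[OF assms(1)] assms(1,2) by simp
qed

text \<open>\<open>zero\<close> speaks of the powers \<open>M + 1\<close> and \<open>M + 2\<close>
  after a chain of length \<open>M + 1\<close>; constancy of late increments reduces it to the first
  two powers, as \<open>growth_pair\<close> requires.\<close>

lemma growth_pair_bounds:
  assumes u: "reduced u" "u \<noteq> []" "cyc_len u \<le> M" and v: "reduced v" "v \<noteq> []" "cyc_len v \<le> M"
    and zero: "\<And>ss s. length ss = Suc M \<Longrightarrow>
      cyc_len (run (ss @ replicate (Suc (Suc M)) s) u) = cyc_len (run (ss @ replicate (Suc M) s) u) \<longleftrightarrow>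
      cyc_len (run (ss @ replicate (Suc (Suc M)) s) v) = cyc_len (run (ss @ replicate (Suc M) s) v)"
    and init: "\<And>ss. length ss \<le> 2 * M + 5 \<Longrightarrow>
      ratios_within lo hi (\<lambda>ss. int (cyc_len (run ss u))) (\<lambda>ss. int (cyc_len (run ss v))) ss"
  shows "ratios_within lo hi (\<lambda>ss. int (cyc_len (run ss u))) (\<lambda>ss. int (cyc_len (run ss v))) ss"
proof -
  note gu = growth_run[OF u] and gv = growth_run[OF v]
  have T: "cyc_len (run (ss @ replicate (Suc (Suc M)) True) x) = cyc_len (run (ss @ replicate (Suc M) True) x) \<longleftrightarrow>
      cyc_len (run (ss @ [True, True]) x) = cyc_len (run (ss @ [True]) x)"
    if "length ss = Suc M" and g: "growth (\<lambda>ss. int (cyc_len (run ss x))) p q M" for ss x p q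
    using growth.A_replicate_True[OF g, of ss M] that(1)
    by (simp add: replicate_append_same) linarith
  have F: "cyc_len (run (ss @ replicate (Suc (Suc M)) False) x) = cyc_len (run (ss @ replicate (Suc M) False) x) \<longleftrightarrow>
      cyc_len (run (ss @ [False, False]) x) = cyc_len (run (ss @ [False]) x)"
    if "length ss = Suc M" and g: "growth (\<lambda>ss. int (cyc_len (run ss x))) p q M" for ss x p q
    using growth.A_replicate_True[OF growth.swapped[OF g], of "map Not ss" M] that(1)
    by (simp add: comp_def replicate_append_same) linarith
  have "growth_pair (\<lambda>ss. int (cyc_len (run ss u))) (\<lambda>ss. aba (run ss u)) (\<lambda>ss. bab (run ss u))
      (\<lambda>ss. int (cyc_len (run ss v))) (\<lambda>ss. aba (run ss v)) (\<lambda>ss. bab (run ss v)) M lo hi"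
  proof (intro growth_pair.intro growth_pair_axioms.intro gu gv init)
    fix ss :: "bool list" assume len: "length ss = Suc M"
    show "(int (cyc_len (run (ss @ [True, True]) u)) = int (cyc_len (run (ss @ [True]) u))) =
        (int (cyc_len (run (ss @ [True, True]) v)) = int (cyc_len (run (ss @ [True]) v)))"
      using zero[OF len, of True] T[OF len gu] T[OF len gv] by simp
    show "(int (cyc_len (run (ss @ [False, False]) u)) = int (cyc_len (run (ss @ [False]) u))) =
        (int (cyc_len (run (ss @ [False, False]) v)) = int (cyc_len (run (ss @ [False]) v)))"
      using zero[OF len, of False] F[OF len gu] F[OF len gv] by simp
  qed
  then show ?thesis by (rule growth_pair.ratios_within_all)
qed

section \<open>The set \<open>Delta\<close> in terms of positive chains\<close>

definition chain_ratio :: "word \<Rightarrow> word \<Rightarrow> bool \<Rightarrow> bool list \<Rightarrow> real"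
  where "chain_ratio u v pos ss = cyc_len (run ss (flip pos u)) / cyc_len (run ss (flip pos v))"

definition step_growth :: "word \<Rightarrow> bool \<Rightarrow> bool list \<Rightarrow> bool \<Rightarrow> int"
  where "step_growth w pos ss s =
    max 1 (int (cyc_len (run (ss @ [s]) (flip pos w))) - int (cyc_len (run ss (flip pos w))))"

lemma step_growth_pos: "0 < step_growth w pos ss s"
  by (simp add: step_growth_def)

lemma signed_letter: "reduced w \<Longrightarrow> signed pos (if s then sigma else tau) w = shear pos s w"
  using signed_sigma signed_tau by simp

text \<open>Pairs of exponents may be (0, 0), so infinitely many lists describe chains of bounded
  length, but only finitely many letter sequences arise. Finiteness and positivity are read off from
  this indexing.\<close>

lemma Delta_eq:
  assumes u: "reduced u" and v: "reduced v"
  shows "Delta N u v = (\<Union>pos. \<Union>ss \<in> {ss. length ss \<le> N}.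
    insert (chain_ratio u v pos ss) (range (\<lambda>s. step_growth u pos ss s / step_growth v pos ss s)))"
proof -
  have ratio: "len_ratio \<psi> u v = chain_ratio u v pos ss" if "\<And>w. reduced w \<Longrightarrow> \<psi> w = shears pos ss w" for \<psi> pos ss
    using that u v by (simp add: len_ratio_def chain_ratio_def cyc_len_shears)
  have step: "incr (signed pos (if s then sigma else tau)) \<psi> w = step_growth w pos ss s"
    if "\<And>w. reduced w \<Longrightarrow> \<psi> w = shears pos ss w" "reduced w" for \<psi> pos ss s w
    unfolding step_growth_def by (rule incr_shear) (use that signed_letter in auto)
  let ?f = "\<lambda>pos ss. insert (chain_ratio u v pos ss) (range (\<lambda>s. step_growth u pos ss s / step_growth v pos ss s))"
  have Delta: "Delta N u v = (\<Union>pos. {len_ratio \<psi> u v | \<psi>. \<psi> \<in> chains pos N} \<union>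
    (\<Union>s. {incr (signed pos (if s then sigma else tau)) \<psi> u / incr (signed pos (if s then sigma else tau)) \<psi> v | \<psi>. \<psi> \<in> chains pos N}))"
    by (auto simp: Delta_def Omega_def Omega_chains UNIV_bool signed_def)
  have "{len_ratio \<psi> u v | \<psi>. \<psi> \<in> chains pos N} \<union>
    (\<Union>s. {incr (signed pos (if s then sigma else tau)) \<psi> u / incr (signed pos (if s then sigma else tau)) \<psi> v | \<psi>. \<psi> \<in> chains pos N})
    = (\<Union>ss \<in> {ss. length ss \<le> N}. ?f pos ss)" (is "?L pos = ?R pos") for pos
  proof
    show "?L pos \<subseteq> ?R pos"
    proof
      fix x assume "x \<in> ?L pos"
      then obtain \<psi> where \<psi>: "\<psi> \<in> chains pos N" "x = len_ratio \<psi> u v \<or>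
          (\<exists>s. x = incr (signed pos (if s then sigma else tau)) \<psi> u / incr (signed pos (if s then sigma else tau)) \<psi> v)"
        by blast
      obtain ss where ss: "length ss \<le> N" "\<And>w. reduced w \<Longrightarrow> \<psi> w = shears pos ss w"
        using chainsD[OF \<psi>(1)] by blast
      have "x \<in> ?f pos ss" using \<psi>(2) ratio[OF ss(2)] step[OF ss(2) u] step[OF ss(2) v] by auto
      then show "x \<in> ?R pos" using ss(1) by blast
    qed
    show "?R pos \<subseteq> ?L pos"
    proof
      fix x assume "x \<in> ?R pos"
      then obtain ss where ss: "length ss \<le> N" "x \<in> ?f pos ss" by blast
      obtain \<psi> where \<psi>: "\<psi> \<in> chains pos N" "\<And>w. reduced w \<Longrightarrow> \<psi> w = shears pos ss w"
        using chainsI[OF ss(1)] by blast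
      have "x = len_ratio \<psi> u v \<or>
          (\<exists>s. x = incr (signed pos (if s then sigma else tau)) \<psi> u / incr (signed pos (if s then sigma else tau)) \<psi> v)"
        using ss(2) ratio[OF \<psi>(2)] step[OF \<psi>(2) u] step[OF \<psi>(2) v] by auto
      then show "x \<in> ?L pos" using \<psi>(1) by blast
    qed
  qed
  then show ?thesis unfolding Delta by simp
qed

lemma finite_Delta: "reduced u \<Longrightarrow> reduced v \<Longrightarrow> finite (Delta N u v)"
  using finite_lists_length_le[of "UNIV :: bool set" N] by (simp add: Delta_eq)

lemma Delta_pos:
  assumes "reduced u" "u \<noteq> []" "reduced v" "v \<noteq> []" "x \<in> Delta N u v"
  shows "0 < x"
proof -
  have "0 < cyc_len (run ss (flip pos w))" if "reduced w" "w \<noteq> []" for w ss pos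
    using cyc_len_pos reduced_run run_neq_Nil that by simp
  then have "0 < chain_ratio u v pos ss" for pos ss using assms by (simp add: chain_ratio_def)
  then show ?thesis using assms(5) step_growth_pos Delta_eq[OF assms(1,3)] by auto
qed

lemma Delta_ratios_within:
  assumes u: "reduced u" "u \<noteq> []" and v: "reduced v" "v \<noteq> []" and "length ss \<le> N"
  shows "ratios_within (Min (Delta N u v)) (Max (Delta N u v))
    (\<lambda>ss. int (cyc_len (run ss (flip pos u)))) (\<lambda>ss. int (cyc_len (run ss (flip pos v)))) ss"
proof -
  have bounds: "Min (Delta N u v) \<le> x \<and> x \<le> Max (Delta N u v)" if "x \<in> Delta N u v" for x
    using finite_Delta[OF u(1) v(1)] that by simp
  have within: "ratio_within (Min (Delta N u v)) (Max (Delta N u v)) x y"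
    if "real_of_int x / real_of_int y \<in> Delta N u v" "0 < y" for x y :: int
    using bounds[OF that(1)] that(2) by (simp add: ratio_within_def field_simps)
  have "0 < cyc_len (run ss (flip pos v))" using cyc_len_pos reduced_run run_neq_Nil v by simp
  moreover have "chain_ratio u v pos ss \<in> Delta N u v"
    "step_growth u pos ss s / step_growth v pos ss s \<in> Delta N u v" for s
    using assms(5) by (auto simp: Delta_eq[OF u(1) v(1)])
  ultimately have "ratio_within (Min (Delta N u v)) (Max (Delta N u v))
      (int (cyc_len (run ss (flip pos u)))) (int (cyc_len (run ss (flip pos v))))"
    "ratio_within (Min (Delta N u v)) (Max (Delta N u v)) (step_growth u pos ss s) (step_growth v pos ss s)" for s
    by (intro within; simp add: chain_ratio_def step_growth_pos)+
  then show ?thesis unfolding ratios_within_def step_growth_def by blast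
qed

text \<open>Cyclic length ignores the inner automorphism and the outer permutation. The inner flip
  remains and decides which of the two types of chain is used.\<close>

lemma aut_cyc_len_chain:
  assumes "\<phi> \<in> auto F2"
  obtains pos ss where "\<And>w. reduced w \<Longrightarrow> cyc_len (\<phi> w) = cyc_len (run ss (flip pos w))"
proof -
  obtain p q ss where d: "letter_perm p" "q \<in> {id, flip_b}"
    "\<And>w. reduced w \<Longrightarrow> conj_F2 (\<phi> w) (map p (run ss (map q w)))"
    using aut_decomp[OF is_aut_auto[OF assms]] unfolding decomp_def by blast
  have "cyc_len (\<phi> w) = cyc_len (run ss (flip (q = id) w))" if w: "reduced w" for w
  proof -
    have q: "map q w = flip (q = id) w" using d(2) by (auto simp: flip_def)
    have r: "reduced (run ss (flip (q = id) w))" using reduced_run w by simp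
    show ?thesis
      using cyc_len_conj[OF d(3)[OF w]] cyc_len_map[OF d(1) r] r by (simp add: q reduced_map d(1))
  qed
  then show thesis by (rule that)
qed

theorem theorem3p7:
  fixes u v :: word and k N :: nat
  assumes "u \<in> carrier F2" and "v \<in> carrier F2"
    and "u \<noteq> \<one>\<^bsub>F2\<^esub>" and "v \<noteq> \<one>\<^bsub>F2\<^esub>"
    and "cyc_len u \<ge> cyc_len v"
    and "N = 2 * cyc_len u + 5"
    and "k = cyc_len u + 1"
    and "\<And>\<psi>\<^sub>1. \<psi>\<^sub>1 \<in> Omega1 N \<Longrightarrow>
      cyc_len ((sigma [^]\<^bsub>Aut_F2\<^esub> (int k + 1)) (\<psi>\<^sub>1 u)) = cyc_len ((sigma [^]\<^bsub>Aut_F2\<^esub> int k) (\<psi>\<^sub>1 u)) \<longleftrightarrow>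
      cyc_len ((sigma [^]\<^bsub>Aut_F2\<^esub> (int k + 1)) (\<psi>\<^sub>1 v)) = cyc_len ((sigma [^]\<^bsub>Aut_F2\<^esub> int k) (\<psi>\<^sub>1 v))"
    and "\<And>\<psi>\<^sub>1. \<psi>\<^sub>1 \<in> Omega1 N \<Longrightarrow>
      cyc_len ((tau [^]\<^bsub>Aut_F2\<^esub> (int k + 1)) (\<psi>\<^sub>1 u)) = cyc_len ((tau [^]\<^bsub>Aut_F2\<^esub> int k) (\<psi>\<^sub>1 u)) \<longleftrightarrow>
      cyc_len ((tau [^]\<^bsub>Aut_F2\<^esub> (int k + 1)) (\<psi>\<^sub>1 v)) = cyc_len ((tau [^]\<^bsub>Aut_F2\<^esub> int k) (\<psi>\<^sub>1 v))"
    and "\<And>\<psi>\<^sub>2. \<psi>\<^sub>2 \<in> Omega2 N \<Longrightarrow>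
      cyc_len ((sigma [^]\<^bsub>Aut_F2\<^esub> (- int k - 1)) (\<psi>\<^sub>2 u)) = cyc_len ((sigma [^]\<^bsub>Aut_F2\<^esub> (- int k)) (\<psi>\<^sub>2 u)) \<longleftrightarrow>
      cyc_len ((sigma [^]\<^bsub>Aut_F2\<^esub> (- int k - 1)) (\<psi>\<^sub>2 v)) = cyc_len ((sigma [^]\<^bsub>Aut_F2\<^esub> (- int k)) (\<psi>\<^sub>2 v))"
    and "\<And>\<psi>\<^sub>2. \<psi>\<^sub>2 \<in> Omega2 N \<Longrightarrow>
      cyc_len ((tau [^]\<^bsub>Aut_F2\<^esub> (- int k - 1)) (\<psi>\<^sub>2 u)) = cyc_len ((tau [^]\<^bsub>Aut_F2\<^esub> (- int k)) (\<psi>\<^sub>2 u)) \<longleftrightarrow>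
      cyc_len ((tau [^]\<^bsub>Aut_F2\<^esub> (- int k - 1)) (\<psi>\<^sub>2 v)) = cyc_len ((tau [^]\<^bsub>Aut_F2\<^esub> (- int k)) (\<psi>\<^sub>2 v))"
  shows "bdd_trans_equiv u v
    \<and> finite (Delta N u v) \<and> (\<forall>x \<in> Delta N u v. 0 < x)
    \<and> (\<forall>\<phi> \<in> carrier Aut_F2.
         Min (Delta N u v) \<le> len_ratio \<phi> u v \<and> len_ratio \<phi> u v \<le> Max (Delta N u v))"
proof -
  define M where "M = cyc_len u"
  have u: "reduced u" "u \<noteq> []" and v: "reduced v" "v \<noteq> []" using assms(1-4) by simp_all
  have N: "N = 2 * M + 5" and k: "k = Suc M" using assms(6,7) by (simp_all add: M_def)
  define lo hi where "lo = Min (Delta N u v)" and "hi = Max (Delta N u v)"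
  \<comment> \<open>Chains of length \<open>M + 1\<close> are where the induction of
    \<open>zeros\<close> starts; they lie well within the bound \<open>N\<close>, so the hypotheses
    apply to them.\<close>
  have zero: "cyc_len (run (ss @ replicate (Suc k) s) (flip pos u)) = cyc_len (run (ss @ replicate k s) (flip pos u)) \<longleftrightarrow>
      cyc_len (run (ss @ replicate (Suc k) s) (flip pos v)) = cyc_len (run (ss @ replicate k s) (flip pos v))"
    if "length ss = Suc M" for ss s pos
  proof -
    have "length ss \<le> N" using that N by simp
    then obtain \<psi> where \<psi>: "\<psi> \<in> chains pos N" "\<And>w. reduced w \<Longrightarrow> \<psi> w = shears pos ss w"
      using chainsI by blast
    have pow: "cyc_len (((if s then sigma else tau) [^]\<^bsub>Aut_F2\<^esub> (if pos then int n else - int n)) (\<psi> w)) =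
        cyc_len (run (ss @ replicate n s) (flip pos w))" if "reduced w" for n w
      using letter_int_pow[OF reduced_shears[OF that]] \<psi>(2)[OF that]
        cyc_len_shears[OF that, of pos "ss @ replicate n s"] by (simp only: shears_append)
    have e: "(if pos then int (Suc k) else - int (Suc k)) = (if pos then int k + 1 else - int k - 1)" by simp
    note pows = pow[OF u(1), of k] pow[OF u(1), of "Suc k", unfolded e]
      pow[OF v(1), of k] pow[OF v(1), of "Suc k", unfolded e]
    show ?thesis
      unfolding pows[symmetric] using assms(8-11)[of \<psi>] \<psi>(1)
      by (cases pos; cases s) (simp_all only: Omega_chains if_True if_False)
  qed
  have chain: "ratios_within lo hi (\<lambda>ss. int (cyc_len (run ss (flip pos u)))) (\<lambda>ss. int (cyc_len (run ss (flip pos v)))) ss"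
    for pos ss
  proof (rule growth_pair_bounds)
    show "ratios_within lo hi (\<lambda>ss. int (cyc_len (run ss (flip pos u)))) (\<lambda>ss. int (cyc_len (run ss (flip pos v)))) ss"
      if "length ss \<le> 2 * M + 5" for ss
      unfolding lo_def hi_def by (rule Delta_ratios_within) (use u v that N in auto)
    show "cyc_len (flip pos u) \<le> M" "cyc_len (flip pos v) \<le> M"
      using u v assms(5) by (simp_all add: cyc_len_flip M_def)
  qed (use u v in \<open>simp_all only: reduced_flip flip_eq_Nil not_False_eq_True zero[unfolded k]\<close>)
  have main: "lo \<le> len_ratio \<phi> u v \<and> len_ratio \<phi> u v \<le> hi" if \<phi>: "\<phi> \<in> carrier Aut_F2" for \<phi>
  proof -
    obtain pos ss where ss: "\<And>w. reduced w \<Longrightarrow> cyc_len (\<phi> w) = cyc_len (run ss (flip pos w))"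
      by (rule aut_cyc_len_chain[OF \<phi>[unfolded carrier_Aut_F2]]) (rule that)
    have "0 < cyc_len (run ss (flip pos v))" using cyc_len_pos reduced_run run_neq_Nil v by simp
    then show ?thesis
      using chain[of pos ss] ss u(1) v(1)
      by (simp add: ratios_within_def ratio_within_def len_ratio_def field_simps)
  qed
  have fin: "finite (Delta N u v)" by (rule finite_Delta[OF u(1) v(1)])
  have pos: "\<forall>x \<in> Delta N u v. 0 < x" using Delta_pos[OF u v] by blast
  have "Delta N u v \<noteq> {}" using Delta_eq[OF u(1) v(1), of N] by (auto intro!: exI[of _ "[]"])
  then have "0 < lo" using Min_in[OF fin] pos by (simp add: lo_def)
  have "bdd_trans_equiv u v"
    unfolding bdd_trans_equiv_def
  proof (intro exI[of _ "max hi (1 / lo)"] conjI ballI)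
    have "0 < 1 / lo" using \<open>0 < lo\<close> by simp
    then show C: "0 < max hi (1 / lo)" by linarith
    fix \<phi> assume \<phi>: "\<phi> \<in> carrier Aut_F2"
    have "1 / max hi (1 / lo) \<le> 1 / (1 / lo)" 
      using \<open>0 < lo\<close> C by (intro divide_left_mono mult_pos_pos) simp_all
    then show "1 / max hi (1 / lo) \<le> len_ratio \<phi> u v" using main[OF \<phi>] by simp
    show "len_ratio \<phi> u v \<le> max hi (1 / lo)" using main[OF \<phi>] by linarith
  qed
  then show ?thesis using fin pos main unfolding lo_def hi_def by blast
qed

end
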